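(* Let $(\Xi^n)_{n\ge 0}$ be generated by an edge iterated graph system (EIGS) satisfying the standing assumptions (canonical, distance-positive, degree-primitive, single-edge initial graph). There exist constants $c_{\mathrm{exit}},C_{\mathrm{exit}}>0$, depending only on the EIGS, such that the following holds. Let $n\in\mathbb N$, let $v\in V_k(\Xi^n)$ be a vertex of birth level $k$, let $m$ be an integer with $c_0+1\le m\le n-k-c_0$, and let $r>0$ satisfy $c_{\mathrm d}\rho_{\min}(\mathcal D)^m\le r\le C_{\mathrm d}\rho_{\min}(\mathcal D)^m$. Then $$c_{\mathrm{exit}}\,\rho(\mathbf M)^m\rho(\Psi)^m\le\mathbb E^v\big[\tau^{\Xi^n}_{B_{\Xi^n}(v,r)^{\mathrm c}}\big]\le C_{\mathrm{exit}}\,\rho(\mathbf M)^m\rho(\Psi)^m.$$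
   Context: **EIGS.** Fix $K\ge1$ colours $[K]=\{1,\dots,K\}$. An edge iterated graph system (EIGS) consists of finite directed rule graphs $R_1,\dots,R_K$ whose edges are coloured by a map $\mathscr C$ with values in $[K]$, each $R_i$ having two distinct planting vertices $\beta_i^+\ne\beta_i^-$, and an initial graph $\Xi^0$, which is a single directed edge of some colour with endpoints $\mathfrak v_+,\mathfrak v_-$. Given $\Xi^n$, the graph $\Xi^{n+1}$ is obtained by simultaneously replacing every directed edge $e=(a,b)$ of colour $i$ by a fresh copy of $R_i$, identifying $a\equiv\beta_i^+$, $b\equiv\beta_i^-$, with no other identifications. Thus $V(\Xi^n)\subset V(\Xi^{n+1})$. $V_k(\Xi^n)=V(\Xi^k)\setminus V(\Xi^{k-1})$ (with $V(\Xi^{-1})=\emptyset$) is the set of vertices of birth level $k\le n$. $\Xi_j^n$ denotes the graph obtained when the initial edge has colour $j$. Distances $d_G$, degrees, paths, balls $B_G(v,r)=\{u:d_G(v,u)<r\}$, random walks and resistances refer to underlying undirected graphs, which are assumed simple and connected. **Matrices.** $\mathbf M\in\mathbb N^{K\times K}$: $[\mathbf M]_{ij}$ is the number of $j$-coloured edges of $R_i$. $\mathbf N\in\mathbb N^{2K\times2K}$ has rows $\kappa_{R_1}(\beta_1^+),\kappa_{R_1}(\beta_1^-),\dots,\kappa_{R_K}(\beta_K^+),\kappa_{R_K}(\beta_K^-)$, where $[\kappa_G(v)]_{2j-1}$ (resp. $[\kappa_G(v)]_{2j}$) is the number of $j$-coloured edges of $G$ leaving (resp. entering) $v$. $\mathcal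 D$ is the finite set of $K\times K$ matrices obtained by choosing, for each $i$, a simple path in $R_i$ between $\beta_i^+$ and $\beta_i^-$ and letting the $(i,j)$ entry be the number of $j$-coloured edges on the chosen path. $\rho(\cdot)$ is the spectral radius and $\rho_{\min}(\mathcal D)=\min_{D\in\mathcal D}\rho(D)$. **Resistance map.** For $\mathbf x\in(0,\infty)^K$, $[\Psi(\mathbf x)]_i$ is the effective resistance between $\beta_i^+$ and $\beta_i^-$ in $R_i$ when each $j$-coloured edge has resistance $[\mathbf x]_j$. There is a unique $\rho(\Psi)>0$ for which $\Psi(\mathbf v)=\rho(\Psi)\mathbf v$ has a solution $\mathbf v\in(0,\infty)^K$. **Standing assumptions.** (1) Canonical: every edge of every $R_i$ lies on a simple path joining $\beta_i^+$ and $\beta_i^-$. (2) Distance-positive: all matrices in $\mathcal D$ have positive entries; if $K=1$, additionally $d_{R_1}(\beta_1^+,\beta_1^-)\ge2$. (3) $\mathbf N$ is primitive. (4) $\Xi^0$ is a single edge. **Constants.** $c_{\mathrm d},C_{\mathrm d}>0$ are fixed constants with $c_{\mathrm d}\rho_{\min}(\mathcal D)^m\le d_{\Xi_j^m}(\mathfrak v_+,\mathfrak v_-)\le\mathrm{diam}(\Xi_j^m)\le C_{\mathrm d}\rho_{\min}(\mathcal D)^m$ for all $j\in[K]$, $m\in\mathbb N$ (such constants exist and are regarded as part of the EIGS data), and $c_0\in\mathbb N$ is fixed so large that $C_{\mathrm d}\rho_{\min}(\mathcal D)^{-c_0}\le\frac{c_{\mathrm d}}{4\rho_{\min}(\mathcal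 D)}$ and $c_{\mathrm d}\rho_{\min}(\mathcal D)^{c_0}\ge4C_{\mathrm d}$. **Walk.** $(X_j^{\Xi^n})_{j\ge0}$ is discrete-time simple random walk on $\Xi^n$; $\tau^{\Xi^n}_{B^{\mathrm c}}=\inf\{j\ge0:X_j^{\Xi^n}\notin B\}$; $\mathbb E^v$ is expectation for the walk started at $v$. *)

theory Defs
  imports
    "HOL-Probability.Probability"
    "Graph_Theory.Graph_Theory"
    "Jordan_Normal_Form.Spectral_Radius"
begin

hide_const (open) Digraph_Component.connected

section \<open>Underlying undirected graphs\<close>

definition undir :: "('a, 'b) pre_digraph \<Rightarrow> ('a, 'a \<times> 'a) pre_digraph" where
  "undir G = with_proj (mk_symmetric G)"

text \<open>The last condition excludes parallel as well as antiparallel edges, so that no edge is lost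
  in passing to \<^const>\<open>undir\<close>.\<close>

definition simple_graph :: "('a, 'b) pre_digraph \<Rightarrow> bool" where
  "simple_graph G \<longleftrightarrow> fin_digraph G \<and> loopfree_digraph G \<and>
     (\<forall>e\<in>arcs G. \<forall>f\<in>arcs G. {tail G e, head G e} = {tail G f, head G f} \<longrightarrow> e = f)"

definition simple_path_between :: "('a, 'b) pre_digraph \<Rightarrow> 'a \<Rightarrow> 'a \<Rightarrow> 'a list \<Rightarrow> bool" where
  "simple_path_between G a b p \<longleftrightarrow> vpath p (undir G) \<and> hd p = a \<and> last p = b"

definition path_arcs :: "('a, 'b) pre_digraph \<Rightarrow> 'a list \<Rightarrow> 'b set" where
  "path_arcs G p = {e \<in> arcs G. (tail G e, head G e) \<in> set (vwalk_arcs p) \<or>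
                                (head G e, tail G e) \<in> set (vwalk_arcs p)}"

definition gdist :: "('a, 'b) pre_digraph \<Rightarrow> 'a \<Rightarrow> 'a \<Rightarrow> nat" where
  "gdist G u v =
     (LEAST l. \<exists>p. vwalk p (undir G) \<and> hd p = u \<and> last p = v \<and> vwalk_length p = l)"

definition gdiam :: "('a, 'b) pre_digraph \<Rightarrow> nat" where
  "gdiam G = Max {gdist G u v | u v. u \<in> verts G \<and> v \<in> verts G}"

definition gball :: "('a, 'b) pre_digraph \<Rightarrow> 'a \<Rightarrow> real \<Rightarrow> 'a set" where
  "gball G v r = {u \<in> verts G. real (gdist G v u) < r}"

definition neighbours :: "('a, 'b) pre_digraph \<Rightarrow> 'a \<Rightarrow> 'a set" where
  "neighbours G u = {w. (u, w) \<in> arcs_ends (undir G)}"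

text \<open>Effective resistance as the reciprocal of the minimal Dirichlet energy of a function with
  unit potential difference, the edge \<open>e\<close> having resistance \<open>r e\<close>.\<close>

definition eff_resistance ::
    "('a, 'b) pre_digraph \<Rightarrow> ('b \<Rightarrow> real) \<Rightarrow> 'a \<Rightarrow> 'a \<Rightarrow> real" where
  "eff_resistance G r a b =
     1 / (INF f \<in> {f :: 'a \<Rightarrow> real. f a = 1 \<and> f b = 0}.
            \<Sum>e\<in>arcs G. (f (tail G e) - f (head G e))\<^sup>2 / r e)"


section \<open>Simple random walk\<close>

text \<open>The walk lives on the canonical space of trajectories \<open>\<omega> :: nat \<Rightarrow> 'a\<close>, with \<open>X\<^sub>j \<omega> = \<omega> j\<close>; its
  law is obtained from the transition kernels by the Ionescu-Tulcea construction.\<close>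

definition srw_kernel :: "('a, 'b) pre_digraph \<Rightarrow> 'a \<Rightarrow> nat \<Rightarrow> (nat \<Rightarrow> 'a) \<Rightarrow> 'a measure" where
  "srw_kernel G v j \<omega> = (case j of
       0 \<Rightarrow> return (count_space UNIV) v
     | Suc i \<Rightarrow> measure_pmf (pmf_of_set (neighbours G (\<omega> i))))"

lemma Ionescu_Tulcea_srw_kernel:
  fixes G :: "('a, 'b) pre_digraph"
  shows "Ionescu_Tulcea (srw_kernel G v) (\<lambda>_. count_space UNIV)"
proof (rule Ionescu_Tulcea.intro, goal_cases)
  case (1 j)
  show "srw_kernel G v j \<in>
      measurable (PiM {0..<j} (\<lambda>_. count_space UNIV)) (subprob_algebra (count_space UNIV))"
  proof (cases j)
    case 0
    then show ?thesis
      by (simp add: srw_kernel_def[abs_def] return_sets_cong space_subprob_algebra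
          prob_space_imp_subprob_space prob_space_return)
  next
    case (Suc i)
    have "(\<lambda>u. measure_pmf (pmf_of_set (neighbours G u)))
        \<in> measurable (count_space UNIV) (subprob_algebra (count_space UNIV))"
      by (auto intro: measure_pmf_in_subprob_algebra)
    moreover have "(\<lambda>\<omega>. \<omega> i)
        \<in> measurable (PiM {0..<j} (\<lambda>_. count_space UNIV)) (count_space (UNIV :: 'a set))"
      using Suc by (intro measurable_component_singleton) auto
    ultimately have "(\<lambda>\<omega>. measure_pmf (pmf_of_set (neighbours G (\<omega> i))))
        \<in> measurable (PiM {0..<j} (\<lambda>_. count_space UNIV)) (subprob_algebra (count_space UNIV))"
      by (rule measurable_compose[rotated])
    then show ?thesis
      by (simp add: Suc srw_kernel_def[abs_def])
  qed
next
  case (2 j \<omega>)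
  show ?case
    by (cases j) (auto simp: srw_kernel_def prob_space_return measure_pmf.prob_space_axioms)
qed

definition srw :: "('a, 'b) pre_digraph \<Rightarrow> 'a \<Rightarrow> (nat \<Rightarrow> 'a) measure" where
  "srw G v = projective_family.lim UNIV
     (Ionescu_Tulcea.CI (srw_kernel G v) (\<lambda>_. count_space UNIV)) (\<lambda>_. count_space UNIV)"

lemma prob_space_srw: "prob_space (srw G v)"
proof -
  interpret Ionescu_Tulcea "srw_kernel G v" "\<lambda>_. count_space UNIV"
    by (rule Ionescu_Tulcea_srw_kernel)
  have "(\<lambda>\<omega>. restrict \<omega> {}) \<in> measurable PF.lim (PiM {} (\<lambda>_. count_space UNIV))"
    by (simp add: measurable_cong_sets[OF PF.sets_lim])
  moreover have "prob_space (distr PF.lim (PiM {} (\<lambda>_. count_space UNIV)) (\<lambda>\<omega>. restrict \<omega> {}))"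
    using PF.prob_space_P[of "{}"] by (simp add: distr_lim)
  ultimately show ?thesis
    unfolding srw_def by (rule prob_space_distrD)
qed

text \<open>The infimum of the empty set is \<open>\<infinity>\<close>.\<close>

definition exit_time :: "'a set \<Rightarrow> (nat \<Rightarrow> 'a) \<Rightarrow> enat" where
  "exit_time B \<omega> = (INF j \<in> {j. \<omega> j \<notin> B}. enat j)"

definition expected_exit_time :: "('a, 'b) pre_digraph \<Rightarrow> 'a \<Rightarrow> 'a set \<Rightarrow> ennreal" where
  "expected_exit_time G v B = (\<integral>\<^sup>+ \<omega>. ennreal_of_enat (exit_time B \<omega>) \<partial>srw G v)"


section \<open>Edge iterated graph systems\<close>

text \<open>Colours are \<open>0, \<dots>, ncol S - 1\<close>. \<open>ecol S i e\<close> is the colour of the edge \<open>e\<close> of the rule graph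
  \<open>rule S i\<close>, and \<open>icol S\<close> is the colour of the single edge of the initial graph.\<close>

record ('v, 'e) eigs =
  ncol :: nat
  rule :: "nat \<Rightarrow> ('v, 'e) pre_digraph"
  ecol :: "nat \<Rightarrow> 'e \<Rightarrow> nat"
  bplus :: "nat \<Rightarrow> 'v"
  bminus :: "nat \<Rightarrow> 'v"
  icol :: nat

definition wf_eigs :: "('v, 'e) eigs \<Rightarrow> bool" where
  "wf_eigs S \<longleftrightarrow> ncol S \<ge> 1 \<and> icol S < ncol S \<and>
     (\<forall>i<ncol S. simple_graph (rule S i) \<and> Digraph_Component.connected (rule S i) \<and>
        bplus S i \<in> verts (rule S i) \<and> bminus S i \<in> verts (rule S i) \<and> bplus S i \<noteq> bminus S i \<and>
        (\<forall>e\<in>arcs (rule S i). ecol S i e < ncol S))"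

text \<open>An edge of the \<open>n\<close>-th iterate is addressed by the list \<open>[e\<^sub>1, \<dots>, e\<^sub>n]\<close> of rule-graph edges
  through which it arose, the last entry being the most recent. \<open>Inner e x\<close> is the copy of the
  non-planting vertex \<open>x\<close> in the rule graph that replaced the edge with address \<open>e\<close>.\<close>

datatype ('v, 'e) ivert = Vplus | Vminus | Inner "'e list" 'v

text \<open>Here \<open>c\<close> is the colouring of \<open>G\<close>, and \<open>plant S c G e\<close> embeds the copy of the rule graph
  replacing \<open>e\<close>.\<close>

definition plant :: "('v, 'e) eigs \<Rightarrow> ('e list \<Rightarrow> nat) \<Rightarrow> (('v, 'e) ivert, 'e list) pre_digraph \<Rightarrow>
    'e list \<Rightarrow> 'v \<Rightarrow> ('v, 'e) ivert" where
  "plant S c G e x =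
     (if x = bplus S (c e) then tail G e else if x = bminus S (c e) then head G e else Inner e x)"

definition replace_edges :: "('v, 'e) eigs \<Rightarrow> ('e list \<Rightarrow> nat) \<Rightarrow>
    (('v, 'e) ivert, 'e list) pre_digraph \<Rightarrow> (('v, 'e) ivert, 'e list) pre_digraph" where
  "replace_edges S c G =
     \<lparr> verts = verts G \<union> (\<Union>e\<in>arcs G. plant S c G e ` verts (rule S (c e))),
       arcs = {e @ [f] | e f. e \<in> arcs G \<and> f \<in> arcs (rule S (c e))},
       tail = (\<lambda>g. plant S c G (butlast g) (tail (rule S (c (butlast g))) (last g))),
       head = (\<lambda>g. plant S c G (butlast g) (head (rule S (c (butlast g))) (last g))) \<rparr>"

text \<open>The colour of an edge is the colour of its last rule-graph edge; this determines in which rule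
  graph the next entry of an address lives, whence the fold.\<close>

definition icolour :: "('v, 'e) eigs \<Rightarrow> nat \<Rightarrow> 'e list \<Rightarrow> nat" where
  "icolour S j e = foldl (ecol S) j e"

text \<open>\<open>iterate_graph S j n\<close> is the \<open>n\<close>-th iterate of a single edge of colour \<open>j\<close>.\<close>

primrec iterate_graph ::
    "('v, 'e) eigs \<Rightarrow> nat \<Rightarrow> nat \<Rightarrow> (('v, 'e) ivert, 'e list) pre_digraph" where
  "iterate_graph S j 0 =
     \<lparr> verts = {Vplus, Vminus}, arcs = {[]}, tail = (\<lambda>_. Vplus), head = (\<lambda>_. Vminus) \<rparr>"
| "iterate_graph S j (Suc n) = replace_edges S (icolour S j) (iterate_graph S j n)"

definition Xi :: "('v, 'e) eigs \<Rightarrow> nat \<Rightarrow> (('v, 'e) ivert, 'e list) pre_digraph" where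
  "Xi S n = iterate_graph S (icol S) n"

lemma verts_Xi_mono: "verts (Xi S n) \<subseteq> verts (Xi S (Suc n))"
  by (simp add: Xi_def replace_edges_def)

definition born_at :: "('v, 'e) eigs \<Rightarrow> nat \<Rightarrow> ('v, 'e) ivert set" where
  "born_at S k = verts (Xi S k) - (case k of 0 \<Rightarrow> {} | Suc l \<Rightarrow> verts (Xi S l))"


section \<open>Matrices and growth rates\<close>

definition edge_matrix :: "('v, 'e) eigs \<Rightarrow> nat mat" where
  "edge_matrix S = Matrix.mat (ncol S) (ncol S)
     (\<lambda>(i, j). card {e \<in> arcs (rule S i). ecol S i e = j})"

text \<open>With colours and indices starting at 0, position \<open>2 j\<close> counts the edges of colour \<open>j\<close> leaving \<open>v\<close>
  and position \<open>2 j + 1\<close> those entering \<open>v\<close>.\<close>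

definition degree_entry :: "('v, 'e) eigs \<Rightarrow> nat \<Rightarrow> 'v \<Rightarrow> nat \<Rightarrow> nat" where
  "degree_entry S i v s =
     card {e \<in> (if even s then out_arcs (rule S i) v else in_arcs (rule S i) v). ecol S i e = s div 2}"

definition degree_matrix :: "('v, 'e) eigs \<Rightarrow> nat mat" where
  "degree_matrix S = Matrix.mat (2 * ncol S) (2 * ncol S)
     (\<lambda>(r, s). let i = r div 2
               in degree_entry S i (if even r then bplus S i else bminus S i) s)"

definition distance_matrices :: "('v, 'e) eigs \<Rightarrow> nat mat set" where
  "distance_matrices S =
     {Matrix.mat (ncol S) (ncol S) (\<lambda>(i, j). card {e \<in> path_arcs (rule S i) (p i). ecol S i e = j}) | p.
        \<forall>i<ncol S. simple_path_between (rule S i) (bplus S i) (bminus S i) (p i)}"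

definition positive_entries :: "nat mat \<Rightarrow> bool" where
  "positive_entries A \<longleftrightarrow> (\<forall>i<dim_row A. \<forall>j<dim_col A. 0 < A $$ (i, j))"

definition primitive_matrix :: "nat mat \<Rightarrow> bool" where
  "primitive_matrix A \<longleftrightarrow> (\<exists>p\<ge>1. positive_entries (A ^\<^sub>m p))"

definition rho :: "nat mat \<Rightarrow> real" where
  "rho A = spectral_radius (map_mat of_nat A)"

definition rho_min :: "('v, 'e) eigs \<Rightarrow> real" where
  "rho_min S = Min (rho ` distance_matrices S)"

text \<open>Vectors indexed by the colours are functions, of which only the values below \<open>ncol S\<close> matter.\<close>

definition resistance_map :: "('v, 'e) eigs \<Rightarrow> (nat \<Rightarrow> real) \<Rightarrow> nat \<Rightarrow> real" where
  "resistance_map S x i =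
     eff_resistance (rule S i) (\<lambda>e. x (ecol S i e)) (bplus S i) (bminus S i)"

definition rho_resistance :: "('v, 'e) eigs \<Rightarrow> real" where
  "rho_resistance S = (THE t. t > 0 \<and>
     (\<exists>x. (\<forall>i<ncol S. x i > 0) \<and> (\<forall>i<ncol S. resistance_map S x i = t * x i)))"


section \<open>Standing assumptions and constants\<close>

definition canonical :: "('v, 'e) eigs \<Rightarrow> bool" where
  "canonical S \<longleftrightarrow> (\<forall>i<ncol S. \<forall>e\<in>arcs (rule S i).
     \<exists>p. simple_path_between (rule S i) (bplus S i) (bminus S i) p \<and> e \<in> path_arcs (rule S i) p)"

definition distance_positive :: "('v, 'e) eigs \<Rightarrow> bool" where
  "distance_positive S \<longleftrightarrow> (\<forall>A\<in>distance_matrices S. positive_entries A) \<and>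
     (ncol S = 1 \<longrightarrow> gdist (rule S 0) (bplus S 0) (bminus S 0) \<ge> 2)"

definition degree_primitive :: "('v, 'e) eigs \<Rightarrow> bool" where
  "degree_primitive S \<longleftrightarrow> primitive_matrix (degree_matrix S)"

definition distance_constants :: "('v, 'e) eigs \<Rightarrow> real \<Rightarrow> real \<Rightarrow> bool" where
  "distance_constants S cd Cd \<longleftrightarrow> cd > 0 \<and> Cd > 0 \<and>
     (\<forall>j<ncol S. \<forall>m.
        cd * rho_min S ^ m \<le> real (gdist (iterate_graph S j m) Vplus Vminus) \<and>
        gdist (iterate_graph S j m) Vplus Vminus \<le> gdiam (iterate_graph S j m) \<and>
        real (gdiam (iterate_graph S j m)) \<le> Cd * rho_min S ^ m)"

definition level_constant :: "('v, 'e) eigs \<Rightarrow> real \<Rightarrow> real \<Rightarrow> nat \<Rightarrow> bool" where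
  "level_constant S cd Cd c0 \<longleftrightarrow>
     Cd * rho_min S powi (- int c0) \<le> cd / (4 * rho_min S) \<and>
     cd * rho_min S ^ c0 \<ge> 4 * Cd"

end

theory Submission
  imports Defs
begin

text \<open>Let \<open>h\<close> be a function on an old iterate that is \<open>1\<close> at \<open>v\<close> and \<open>0\<close> at the other vertices, extended
  harmonically level by level to the current iterate. The copy replacing an edge acts as one edge
  carrying its effective resistance, so for every \<open>u\<close> the energy \<open>E(h, u)\<close> is computed at the old
  level, with resistances \<open>\<Psi>\<^sup>m(1)\<close>. On the other hand, \<open>E(h, u)\<close> is the sum of
  \<open>deg(x) h(x) (u - P u)(x)\<close>, where \<open>u - P u\<close> is \<open>1\<close> on the ball and at most \<open>0\<close> off it if \<open>u\<close> is the
  expected exit time. Hence \<open>u(v)\<close> is comparable to the mass of the star of \<open>v\<close> in the old iterate,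
  which is \<open>deg(v) \<rho>(M)\<^sup>m\<close> up to constants, divided by its conductance, which is
  \<open>deg(v) \<rho>(\<Psi>)\<^sup>-\<^sup>m\<close> up to constants; the unbounded degree of \<open>v\<close> cancels. The upper bound uses a level
  at which the ball contains no old vertex but \<open>v\<close>, the lower bound one at which it contains the
  whole star. The powers \<open>M\<^sup>m\<close> and \<open>\<Psi>\<^sup>m\<close> grow like powers of their eigenvalues because both maps are
  minima of linear functionals with coefficients bounded away from \<open>0\<close>: every path between the
  planting vertices uses all colours, so each colour class is a cut.\<close>

section \<open>Expected exit times as limits of truncated ones\<close>

text \<open>A priori the expected exit time may be infinite, so it is not yet available as a real
  function \<open>u\<close>. The upper bound is therefore proved for E[min(tau, k)] with
  \<open>k\<close> arbitrary, which already satisfies u - P u <= 1. That bound makes the monotone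
  limit in \<open>k\<close> finite, and only then can the lower bound use the exact equation u - P u
  = 1 on the ball. The energy identity needs harmonicity of \<open>h\<close> alone, which is why
  \<open>u\<close> may be any function. For the upper bound, 0 <= h <= 1 controls the mass of
  \<open>h\<close>. For the lower bound \<open>h\<close> might decay inside the copies, so one
  substitution step is treated by itself: each copy at \<open>v\<close> contains an arc with h >=
  \<delta> at both ends, since \<open>h\<close> at a neighbour is a weighted average and the
  resistances \<Psi>^m(1) of different colours are comparable up to a factor \<kappa> independent of
  m. What later replaces that arc carries a fixed share of the mass of its copy. The two levels used
  are n - m - c0 and n - m + c0; the shift by c0 costs only fixed powers of \<rho>(M) and
  \<rho>(\<Psi>), absorbed in the constants.\<close>

primrec survive :: "('a, 'b) pre_digraph \<Rightarrow> 'a set \<Rightarrow> nat \<Rightarrow> ('a \<Rightarrow> ennreal) \<Rightarrow> 'a \<Rightarrow> ennreal" where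
  "survive G B 0 f x = indicator B x * f x"
| "survive G B (Suc j) f x =
     indicator B x * (\<integral>\<^sup>+y. survive G B j f y \<partial>measure_pmf (pmf_of_set (neighbours G x)))"

text \<open>\<open>survive G B j f x\<close> is the expectation of f(X_j) on the event that X_0,
  ..., X_j all lie in \<open>B\<close>. Its recursion conditions on the first step, whereas the
  Ionescu-Tulcea construction appends the last one; this is the bridge between the two.\<close>

lemma survive_Suc_right:
  "survive G B (Suc j) f x =
     survive G B j (\<lambda>x. \<integral>\<^sup>+y. indicator B y * f y \<partial>measure_pmf (pmf_of_set (neighbours G x))) x"
  by (induction j arbitrary: x) auto

text \<open>Integrating out the last kernel turns it into a new test function at the previous time,
  hence the induction with \<open>f\<close> arbitrary. The index is \<open>Suc j\<close> because
  coordinate 0 is itself drawn, from the point mass at \<open>v\<close>.\<close>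

lemma nn_integral_srw_prefix:
  fixes G :: "('a, 'b) pre_digraph"
  shows "(\<integral>\<^sup>+\<omega>. (\<Prod>i\<le>j. indicator B (\<omega> i)) * f (\<omega> j)
      \<partial>Ionescu_Tulcea.C (srw_kernel G v) (\<lambda>_. count_space UNIV) 0 (Suc j) (\<lambda>_. undefined))
    = survive G B j f v"
proof -
  interpret Ionescu_Tulcea "srw_kernel G v" "\<lambda>_. count_space UNIV"
    by (rule Ionescu_Tulcea_srw_kernel)
  have meas: "(\<lambda>\<omega>. (\<Prod>i\<le>j. indicator B (\<omega> i)) * f (\<omega> j) :: ennreal)
      \<in> borel_measurable (PiM {0..<n} (\<lambda>_. count_space UNIV))" if "j < n" for j n :: nat and f :: "'a \<Rightarrow> ennreal"
  proof -
    have c: "(\<lambda>\<omega>. g (\<omega> i) :: ennreal) \<in> borel_measurable (PiM {0..<n} (\<lambda>_. count_space UNIV))"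
      if "i < n" for i :: nat and g :: "'a \<Rightarrow> ennreal"
      by (rule measurable_compose[OF measurable_component_singleton[of i "{0..<n}"]]) (use that in auto)
    show ?thesis
      by (intro borel_measurable_times_ennreal borel_measurable_prod_ennreal c) (use that in auto)
  qed
  have u: "(\<lambda>_. undefined) \<in> space (PiM {0..<0::nat} (\<lambda>_. count_space UNIV :: 'a measure))"
    by (simp add: space_PiM)
  show ?thesis
  proof (induction j arbitrary: f)
    case 0
    have "C 0 (Suc 0) (\<lambda>_. undefined) = eP 0 (\<lambda>_. undefined)"
      by (simp only: C.simps add_0 bind_return[OF measurable_eP u])
    then show ?case
      by (subst nn_integral_eP[OF u meas, of 0 f, folded \<open>C 0 (Suc 0) (\<lambda>_. undefined) = eP 0 (\<lambda>_. undefined)\<close>])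
        (simp_all add: srw_kernel_def[of G v 0] nn_integral_return)
  next
    case (Suc j)
    let ?K = "\<lambda>x. measure_pmf (pmf_of_set (neighbours G x))"
    have "(\<integral>\<^sup>+\<omega>. (\<Prod>i\<le>Suc j. indicator B (\<omega> i)) * f (\<omega> (Suc j)) \<partial>C 0 (Suc (Suc j)) (\<lambda>_. undefined))
      = (\<integral>\<^sup>+\<omega>'. (\<integral>\<^sup>+\<omega>. (\<Prod>i\<le>Suc j. indicator B (\<omega> i)) * f (\<omega> (Suc j)) \<partial>eP (Suc j) \<omega>')
          \<partial>C 0 (Suc j) (\<lambda>_. undefined))"
    proof -
      have "eP (Suc j) \<in> measurable (C 0 (Suc j) (\<lambda>_. undefined))
          (subprob_algebra (PiM {0..<Suc (Suc j)} (\<lambda>_. count_space UNIV)))"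
        unfolding measurable_cong_sets[OF sets_C[OF u, of "Suc j", unfolded add_0] refl]
        by (rule measurable_eP)
      then show ?thesis
        by (subst C.simps(2), subst add_0)
          (rule nn_integral_bind[OF meas], auto)
    qed
    also have "\<dots> = (\<integral>\<^sup>+\<omega>'. (\<Prod>i\<le>j. indicator B (\<omega>' i)) * (\<integral>\<^sup>+y. indicator B y * f y \<partial>?K (\<omega>' j))
          \<partial>C 0 (Suc j) (\<lambda>_. undefined))"
    proof (intro nn_integral_cong)
      fix \<omega>' :: "nat \<Rightarrow> 'a"
      assume "\<omega>' \<in> space (C 0 (Suc j) (\<lambda>_. undefined))"
      then have w: "\<omega>' \<in> space (PiM {0..<Suc j} (\<lambda>_. count_space UNIV))"
        using u by (simp add: space_C del: C.simps)
      have "(\<integral>\<^sup>+\<omega>. (\<Prod>i\<le>Suc j. indicator B (\<omega> i)) * f (\<omega> (Suc j)) \<partial>eP (Suc j) \<omega>')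
        = (\<integral>\<^sup>+y. (\<Prod>i\<le>j. indicator B (\<omega>' i)) * (indicator B y * f y) \<partial>?K (\<omega>' j))"
        by (subst nn_integral_eP[OF w meas]) (auto simp: srw_kernel_def mult.assoc intro!: nn_integral_cong)
      then show "(\<integral>\<^sup>+\<omega>. (\<Prod>i\<le>Suc j. indicator B (\<omega> i)) * f (\<omega> (Suc j)) \<partial>eP (Suc j) \<omega>')
        = (\<Prod>i\<le>j. indicator B (\<omega>' i)) * (\<integral>\<^sup>+y. indicator B y * f y \<partial>?K (\<omega>' j))"
        by (simp add: nn_integral_cmult)
    qed
    also have "\<dots> = survive G B j (\<lambda>x. \<integral>\<^sup>+y. indicator B y * f y \<partial>?K x) v"
      by (rule Suc.IH)
    finally show ?case
      by (simp only: survive_Suc_right)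
  qed
qed

text \<open>The event is a cylinder over the coordinates up to \<open>j\<close>, so both
  measurability and mass come from the finite-dimensional law.\<close>

lemma emeasure_srw_survive:
  fixes G :: "('a, 'b) pre_digraph"
  shows "{\<omega>. \<forall>i\<le>j. \<omega> i \<in> B} \<in> sets (srw G v)"
    and "emeasure (srw G v) {\<omega>. \<forall>i\<le>j. \<omega> i \<in> B} = survive G B j (\<lambda>_. 1) v"
proof -
  interpret Ionescu_Tulcea "srw_kernel G v" "\<lambda>_. count_space UNIV"
    by (rule Ionescu_Tulcea_srw_kernel)
  let ?J = "{0..<Suc j}" and ?M = "\<lambda>_. count_space UNIV :: 'a measure"
  let ?X = "PiE ?J (\<lambda>_. B)"
  have u: "(\<lambda>_. undefined) \<in> space (PiM {0..<0::nat} ?M)"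
    by (simp add: space_PiM)
  have X: "?X \<in> sets (PiM ?J ?M)"
    by (intro sets_PiM_I_finite) auto
  have emb: "prod_emb UNIV ?M ?J ?X = {\<omega>. \<forall>i\<le>j. \<omega> i \<in> B}"
    by (auto simp: prod_emb_def PiE_iff)
  have emb': "prod_emb ?J ?M ?J ?X = ?X"
    by (rule prod_emb_id) auto
  have "prod_emb UNIV ?M ?J ?X \<in> sets (PiM UNIV ?M)"
    by (intro measurable_prod_emb X) auto
  then show "{\<omega>. \<forall>i\<le>j. \<omega> i \<in> B} \<in> sets (srw G v)"
    unfolding emb srw_def by simp
  have "emeasure (srw G v) {\<omega>. \<forall>i\<le>j. \<omega> i \<in> B} = emeasure (CI ?J) ?X"
    unfolding srw_def emb[symmetric] by (rule lim) (use X in auto)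
  also have "\<dots> = emeasure (C 0 (Suc j) (\<lambda>_. undefined)) ?X"
    by (subst emeasure_CI[of _ "Suc j"]) (use X emb' in \<open>simp_all del: C.simps\<close>)
  also have "\<dots> = (\<integral>\<^sup>+\<omega>. indicator ?X \<omega> \<partial>C 0 (Suc j) (\<lambda>_. undefined))"
    using X u by (simp add: sets_C del: C.simps)
  also have "\<dots> = (\<integral>\<^sup>+\<omega>. (\<Prod>i\<le>j. indicator B (\<omega> i)) * 1 \<partial>C 0 (Suc j) (\<lambda>_. undefined))"
  proof (intro nn_integral_cong)
    fix \<omega> :: "nat \<Rightarrow> 'a"
    assume "\<omega> \<in> space (C 0 (Suc j) (\<lambda>_. undefined))"
    then have w: "\<omega> \<in> space (PiM ?J ?M)"
      using u by (simp add: space_C del: C.simps)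
    have "(\<Prod>i\<le>j. indicator B (\<omega> i)) = (if \<forall>i\<le>j. \<omega> i \<in> B then 1 else 0 :: ennreal)"
      by (auto simp: indicator_def intro!: prod.neutral)
    then show "indicator ?X \<omega> = (\<Prod>i\<le>j. indicator B (\<omega> i)) * (1 :: ennreal)"
      using w by (auto simp: indicator_def space_PiM PiE_iff)
  qed
  also have "\<dots> = survive G B j (\<lambda>_. 1) v"
    by (rule nn_integral_srw_prefix)
  finally show "emeasure (srw G v) {\<omega>. \<forall>i\<le>j. \<omega> i \<in> B} = survive G B j (\<lambda>_. 1) v" .
qed

text \<open>Tail-sum formula: the \<open>j\<close>-th summand is the indicator of exit after time
  \<open>j\<close>. On trajectories that never leave \<open>B\<close> both sides are
  infinite.\<close>

lemma ennreal_of_enat_exit_time: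
  "ennreal_of_enat (exit_time B \<omega>) = (\<Sum>j. indicator {\<omega>. \<forall>i\<le>j. \<omega> i \<in> B} \<omega>)"
proof (cases "\<exists>j. \<omega> j \<notin> B")
  case True
  define k where "k = (LEAST j. \<omega> j \<notin> B)"
  have k: "\<omega> k \<notin> B"
    unfolding k_def using True by (rule LeastI_ex)
  have k': "\<omega> i \<in> B" if "i < k" for i
    using not_less_Least[OF that[unfolded k_def]] by simp
  have "exit_time B \<omega> = enat k"
    unfolding exit_time_def
  proof (rule antisym)
    show "(INF j\<in>{j. \<omega> j \<notin> B}. enat j) \<le> enat k"
      by (rule INF_lower) (simp add: k)
    show "enat k \<le> (INF j\<in>{j. \<omega> j \<notin> B}. enat j)"
      by (rule INF_greatest) (metis enat_ord_simps(1) k' linorder_not_le mem_Collect_eq)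
  qed
  moreover have "(\<Sum>j. indicator {\<omega>. \<forall>i\<le>j. \<omega> i \<in> B} \<omega>) = (\<Sum>j<k. indicator {\<omega>. \<forall>i\<le>j. \<omega> i \<in> B} \<omega> :: ennreal)"
  proof (rule suminf_finite)
    fix j
    assume "j \<notin> {..<k}"
    then have "\<not> (\<forall>i\<le>j. \<omega> i \<in> B)"
      using k by (auto simp: not_less)
    then show "indicator {\<omega>. \<forall>i\<le>j. \<omega> i \<in> B} \<omega> = (0 :: ennreal)"
      by simp
  qed simp
  moreover have "\<dots> = (\<Sum>j<k. 1)"
    by (rule sum.cong) (use k' in auto)
  ultimately show ?thesis
    by (simp add: ennreal_of_nat_eq_real_of_nat)
next
  case False
  then have "{j. \<omega> j \<notin> B} = {}"
    by auto
  then have "exit_time B \<omega> = \<infinity>"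
    by (simp add: exit_time_def top_enat_def)
  moreover have "(\<Sum>j. indicator {\<omega>. \<forall>i\<le>j. \<omega> i \<in> B} \<omega>) = (\<Sum>j. 1 :: ennreal)"
    using False by (intro suminf_cong) auto
  moreover have "(\<Sum>j. 1 :: ennreal) = \<infinity>"
  proof -
    have "(\<Sum>j. 1 :: ennreal) = (SUP n. of_nat n)"
      by (subst suminf_eq_SUP) simp
    then show ?thesis
      by (simp add: ennreal_SUP_of_nat_eq_top)
  qed
  ultimately show ?thesis
    by (simp add: ennreal_of_enat_def)
qed

text \<open>This is E[min(tau, k)] for the walk started at \<open>x\<close>, generated by iterating
  u = 1 + P u on \<open>B\<close> from 0. Being real and finite for every \<open>k\<close>, it can
  be used in energies before the exit time is known to be integrable.\<close>

primrec truncated_exit :: "('a, 'b) pre_digraph \<Rightarrow> 'a set \<Rightarrow> nat \<Rightarrow> 'a \<Rightarrow> real" where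
  "truncated_exit G B 0 x = 0"
| "truncated_exit G B (Suc k) x =
     (if x \<in> B then 1 + (\<Sum>y\<in>neighbours G x. truncated_exit G B k y) / card (neighbours G x) else 0)"

lemma truncated_exit_nonneg: "0 \<le> truncated_exit G B k x"
  by (induction k arbitrary: x) (auto intro!: sum_nonneg add_nonneg_nonneg divide_nonneg_nonneg)

lemma truncated_exit_Suc_mono: "truncated_exit G B k x \<le> truncated_exit G B (Suc k) x"
proof (induction k arbitrary: x)
  case 0
  show ?case
    by (simp add: sum_nonneg)
next
  case (Suc k)
  then show ?case
    by (auto intro!: divide_right_mono sum_mono)
qed

lemma truncated_exit_outside: "x \<notin> B \<Longrightarrow> truncated_exit G B k x = 0"
  by (cases k) auto

text \<open>Both sides obey the same first-step recursion. The hypothesis makes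
  \<open>pmf_of_set\<close> the uniform law, so that its integral is the average in
  \<open>truncated_exit\<close>.\<close>

lemma truncated_exit_eq_sum:
  assumes "\<forall>x\<in>B. finite (neighbours G x) \<and> neighbours G x \<noteq> {}"
  shows "ennreal (truncated_exit G B k x) = (\<Sum>j<k. survive G B j (\<lambda>_. 1) x)"
proof (induction k arbitrary: x)
  case 0
  show ?case by simp
next
  case (Suc k)
  show ?case
  proof (cases "x \<in> B")
    case True
    let ?N = "neighbours G x"
    have N: "finite ?N" "?N \<noteq> {}"
      using assms True by auto
    then have "(\<integral>\<^sup>+y. (\<Sum>j<k. survive G B j (\<lambda>_. 1) y) \<partial>measure_pmf (pmf_of_set ?N))
        = (\<Sum>y\<in>?N. \<Sum>j<k. survive G B j (\<lambda>_. 1) y) / card ?N"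
      by (subst nn_integral_pmf_of_set) auto
    also have "\<dots> = (\<Sum>y\<in>?N. ennreal (truncated_exit G B k y)) / ennreal (card ?N)"
      by (simp add: Suc ennreal_of_nat_eq_real_of_nat)
    also have "\<dots> = ennreal ((\<Sum>y\<in>?N. truncated_exit G B k y) / card ?N)"
      using N by (subst sum_ennreal)
        (auto simp: truncated_exit_nonneg divide_ennreal sum_nonneg card_gt_0_iff)
    finally have eq: "ennreal ((\<Sum>y\<in>?N. truncated_exit G B k y) / card ?N)
        = (\<Sum>j<k. \<integral>\<^sup>+y. survive G B j (\<lambda>_. 1) y \<partial>measure_pmf (pmf_of_set ?N))"
      by (simp add: nn_integral_sum)
    have "ennreal (truncated_exit G B (Suc k) x)
        = 1 + ennreal ((\<Sum>y\<in>?N. truncated_exit G B k y) / card ?N)"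
      using True by (simp add: ennreal_plus sum_nonneg truncated_exit_nonneg divide_nonneg_nonneg)
    also have "\<dots> = (\<Sum>j<Suc k. survive G B j (\<lambda>_. 1) x)"
      unfolding eq sum.lessThan_Suc_shift using True by simp
    finally show ?thesis .
  next
    case False
    have "survive G B j f x = 0" for j f
      using False by (cases j) auto
    then have "(\<Sum>j<Suc k. survive G B j (\<lambda>_. 1) x) = 0"
      by (simp only: sum.neutral_const)
    then show ?thesis
      using False by (simp only: truncated_exit.simps if_False ennreal_0)
  qed
qed

text \<open>Summing the survival probabilities gives the expectation. A bound on all truncations
  thus bounds the expectation with no prior finiteness.\<close>

lemma expected_exit_time_eq_SUP:
  assumes "\<forall>x\<in>B. finite (neighbours G x) \<and> neighbours G x \<noteq> {}"
  shows "expected_exit_time G v B = (SUP k. ennreal (truncated_exit G B k v))"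
proof -
  have "(\<integral>\<^sup>+\<omega>. indicator {\<omega>. \<forall>i\<le>j. \<omega> i \<in> B} \<omega> \<partial>srw G v) = survive G B j (\<lambda>_. 1) v" for j
    using nn_integral_indicator[OF emeasure_srw_survive(1)[of j B G v]] emeasure_srw_survive(2)[of G v j B]
    by (rule trans)
  then have "(\<Sum>j. \<integral>\<^sup>+\<omega>. indicator {\<omega>. \<forall>i\<le>j. \<omega> i \<in> B} \<omega> \<partial>srw G v) = (\<Sum>j. survive G B j (\<lambda>_. 1) v)"
    by (rule suminf_cong)
  moreover have "expected_exit_time G v B = (\<Sum>j. \<integral>\<^sup>+\<omega>. indicator {\<omega>. \<forall>i\<le>j. \<omega> i \<in> B} \<omega> \<partial>srw G v)"
    unfolding expected_exit_time_def ennreal_of_enat_exit_time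
    by (rule nn_integral_suminf) (rule borel_measurable_indicator[OF emeasure_srw_survive(1)])
  moreover have "(\<Sum>j<k. survive G B j (\<lambda>_. 1) v) = ennreal (truncated_exit G B k v)" for k
    by (rule truncated_exit_eq_sum[OF assms, symmetric])
  ultimately show ?thesis
    using suminf_eq_SUP[of "\<lambda>j. survive G B j (\<lambda>_. 1) v"] by (simp only:)
qed

section \<open>Minima of linear functionals\<close>

lemma compact_PiE_UNIV:
  fixes S :: "'i \<Rightarrow> 'a::topological_space set"
  assumes "\<And>i. compact (S i)"
  shows "compact (PiE UNIV S)"
  using compactin_PiE[of "\<lambda>_. euclidean" UNIV S] assms
  by (simp add: euclidean_product_topology compactin_euclidean_iff)

lemma continuous_on_Max:
  fixes f :: "'i \<Rightarrow> 'a::topological_space \<Rightarrow> real"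
  assumes "finite I" "I \<noteq> {}" "\<And>i. i \<in> I \<Longrightarrow> continuous_on S (f i)"
  shows "continuous_on S (\<lambda>x. Max ((\<lambda>i. f i x) ` I))"
  using assms
proof (induction I rule: finite_ne_induct)
  case (insert i I)
  then have "continuous_on S (\<lambda>x. max (f i x) (Max ((\<lambda>i. f i x) ` I)))"
    by (intro continuous_on_max) auto
  with insert show ?case
    by simp
qed simp

text \<open>Minima of linear functionals with coefficients bounded away from \<open>0\<close>: the hypothesis exhibits
  a minimising functional at each point. Both \<open>\<Psi>\<close> and \<open>x \<mapsto> M x\<close> are of this form.\<close>

locale min_linear_map =
  fixes K :: nat and F :: "(nat \<Rightarrow> real) \<Rightarrow> nat \<Rightarrow> real" and c :: real
  assumes K_pos: "0 < K" and c_pos: "0 < c"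
    and support: "i < K \<Longrightarrow> \<forall>j<K. 0 < x j \<Longrightarrow> \<exists>a. (\<forall>j<K. c \<le> a j) \<and> F x i = (\<Sum>j<K. a j * x j) \<and>
      (\<forall>y. (\<forall>j<K. 0 < y j) \<longrightarrow> F y i \<le> (\<Sum>j<K. a j * y j))"
begin

abbreviation pos :: "(nat \<Rightarrow> real) \<Rightarrow> bool" where
  "pos x \<equiv> \<forall>j<K. 0 < x j"

definition supporting :: "nat \<Rightarrow> (nat \<Rightarrow> real) \<Rightarrow> (nat \<Rightarrow> real) \<Rightarrow> bool" where
  "supporting i x a \<longleftrightarrow> (\<forall>j<K. c \<le> a j) \<and> F x i = (\<Sum>j<K. a j * x j) \<and>
     (\<forall>y. pos y \<longrightarrow> F y i \<le> (\<Sum>j<K. a j * y j))"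

lemma ex_supporting: "i < K \<Longrightarrow> pos x \<Longrightarrow> \<exists>a. supporting i x a"
  unfolding supporting_def by (rule support)

lemma supportingD:
  assumes "supporting i x a"
  shows "\<And>j. j < K \<Longrightarrow> c \<le> a j" "F x i = (\<Sum>j<K. a j * x j)"
    "\<And>y. pos y \<Longrightarrow> F y i \<le> (\<Sum>j<K. a j * y j)"
  using assms by (simp_all add: supporting_def)

text \<open>Quantitative strict monotonicity: the functional supporting at the larger point
  \<open>y\<close> is exact there and dominates \<open>F\<close> at \<open>x\<close>, and every
  coefficient is at least \<open>c\<close>. Raising one coordinate therefore raises all
  values.\<close>

lemma gap:
  assumes "pos x" "pos y" "\<And>j. j < K \<Longrightarrow> x j \<le> y j" "i < K" "k < K"
  shows "F x i + c * (y k - x k) \<le> F y i"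
proof -
  obtain a where "supporting i y a"
    using ex_supporting[OF assms(4,2)] by blast
  note a = supportingD[OF this]
  have nn: "0 \<le> a j * (y j - x j)" if "j < K" for j
    using a(1)[OF that] c_pos assms(3)[OF that] by (intro mult_nonneg_nonneg) linarith+
  have "c * (y k - x k) \<le> a k * (y k - x k)"
    using a(1)[OF assms(5)] assms(3)[OF assms(5)] by (simp add: mult_right_mono)
  also have "\<dots> \<le> (\<Sum>j<K. a j * (y j - x j))"
    using nn assms(5) by (intro member_le_sum) auto
  also have "\<dots> = F y i - (\<Sum>j<K. a j * x j)"
    by (simp add: a(2) right_diff_distrib sum_subtractf)
  also have "\<dots> \<le> F y i - F x i"
    using a(3)[OF assms(1)] by simp
  finally show ?thesis
    by simp
qed

lemma mono:
  assumes "pos x" "\<And>j. j < K \<Longrightarrow> x j \<le> y j" "i < K"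
  shows "F x i \<le> F y i"
proof -
  have "pos y"
    using assms(1,2) by (auto intro: less_le_trans)
  then have "F x i + c * (y i - x i) \<le> F y i"
    using assms by (intro gap) auto
  moreover have "0 \<le> c * (y i - x i)"
    using c_pos assms by simp
  ultimately show ?thesis
    by simp
qed

text \<open>Needed because vectors are functions on all naturals, while equations such as the
  eigenvector equation hold only below \<open>K\<close>.\<close>

lemma cong:
  assumes "pos x" "\<And>j. j < K \<Longrightarrow> x j = y j" "i < K"
  shows "F x i = F y i"
proof (rule antisym)
  show "F x i \<le> F y i"
    using assms by (intro mono) auto
  show "F y i \<le> F x i"
    using assms by (intro mono) auto
qed

text \<open>The functional supporting at \<open>x\<close> gives one inequality for every factor; the
  other is the same inequality for the factor \<open>1 / s\<close> at the scaled point.\<close>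

lemma scale:
  assumes "pos x" "0 < s" "i < K"
  shows "F (\<lambda>j. s * x j) i = s * F x i"
proof -
  have le: "F (\<lambda>j. s * x j) i \<le> s * F x i" if x: "pos x" and s: "0 < s" for x s
  proof -
    obtain a where "supporting i x a"
      using ex_supporting[OF assms(3) x] by blast
    note a = supportingD[OF this]
    from a(3)[of "\<lambda>j. s * x j"] have "F (\<lambda>j. s * x j) i \<le> (\<Sum>j<K. a j * (s * x j))"
      using x s by simp
    then show ?thesis
      by (simp add: a(2) sum_distrib_left mult.left_commute)
  qed
  have "F (\<lambda>j. (1 / s) * (s * x j)) i \<le> 1 / s * F (\<lambda>j. s * x j) i"
    using assms by (intro le) auto
  then have "s * F x i \<le> F (\<lambda>j. s * x j) i"
    using assms by (simp add: field_simps)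
  with le[OF assms(1,2)] show ?thesis
    by simp
qed

lemma lower:
  assumes "pos x" "i < K"
  shows "c * (\<Sum>j<K. x j) \<le> F x i"
proof -
  obtain a where "supporting i x a"
    using ex_supporting[OF assms(2,1)] by blast
  note a = supportingD[OF this]
  show ?thesis
    unfolding a(2) sum_distrib_left using a(1) assms(1)
    by (intro sum_mono mult_right_mono) (auto intro: less_imp_le)
qed

lemma sum_pos': "pos x \<Longrightarrow> 0 < (\<Sum>j<K. x j)"
  using K_pos by (intro sum_pos) auto

lemma pos_F:
  assumes "pos x"
  shows "pos (F x)"
proof (intro allI impI)
  fix i
  assume "i < K"
  have "0 < c * (\<Sum>j<K. x j)"
    using c_pos sum_pos'[OF assms] by simp
  also have "\<dots> \<le> F x i"
    using lower[OF assms \<open>i < K\<close>] .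
  finally show "0 < F x i" .
qed

lemma pos_funpow:
  assumes "pos x"
  shows "pos ((F ^^ m) x)"
proof (induction m)
  case (Suc m)
  then show ?case
    using pos_F[of "(F ^^ m) x"] by simp
qed (use assms in simp)

text \<open>The functional supporting at the constant vector 1 dominates \<open>F\<close>
  everywhere; its coefficient sum is the constant for one index, and these are summed over the
  indices.\<close>

lemma ex_upper: "\<exists>C>0. \<forall>x i. pos x \<longrightarrow> i < K \<longrightarrow> F x i \<le> C * (\<Sum>j<K. x j)"
proof -
  define P where "P i C \<longleftrightarrow> 0 < C \<and> (\<forall>x. pos x \<longrightarrow> F x i \<le> C * (\<Sum>j<K. x j))" for i C
  have "\<exists>C. P i C" if i: "i < K" for i
  proof -
    obtain a where "supporting i (\<lambda>_. 1) a"
      using ex_supporting[OF i, of "\<lambda>_. 1"] by auto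
    note a = supportingD[OF this]
    have nn: "0 \<le> a j" if "j < K" for j
      using a(1)[OF that] c_pos by simp
    have "F x i \<le> (\<Sum>j<K. a j) * (\<Sum>j<K. x j)" if x: "pos x" for x
    proof -
      have "F x i \<le> (\<Sum>j<K. a j * x j)"
        using a(3)[OF x] .
      also have "\<dots> \<le> (\<Sum>j<K. (\<Sum>j<K. a j) * x j)"
        using nn x by (intro sum_mono mult_right_mono member_le_sum) (auto intro: less_imp_le)
      finally show ?thesis
        by (simp add: sum_distrib_left)
    qed
    moreover have "0 < (\<Sum>j<K. a j)"
      using a(1) c_pos K_pos by (intro sum_pos) (auto intro: less_le_trans)
    ultimately show ?thesis
      unfolding P_def by blast
  qed
  then obtain C where C: "\<And>i. i < K \<Longrightarrow> P i (C i)"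
    by metis
  have C0: "0 < C i" if "i < K" for i
    using C[OF that] by (simp add: P_def)
  have "F x i \<le> (\<Sum>i<K. C i) * (\<Sum>j<K. x j)" if x: "pos x" and i: "i < K" for x i
  proof -
    have "F x i \<le> C i * (\<Sum>j<K. x j)"
      using C[OF i] x by (simp add: P_def)
    also have "\<dots> \<le> (\<Sum>i<K. C i) * (\<Sum>j<K. x j)"
      using C0 i sum_pos'[OF x] by (intro mult_right_mono member_le_sum) (auto intro: less_imp_le)
    finally show ?thesis .
  qed
  moreover have "0 < (\<Sum>i<K. C i)"
    using C0 K_pos by (intro sum_pos) auto
  ultimately show ?thesis
    by blast
qed

text \<open>By \<open>lower\<close> and \<open>ex_upper\<close> every value of \<open>F x\<close> is
  comparable to the sum of the entries of \<open>x\<close>. So \<open>F\<close> maps the cone into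
  vectors of bounded ratio, which supplies compactness for the eigenvector and comparability of the
  iterates over all colours.\<close>

lemma ex_ratio_bound:
  "\<exists>\<kappa>\<ge>1. \<forall>x i j. pos x \<longrightarrow> i < K \<longrightarrow> j < K \<longrightarrow> F x i \<le> \<kappa> * F x j"
proof -
  obtain C where C: "C > 0" "\<And>x i. pos x \<Longrightarrow> i < K \<Longrightarrow> F x i \<le> C * (\<Sum>j<K. x j)"
    using ex_upper by blast
  have le: "F x i \<le> C / c * F x j" if "pos x" "i < K" "j < K" for x i j
  proof -
    have "F x i \<le> C * (\<Sum>j<K. x j)"
      using C that by blast
    also have "\<dots> = C / c * (c * (\<Sum>j<K. x j))"
      using c_pos by simp
    also have "\<dots> \<le> C / c * F x j"
      using lower[of x j] that C c_pos by (intro mult_left_mono) auto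
    finally show ?thesis .
  qed
  have one: "pos (\<lambda>_. 1)"
    by simp
  \<comment> \<open>Comparing an index with itself forces the ratio constant to be at least
    1.\<close>
  have "1 * F (\<lambda>_. 1) 0 \<le> C / c * F (\<lambda>_. 1) 0"
    using le[OF one K_pos K_pos] by simp
  then have "1 \<le> C / c"
    using pos_F[OF one] K_pos by (metis mult_le_cancel_right_pos)
  then show ?thesis
    using le by blast
qed

text \<open>On the box the coefficients of supporting functionals are bounded, so \<open>F\<close>
  is Lipschitz in the sum norm: use the functional supporting at \<open>y\<close> to bound the
  difference one way, then exchange \<open>x\<close> and \<open>y\<close>.\<close>

lemma continuous_on_box:
  assumes "i < K" and Q: "\<And>x j. x \<in> Q \<Longrightarrow> j < K \<Longrightarrow> 1 \<le> x j \<and> x j \<le> \<kappa>"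
  shows "continuous_on Q (\<lambda>x. F x i)"
proof -
  obtain C where C: "C > 0" "\<And>x i. pos x \<Longrightarrow> i < K \<Longrightarrow> F x i \<le> C * (\<Sum>j<K. x j)"
    using ex_upper by blast
  define L where "L = C * (K * \<kappa>)"
  have posQ: "pos x" if "x \<in> Q" for x
  proof (intro allI impI)
    show "0 < x j" if "j < K" for j
      using Q[OF \<open>x \<in> Q\<close> that] by linarith
  qed
  have le: "F x i - F y i \<le> L * (\<Sum>j<K. \<bar>x j - y j\<bar>)" if "x \<in> Q" "y \<in> Q" for x y
  proof -
    obtain a where "supporting i y a"
      using ex_supporting[OF assms(1) posQ[OF \<open>y \<in> Q\<close>]] by blast
    note a = supportingD[OF this]
    \<comment> \<open>Since y >= 1 on the box, each coefficient is at most its own summand of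
      \<open>F y i\<close>, and \<open>F y i\<close> is at most \<open>L\<close>.\<close>
    have aL: "0 \<le> a j \<and> a j \<le> L" if j: "j < K" for j
    proof -
      have nn: "0 \<le> a j * y j" if "j < K" for j
        using a(1)[OF that] c_pos Q[OF \<open>y \<in> Q\<close> that] by (intro mult_nonneg_nonneg) linarith+
      have "a j * 1 \<le> a j * y j"
        using a(1)[OF j] c_pos Q[OF \<open>y \<in> Q\<close> j] by (intro mult_left_mono) auto
      also have "\<dots> \<le> F y i"
        unfolding a(2) using j nn by (intro member_le_sum) auto
      also have "\<dots> \<le> C * (\<Sum>j<K. y j)"
        using C(2)[OF posQ[OF \<open>y \<in> Q\<close>] assms(1)] .
      also have "\<dots> \<le> C * (\<Sum>j<K. \<kappa>)"
        using Q[OF \<open>y \<in> Q\<close>] C(1) by (intro mult_left_mono sum_mono) auto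
      finally show ?thesis
        using a(1)[OF j] c_pos by (simp add: L_def)
    qed
    have "F x i - F y i \<le> (\<Sum>j<K. a j * x j) - (\<Sum>j<K. a j * y j)"
      using a(3)[OF posQ[OF that(1)]] by (simp add: a(2))
    also have "\<dots> = (\<Sum>j<K. a j * (x j - y j))"
      by (simp add: right_diff_distrib sum_subtractf)
    also have "\<dots> \<le> (\<Sum>j<K. L * \<bar>x j - y j\<bar>)"
    proof (intro sum_mono)
      fix j
      assume "j \<in> {..<K}"
      then have "a j * (x j - y j) \<le> a j * \<bar>x j - y j\<bar>" "a j * \<bar>x j - y j\<bar> \<le> L * \<bar>x j - y j\<bar>"
        using aL[of j] by (auto intro!: mult_left_mono mult_right_mono)
      then show "a j * (x j - y j) \<le> L * \<bar>x j - y j\<bar>"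
        by linarith
    qed
    finally show ?thesis
      by (simp add: sum_distrib_left)
  qed
  have "((\<lambda>x. F x i) \<longlongrightarrow> F y i) (at y within Q)" if y: "y \<in> Q" for y
  proof (rule metric_tendsto_imp_tendsto)
    have "continuous_on Q (\<lambda>x :: nat \<Rightarrow> real. L * (\<Sum>j<K. \<bar>x j - y j\<bar>))"
      by (intro continuous_intros continuous_on_product_coordinates[THEN continuous_on_subset]) auto
    then show "((\<lambda>x. L * (\<Sum>j<K. \<bar>x j - y j\<bar>)) \<longlongrightarrow> 0) (at y within Q)"
      using y by (auto simp: continuous_on_def)
    have "dist (F x i) (F y i) \<le> dist (L * (\<Sum>j<K. \<bar>x j - y j\<bar>)) 0" if "x \<in> Q" for x
      using le[OF that y] le[OF y that] by (simp add: dist_real_def abs_minus_commute)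
    then show "\<forall>\<^sub>F x in at y within Q. dist (F x i) (F y i) \<le> dist (L * (\<Sum>j<K. \<bar>x j - y j\<bar>)) 0"
      by (auto simp: eventually_at_filter)
  qed
  then show ?thesis
    by (simp add: continuous_on_def)
qed

text \<open>Collatz--Wielandt: a minimiser of \<open>max\<^sub>i F\<^sub>i(x) / x\<^sub>i\<close> is an eigenvector, since otherwise
  replacing \<open>x\<close> by \<open>F x\<close> lowers all the quotients strictly.\<close>

lemma ex_eigenvector: "\<exists>t>0. \<exists>x. pos x \<and> (\<forall>i<K. F x i = t * x i)"
proof -
  obtain \<kappa> where \<kappa>: "\<kappa> \<ge> 1" "\<And>x i j. pos x \<Longrightarrow> i < K \<Longrightarrow> j < K \<Longrightarrow> F x i \<le> \<kappa> * F x j"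
    using ex_ratio_bound by blast
  define Q where "Q = PiE (UNIV :: nat set) (\<lambda>j. if j < K then {1..\<kappa>} else {1})"
  have Q: "x \<in> Q \<longleftrightarrow> (\<forall>j. if j < K then 1 \<le> x j \<and> x j \<le> \<kappa> else x j = 1)" for x
    by (auto simp: Q_def PiE_iff split: if_splits)
  have posQ: "pos x" if "x \<in> Q" for x
  proof (intro allI impI)
    fix j
    assume "j < K"
    with \<open>x \<in> Q\<close> have "1 \<le> x j"
      unfolding Q by metis
    then show "0 < x j"
      by linarith
  qed
  define \<phi> where "\<phi> x = Max ((\<lambda>i. F x i / x i) ` {..<K})" for x :: "nat \<Rightarrow> real"
  have "compact Q"
    unfolding Q_def by (rule compact_PiE_UNIV) auto
  moreover have "(\<lambda>_. 1) \<in> Q"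
    using \<kappa> by (simp add: Q)
  moreover have "continuous_on Q \<phi>"
    unfolding \<phi>_def
  proof (rule continuous_on_Max)
    fix i
    assume "i \<in> {..<K}"
    then have "continuous_on Q (\<lambda>x. F x i)"
      using Q by (intro continuous_on_box[of _ _ \<kappa>]) (auto split: if_splits)
    then show "continuous_on Q (\<lambda>x. F x i / x i)"
      using posQ \<open>i \<in> {..<K}\<close>
      by (intro continuous_intros continuous_on_product_coordinates[THEN continuous_on_subset]) fastforce+
  qed (use K_pos in auto)
  ultimately obtain x where x: "x \<in> Q" and min: "\<And>y. y \<in> Q \<Longrightarrow> \<phi> x \<le> \<phi> y"
    using continuous_attains_inf[of Q \<phi>] by blast
  define t where "t = \<phi> x"
  have px: "pos x"
    using posQ x by blast
  have le_t: "F x i / x i \<le> t" if "i < K" for i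
    unfolding t_def \<phi>_def using that by (intro Max_ge) auto
  have Fx: "F x i \<le> t * x i" if "i < K" for i
    using le_t[OF that] px that by (simp add: divide_le_eq mult.commute)
  have t: "0 < t"
    using le_t[OF K_pos] px pos_F[OF px] K_pos by (meson divide_pos_pos less_le_trans)
  have "F x i = t * x i" if "i < K" for i
  proof (rule ccontr)
    assume "F x i \<noteq> t * x i"
    with Fx[OF that] have lt: "F x i < t * x i"
      by simp
    \<comment> \<open>By \<open>gap\<close>, strictness at the single index \<open>i\<close> spreads
      to every index \<open>k\<close>.\<close>
    have strict: "F (F x) k < t * F x k" if "k < K" for k
    proof -
      have "F (F x) k + c * (t * x i - F x i) \<le> F (\<lambda>j. t * x j) k"
        using px t Fx \<open>k < K\<close> \<open>i < K\<close> by (intro gap pos_F) auto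
      moreover have "F (\<lambda>j. t * x j) k = t * F x k"
        using scale px t that by blast
      moreover have "0 < c * (t * x i - F x i)"
        using lt c_pos by simp
      ultimately show ?thesis
        by linarith
    qed
    define s where "s = Min (F x ` {..<K})"
    have ne: "finite (F x ` {..<K})" "F x ` {..<K} \<noteq> {}"
      using K_pos by auto
    obtain l where l: "l < K" "s = F x l"
      using Min_in[OF ne] unfolding s_def by auto
    have s: "0 < s"
      using l pos_F[OF px] by simp
    \<comment> \<open>Dividing \<open>F x\<close> by its least entry \<open>s\<close> returns to the
      box: the entries become at least 1, and at most \<kappa> by the ratio bound.\<close>
    define z where "z j = (if j < K then F x j / s else 1)" for j
    have "z \<in> Q"
      unfolding Q
    proof
      fix j
      have "s \<le> F x j" if "j < K"
        unfolding s_def using that by (intro Min_le) auto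
      moreover have "F x j \<le> \<kappa> * s" if "j < K"
        using \<kappa>(2)[OF px that l(1)] l(2) by simp
      ultimately show "if j < K then 1 \<le> z j \<and> z j \<le> \<kappa> else z j = 1"
        using s by (simp add: z_def field_simps)
    qed
    then have "t \<le> \<phi> z"
      using min by (simp add: t_def)
    moreover have "\<phi> z \<in> (\<lambda>i. F z i / z i) ` {..<K}"
      unfolding \<phi>_def using K_pos by (intro Max_in) auto
    then obtain k where k: "k < K" "\<phi> z = F z k / z k"
      by auto
    moreover have "F z k = 1 / s * F (F x) k"
    proof -
      have "F z k = F (\<lambda>j. 1 / s * F x j) k"
        using posQ[OF \<open>z \<in> Q\<close>] k by (intro cong) (auto simp: z_def)
      then show ?thesis
        using scale[of "F x" "1 / s" k] pos_F[OF px] s k by simp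
    qed
    ultimately have "t * F x k \<le> F (F x) k"
      using s pos_F[OF px] by (simp add: z_def field_simps)
    with strict[OF k(1)] show False
      by simp
  qed
  with t px show ?thesis
    by blast
qed

lemma funpow_mono:
  assumes "pos x" "\<And>j. j < K \<Longrightarrow> x j \<le> y j" "i < K"
  shows "(F ^^ m) x i \<le> (F ^^ m) y i"
  using assms(3)
proof (induction m arbitrary: i)
  case (Suc m)
  then show ?case
    using pos_funpow[OF assms(1)] by (auto intro!: mono)
qed (use assms in auto)

lemma funpow_eigenvector:
  assumes "pos x" "\<And>i. i < K \<Longrightarrow> F x i = t * x i" "0 < t" "0 < s" "i < K"
  shows "(F ^^ m) (\<lambda>j. s * x j) i = s * (t ^ m * x i)"
  using assms(5)
proof (induction m arbitrary: i)
  case (Suc m)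
  have "F ((F ^^ m) (\<lambda>j. s * x j)) i = F (\<lambda>j. (s * t ^ m) * x j) i"
    using Suc assms pos_funpow[of "\<lambda>j. s * x j" m] by (intro cong) (auto simp: mult.assoc)
  also have "\<dots> = (s * t ^ m) * F x i"
    using assms Suc.prems by (intro scale) auto
  finally show ?case
    using assms(2)[OF Suc.prems] by (simp add: mult_ac)
qed (use assms in auto)

lemma ex_comparison:
  assumes "pos x" "pos y"
  shows "\<exists>s>0. \<forall>j<K. s * x j \<le> y j"
proof -
  define s where "s = Min ((\<lambda>j. y j / x j) ` {..<K})"
  have ne: "finite ((\<lambda>j. y j / x j) ` {..<K})" "(\<lambda>j. y j / x j) ` {..<K} \<noteq> {}"
    using K_pos by auto
  obtain l where "l < K" "s = y l / x l"
    using Min_in[OF ne] unfolding s_def by auto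
  then have "0 < s"
    using assms by simp
  moreover have "s \<le> y j / x j" if "j < K" for j
    unfolding s_def using that by (intro Min_le) auto
  ultimately show ?thesis
    using assms by (auto simp: field_simps)
qed

text \<open>Multiples of the eigenvector squeeze \<open>y\<close> from both sides, and on them the
  iterates are explicit. The numbers \<open>u\<close> and \<open>1 / w\<close> bound the entries of
  the eigenvector, which removes the dependence on \<open>i\<close>.\<close>

lemma growth:
  assumes "pos x" "\<And>i. i < K \<Longrightarrow> F x i = t * x i" "0 < t" "pos y"
  shows "\<exists>b>0. \<exists>B>0. \<forall>m. \<forall>i<K. b * t ^ m \<le> (F ^^ m) y i \<and> (F ^^ m) y i \<le> B * t ^ m"
proof -
  obtain r where r: "0 < r" "\<And>j. j < K \<Longrightarrow> r * x j \<le> y j"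
    using ex_comparison[OF assms(1,4)] by auto
  obtain s where s: "0 < s" "\<And>j. j < K \<Longrightarrow> s * y j \<le> x j"
    using ex_comparison[OF assms(4,1)] by auto
  obtain u where u: "0 < u" "\<And>j. j < K \<Longrightarrow> u \<le> x j"
    using ex_comparison[of "\<lambda>_. 1" x] assms by auto
  obtain w where w: "0 < w" "\<And>j. j < K \<Longrightarrow> w * x j \<le> 1"
    using ex_comparison[of x "\<lambda>_. 1"] assms by auto
  have "r * u * t ^ m \<le> (F ^^ m) y i \<and> (F ^^ m) y i \<le> 1 / (s * w) * t ^ m" if "i < K" for m i
  proof
    have "r * u * t ^ m \<le> r * (t ^ m * x i)"
      using r(1) u(2)[OF that] assms(3) by (simp add: mult_ac)
    also have "\<dots> = (F ^^ m) (\<lambda>j. r * x j) i"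
      using funpow_eigenvector[OF assms(1-3) r(1) that] by simp
    also have "\<dots> \<le> (F ^^ m) y i"
      using r assms that by (intro funpow_mono) auto
    finally show "r * u * t ^ m \<le> (F ^^ m) y i" .
    have "(F ^^ m) y i \<le> (F ^^ m) (\<lambda>j. 1 / s * x j) i"
      using s assms that by (intro funpow_mono) (auto simp: field_simps)
    also have "\<dots> = 1 / s * (t ^ m * x i)"
      using funpow_eigenvector[OF assms(1-3) _ that, of "1 / s" m] s(1) by simp
    also have "\<dots> \<le> 1 / s * (t ^ m * (1 / w))"
      using s(1) w(1) w(2)[OF that] assms(3)
      by (intro mult_left_mono) (auto simp: field_simps)
    finally show "(F ^^ m) y i \<le> 1 / (s * w) * t ^ m"
      by (simp add: field_simps)
  qed
  moreover have "0 < r * u" "0 < 1 / (s * w)"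
    using r s u w by auto
  ultimately show ?thesis
    by blast
qed

text \<open>The iterates from \<open>x\<close> grow exactly like s^m, but by the squeeze with
  \<open>y\<close> at most like t^m.\<close>

lemma eigenvalue_le:
  assumes "pos x" "\<And>i. i < K \<Longrightarrow> F x i = s * x i" "0 < s"
    and "pos y" "\<And>i. i < K \<Longrightarrow> F y i = t * y i" "0 < t"
  shows "s \<le> t"
proof (rule ccontr)
  assume "\<not> s \<le> t"
  obtain B where B: "\<And>m i. i < K \<Longrightarrow> (F ^^ m) x i \<le> B * t ^ m"
    using growth[OF assms(4-6,1)] by blast
  have "(s / t) ^ m \<le> B / x 0" for m
  proof -
    have "1 * (s ^ m * x 0) \<le> B * t ^ m"
      using B[of 0 m] funpow_eigenvector[of x s 1 0 m] assms(1-3) K_pos by simp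
    then show ?thesis
      using assms(1,6) K_pos by (simp add: field_simps)
  qed
  moreover obtain m where "B / x 0 < (s / t) ^ m"
    using real_arch_pow[of "s / t" "B / x 0"] \<open>\<not> s \<le> t\<close> assms(6) by auto
  ultimately show False
    by (meson not_less)
qed

text \<open>Has the shape of the predicate under \<open>THE\<close> in
  \<open>rho_resistance\<close>, so that uniqueness identifies that constant.\<close>

definition positive_eigenvalue :: "real \<Rightarrow> bool" where
  "positive_eigenvalue t \<longleftrightarrow> 0 < t \<and> (\<exists>x. pos x \<and> (\<forall>i<K. F x i = t * x i))"

lemma ex1_eigenvalue: "\<exists>!t. positive_eigenvalue t"
proof (rule ex_ex1I)
  show "\<exists>t. positive_eigenvalue t"
    using ex_eigenvector unfolding positive_eigenvalue_def by blast
  have le: "s \<le> t" if st: "positive_eigenvalue s" "positive_eigenvalue t" for s t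
  proof -
    obtain x where x: "pos x" "\<forall>i<K. F x i = s * x i"
      using st(1) unfolding positive_eigenvalue_def by (elim conjE exE)
    obtain y where y: "pos y" "\<forall>i<K. F y i = t * y i"
      using st(2) unfolding positive_eigenvalue_def by (elim conjE exE)
    show ?thesis
      using x y st by (intro eigenvalue_le[of x s y t]) (simp_all add: positive_eigenvalue_def)
  qed
  show "s = t" if "positive_eigenvalue s" "positive_eigenvalue t" for s t
    using le that by (simp add: antisym)
qed

lemma ex_growth:
  assumes "positive_eigenvalue t" "pos y"
  shows "\<exists>b>0. \<exists>B>0. \<forall>m. \<forall>i<K. b * t ^ m \<le> (F ^^ m) y i \<and> (F ^^ m) y i \<le> B * t ^ m"
proof -
  obtain x where x: "pos x" "\<forall>i<K. F x i = t * x i"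
    using assms(1) unfolding positive_eigenvalue_def by (elim conjE exE)
  show ?thesis
    using x assms by (intro growth[of x t y]) (simp_all add: positive_eigenvalue_def)
qed

end

section \<open>Graph distance and exit from balls\<close>

abbreviation adj :: "('a, 'b) pre_digraph \<Rightarrow> ('a \<times> 'a) set" where
  "adj G \<equiv> arcs_ends (undir G)"

lemma verts_undir [simp]: "verts (undir G) = verts G"
  by (simp add: undir_def)

lemma adj_iff:
  "(x, y) \<in> adj G \<longleftrightarrow>
     (\<exists>e\<in>arcs G. (x = tail G e \<and> y = head G e) \<or> (x = head G e \<and> y = tail G e))"
  by (auto simp: undir_def arcs_ends_conv parcs_mk_symmetric)

lemma adj_sym: "(x, y) \<in> adj G \<Longrightarrow> (y, x) \<in> adj G"
  by (auto simp: adj_iff)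

lemma adj_relpow_sym: "(x, y) \<in> adj G ^^ l \<Longrightarrow> (y, x) \<in> adj G ^^ l"
proof (induction l arbitrary: y)
  case (Suc l)
  then obtain z where "(x, z) \<in> adj G ^^ l" "(z, y) \<in> adj G"
    by auto
  then show ?case
    using relpow_Suc_I2[OF adj_sym Suc.IH] by blast
qed simp

lemma adj_rtrancl_sym: "(x, y) \<in> (adj G)\<^sup>* \<Longrightarrow> (y, x) \<in> (adj G)\<^sup>*"
  unfolding rtrancl_is_UN_relpow by (auto dest: adj_relpow_sym)

lemma adj_verts:
  assumes "wf_digraph G" "(x, y) \<in> adj G"
  shows "x \<in> verts G" "y \<in> verts G"
  using assms by (auto simp: adj_iff wf_digraph_def)

text \<open>Together with \<open>relpow_vwalk\<close> this replaces the walks in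
  \<open>gdist\<close> by powers of the adjacency relation, which compose and reverse
  easily.\<close>

lemma vwalk_relpow:
  assumes "vwalk p H"
  shows "(hd p, last p) \<in> arcs_ends H ^^ (length p - 1)"
  using assms
proof (induction p rule: vwalk_induct)
  case (Cons u v es)
  then have "(u, last (v # es)) \<in> arcs_ends H ^^ Suc (length (v # es) - 1)"
    by (intro relpow_Suc_I2) auto
  then show ?case
    by (simp del: relpow.simps)
qed simp

lemma relpow_vwalk:
  assumes "arcs_ends H \<subseteq> verts H \<times> verts H" "u \<in> verts H" "(u, v) \<in> arcs_ends H ^^ l"
  shows "\<exists>p. vwalk p H \<and> hd p = u \<and> last p = v \<and> vwalk_length p = l"
  using assms(2,3)
proof (induction l arbitrary: u)
  case 0
  then show ?case
    by (intro exI[of _ "[u]"]) (auto simp: vwalk_def)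
next
  case (Suc l)
  then obtain w where w: "(u, w) \<in> arcs_ends H" "(w, v) \<in> arcs_ends H ^^ l"
    by (meson relpow_Suc_E2)
  then obtain p where p: "vwalk p H" "hd p = w" "last p = v" "vwalk_length p = l"
    using Suc.IH[of w] assms(1) by auto
  then have "p \<noteq> []"
    by (auto simp: vwalk_def)
  then have "vwalk (u # p) H \<and> hd (u # p) = u \<and> last (u # p) = v \<and> vwalk_length (u # p) = Suc l"
    using p w Suc.prems by (auto intro: vwalk_consI simp: Suc_diff_Suc)
  then show ?case
    by blast
qed

lemma gdist_le:
  assumes "wf_digraph G" "u \<in> verts G" "(u, v) \<in> adj G ^^ l"
  shows "gdist G u v \<le> l"
  unfolding gdist_def
proof (rule Least_le)
  show "\<exists>p. vwalk p (undir G) \<and> hd p = u \<and> last p = v \<and> vwalk_length p = l"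
    using assms adj_verts[OF assms(1)] by (intro relpow_vwalk) auto
qed

lemma gdist_relpow:
  assumes "wf_digraph G" "u \<in> verts G" "(u, v) \<in> (adj G)\<^sup>*"
  shows "(u, v) \<in> adj G ^^ gdist G u v"
proof -
  obtain l where "(u, v) \<in> adj G ^^ l"
    using assms(3) by (auto simp: rtrancl_is_UN_relpow)
  then have "\<exists>l p. vwalk p (undir G) \<and> hd p = u \<and> last p = v \<and> vwalk_length p = l"
    using assms adj_verts[OF assms(1)] by (intro exI[of _ l] relpow_vwalk) auto
  from LeastI_ex[OF this] obtain p where
    "vwalk p (undir G)" "hd p = u" "last p = v" "vwalk_length p = gdist G u v"
    unfolding gdist_def by blast
  then show ?thesis
    using vwalk_relpow[of p "undir G"] by simp
qed

text \<open>The source of lower bounds on distances: a function changing by at most 1 along edges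
  cannot separate two vertices faster than walks do.\<close>

lemma lipschitz_relpow:
  fixes f :: "'a \<Rightarrow> real"
  assumes "\<And>e. e \<in> arcs G \<Longrightarrow> \<bar>f (tail G e) - f (head G e)\<bar> \<le> 1" "(u, v) \<in> adj G ^^ l"
  shows "\<bar>f u - f v\<bar> \<le> l"
  using assms(2)
proof (induction l arbitrary: v)
  case (Suc l)
  then obtain w where w: "(u, w) \<in> adj G ^^ l" "(w, v) \<in> adj G"
    by auto
  then have "\<bar>f w - f v\<bar> \<le> 1"
    using assms(1) unfolding adj_iff by (metis abs_minus_commute)
  with Suc.IH[OF w(1)] show ?case
    by simp
qed simp

definition conn :: "('a, 'b) pre_digraph \<Rightarrow> bool" where
  "conn G \<longleftrightarrow> (\<forall>u\<in>verts G. \<forall>v\<in>verts G. (u, v) \<in> (adj G)\<^sup>*)"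

lemma connected_imp_conn: "Digraph_Component.connected G \<Longrightarrow> conn G"
proof -
  assume c: "Digraph_Component.connected G"
  have "(x, y) \<in> arcs_ends G \<longleftrightarrow> (\<exists>e\<in>arcs G. x = tail G e \<and> y = head G e)" for x y
    by (auto simp: arcs_ends_conv)
  moreover have "(x, y) \<in> (arcs_ends G)\<^sup>s \<longleftrightarrow> (x, y) \<in> arcs_ends G \<or> (y, x) \<in> arcs_ends G" for x y
    by (auto simp: symcl_def)
  ultimately have "(x, y) \<in> (arcs_ends G)\<^sup>s \<longleftrightarrow> (x, y) \<in> adj G" for x y
    unfolding adj_iff by blast
  then have "(arcs_ends G)\<^sup>s = adj G"
    by auto
  moreover have "(u, v) \<in> (adj G)\<^sup>*" if "(u, v) \<in> rtrancl_on (verts G) (adj G)" for u v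
    using that by (induction rule: rtrancl_on_induct) auto
  ultimately show ?thesis
    using c unfolding connected_conv conn_def by simp
qed

lemma simple_graphD:
  assumes "simple_graph G"
  shows "wf_digraph G" "finite (arcs G)" "finite (verts G)"
    "\<And>e. e \<in> arcs G \<Longrightarrow> tail G e \<in> verts G \<and> head G e \<in> verts G \<and> tail G e \<noteq> head G e"
    "\<And>e f. e \<in> arcs G \<Longrightarrow> f \<in> arcs G \<Longrightarrow> {tail G e, head G e} = {tail G f, head G f} \<Longrightarrow> e = f"
proof -
  interpret fin_digraph G
    using assms by (simp add: simple_graph_def)
  interpret loopfree_digraph G
    using assms by (simp add: simple_graph_def)
  show "wf_digraph G" "finite (arcs G)" "finite (verts G)"
    by (rule wf_digraph finite_arcs finite_verts)+
  show "tail G e \<in> verts G \<and> head G e \<in> verts G \<and> tail G e \<noteq> head G e" if "e \<in> arcs G" for e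
    using that no_loops by simp
  show "e = f" if "e \<in> arcs G" "f \<in> arcs G" "{tail G e, head G e} = {tail G f, head G f}" for e f
    using assms that by (simp add: simple_graph_def)
qed

lemma neighbours_subset: "wf_digraph G \<Longrightarrow> neighbours G x \<subseteq> verts G"
  by (auto simp: neighbours_def dest: adj_verts)

text \<open>The ordered adjacent pairs are the disjoint union of the arcs and the reversed arcs.
  Injectivity and disjointness are where simplicity enters: no loops, no parallel and no
  antiparallel arcs.\<close>

lemma sum_over_neighbours:
  fixes \<phi> :: "'a \<Rightarrow> 'a \<Rightarrow> real"
  assumes G: "simple_graph G"
  shows "(\<Sum>x\<in>verts G. \<Sum>y\<in>neighbours G x. \<phi> x y)
    = (\<Sum>e\<in>arcs G. \<phi> (tail G e) (head G e) + \<phi> (head G e) (tail G e))"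
proof -
  note D = simple_graphD[OF G]
  define f where "f e = (tail G e, head G e)" for e
  define g where "g e = (head G e, tail G e)" for e
  have fin: "finite (neighbours G x)" for x
    using neighbours_subset[OF D(1)] D(3) by (rule finite_subset)
  have "(SIGMA x:verts G. neighbours G x) = f ` arcs G \<union> g ` arcs G"
    using D(4) by (auto simp: f_def g_def neighbours_def adj_iff)
  moreover have "f ` arcs G \<inter> g ` arcs G = {}"
  proof -
    have "f e \<noteq> g e'" if "e \<in> arcs G" "e' \<in> arcs G" for e e'
    proof
      assume eq: "f e = g e'"
      then have "e = e'"
        using that by (intro D(5)) (auto simp: f_def g_def)
      with eq have "fst (f e) = fst (g e)"
        by metis
      then show False
        using D(4)[OF that(1)] by (simp add: f_def g_def)
    qed
    then show ?thesis
      unfolding disjoint_iff by (intro allI impI notI) (elim imageE, simp)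
  qed
  moreover have "inj_on f (arcs G)"
    using D(5) by (auto intro!: inj_onI simp: f_def)
  moreover have "inj_on g (arcs G)"
    using D(5) by (auto intro!: inj_onI simp: g_def)
  ultimately have "(\<Sum>(x, y)\<in>(SIGMA x:verts G. neighbours G x). \<phi> x y)
      = (\<Sum>e\<in>arcs G. case f e of (x, y) \<Rightarrow> \<phi> x y) + (\<Sum>e\<in>arcs G. case g e of (x, y) \<Rightarrow> \<phi> x y)"
    using D(2) by (simp add: sum.union_disjoint sum.reindex)
  then show ?thesis
    using fin D(3) by (simp add: sum.Sigma f_def g_def sum.distrib)
qed

text \<open>Discrete Green formula; the inner sum on the right is deg(x) (u - P u)(x).\<close>

lemma energy_eq_generator:
  fixes h u :: "'a \<Rightarrow> real"
  assumes "simple_graph G"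
  shows "(\<Sum>e\<in>arcs G. (h (tail G e) - h (head G e)) * (u (tail G e) - u (head G e)))
    = (\<Sum>x\<in>verts G. h x * (\<Sum>y\<in>neighbours G x. u x - u y))"
  using sum_over_neighbours[OF assms, of "\<lambda>x y. h x * (u x - u y)"]
  by (simp add: sum_distrib_left algebra_simps)

lemma sum_degree:
  fixes h :: "'a \<Rightarrow> real"
  assumes "simple_graph G"
  shows "(\<Sum>x\<in>verts G. h x * card (neighbours G x)) = (\<Sum>e\<in>arcs G. h (tail G e) + h (head G e))"
  using sum_over_neighbours[OF assms, of "\<lambda>x y. h x"] by (simp add: mult.commute)

text \<open>By Green's formula it suffices that u - P u <= 1 everywhere, because \<open>h\<close> is
  nonnegative. This holds for each truncation, so no passage to the limit is involved.\<close>

lemma truncated_exit_energy_le: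
  fixes G :: "('a, 'b) pre_digraph" and B :: "'a set" and k :: nat and h :: "'a \<Rightarrow> real"
  assumes G: "simple_graph G" and h: "\<And>x. x \<in> verts G \<Longrightarrow> 0 \<le> h x"
  defines "u \<equiv> truncated_exit G B k"
  shows "(\<Sum>e\<in>arcs G. (h (tail G e) - h (head G e)) * (u (tail G e) - u (head G e)))
    \<le> (\<Sum>e\<in>arcs G. h (tail G e) + h (head G e))"
  unfolding energy_eq_generator[OF G] sum_degree[OF G, symmetric]
proof (intro sum_mono mult_left_mono)
  fix x
  assume "x \<in> verts G"
  let ?N = "neighbours G x"
  have fin: "finite ?N"
    using neighbours_subset simple_graphD[OF G] finite_subset by metis
  show "(\<Sum>y\<in>?N. u x - u y) \<le> card ?N"
  proof (cases "x \<in> B \<and> ?N \<noteq> {}")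
    case True
    then have d: "0 < card ?N"
      using fin by (simp add: card_gt_0_iff)
    \<comment> \<open>The recursion gives 1 + P u for the truncation at \<open>Suc k\<close>, which
      dominates \<open>u\<close>, the truncation at \<open>k\<close>.\<close>
    have "u x \<le> 1 + (\<Sum>y\<in>?N. u y) / card ?N"
      using truncated_exit_Suc_mono[of G B k x] True by (simp add: u_def)
    then have "card ?N * u x \<le> card ?N * (1 + (\<Sum>y\<in>?N. u y) / card ?N)"
      by (intro mult_left_mono) auto
    also have "\<dots> = card ?N + (\<Sum>y\<in>?N. u y)"
      using d by (simp add: field_simps)
    finally show ?thesis
      by (simp add: sum_subtractf)
  next
    case False
    have nn: "0 \<le> u y" for y
      by (simp add: u_def truncated_exit_nonneg)
    have "(\<Sum>y\<in>?N. u x - u y) \<le> 0"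
    proof (rule sum_nonpos)
      show "u x - u y \<le> 0" if "y \<in> ?N" for y
        using False nn[of y] that by (auto simp: u_def truncated_exit_outside)
    qed
    also have "0 \<le> real (card ?N)"
      by simp
    finally show ?thesis .
  qed
qed (use h in auto)

text \<open>A bound uniform in \<open>k\<close> propagates from \<open>v\<close> along a shortest
  path: every vertex of the path before its end lies in the ball, where the recursion controls the
  neighbours.\<close>

lemma truncated_exit_bounded_ball:
  assumes G: "simple_graph G" "conn G" and v: "v \<in> verts G"
    and bdd: "\<And>k. truncated_exit G (gball G v r) k v \<le> C"
    and x: "x \<in> gball G v r"
  shows "\<exists>C. \<forall>k. truncated_exit G (gball G v r) k x \<le> C"
proof -
  let ?u = "truncated_exit G (gball G v r)"
  note D = simple_graphD[OF G(1)]
  have "\<exists>C. \<forall>k. ?u k y \<le> C" if "(v, y) \<in> adj G ^^ l" "real l < r" for l y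
    using that
  proof (induction l arbitrary: y)
    case 0
    then show ?case
      using bdd by auto
  next
    case (Suc l)
    then obtain z where z: "(v, z) \<in> adj G ^^ l" "(z, y) \<in> adj G"
      by auto
    then obtain C' where C': "\<And>k. ?u k z \<le> C'"
      using Suc.IH[of z] Suc.prems by auto
    let ?N = "neighbours G z"
    have y: "y \<in> ?N"
      using z by (simp add: neighbours_def)
    have fin: "finite ?N"
      using neighbours_subset[OF D(1)] D(3) by (rule finite_subset)
    then have d: "0 < card ?N"
      using y by (auto simp: card_gt_0_iff)
    have "gdist G v z \<le> l"
      using gdist_le[OF D(1) v z(1)] .
    then have "z \<in> gball G v r"
      using adj_verts[OF D(1) z(2)] Suc.prems(2) by (simp add: gball_def)
    have "?u k y \<le> card ?N * C'" for k
    proof -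
      \<comment> \<open>By nonnegativity one neighbour is at most the sum over all, and that sum is
        at most the degree times the next truncation at \<open>z\<close>.\<close>
      have "?u k y \<le> (\<Sum>y\<in>?N. ?u k y)"
        using y fin by (intro member_le_sum) (auto simp: truncated_exit_nonneg)
      also have "\<dots> \<le> card ?N * ?u (Suc k) z"
        using d \<open>z \<in> gball G v r\<close> by (simp add: field_simps)
      also have "\<dots> \<le> card ?N * C'"
        using C'[of "Suc k"] by (intro mult_left_mono) (simp_all del: truncated_exit.simps)
      finally show ?thesis .
    qed
    then show ?case
      by (intro exI allI)
  qed
  moreover have "(v, x) \<in> adj G ^^ gdist G v x"
    using x v G(2) by (intro gdist_relpow[OF D(1)]) (auto simp: gball_def conn_def)
  moreover have "real (gdist G v x) < r"
    using x by (simp add: gball_def)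
  ultimately show ?thesis
    by blast
qed

text \<open>Finiteness at \<open>v\<close> spreads over the ball, so the monotone limit
  \<open>u\<close> is real and solves u = 1 + P u there exactly. The energy inequality for
  truncations thus becomes an equality for test functions supported in the ball.\<close>

lemma exit_time_energy:
  assumes G: "simple_graph G" "conn G" and v: "v \<in> verts G"
    and ne: "\<And>x. x \<in> verts G \<Longrightarrow> neighbours G x \<noteq> {}"
    and bdd: "\<And>k. truncated_exit G (gball G v r) k v \<le> C"
  shows "\<exists>u. expected_exit_time G v (gball G v r) = ennreal (u v) \<and> (\<forall>x. 0 \<le> u x) \<and>
    (\<forall>h. (\<forall>x\<in>verts G. x \<notin> gball G v r \<longrightarrow> h x = 0) \<longrightarrow>
      (\<Sum>e\<in>arcs G. (h (tail G e) - h (head G e)) * (u (tail G e) - u (head G e)))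
      = (\<Sum>e\<in>arcs G. h (tail G e) + h (head G e)))"
proof -
  let ?B = "gball G v r"
  let ?u = "truncated_exit G ?B"
  note D = simple_graphD[OF G(1)]
  have fin: "finite (neighbours G x)" for x
    using neighbours_subset[OF D(1)] D(3) by (rule finite_subset)
  define u where "u x = (SUP k. ?u k x)" for x
  have ex: "\<exists>C. \<forall>k. ?u k x \<le> C" for x
  proof (cases "x \<in> ?B")
    case True
    then show ?thesis
      by (rule truncated_exit_bounded_ball[OF G v bdd])
  next
    case False
    then show ?thesis
      by (auto simp: truncated_exit_outside)
  qed
  have above: "bdd_above (range (\<lambda>k. ?u k x))" for x
    using ex[of x] by (auto intro: bdd_aboveI2)
  have mono: "incseq (\<lambda>k. ?u k x)" for x
    by (rule incseq_SucI) (rule truncated_exit_Suc_mono)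
  have lim: "(\<lambda>k. ?u k x) \<longlonglongrightarrow> u x" for x
    unfolding u_def by (rule LIMSEQ_incseq_SUP[OF above mono])
  have nn: "0 \<le> u x" for x
    by (rule LIMSEQ_le_const[OF lim]) (auto simp: truncated_exit_nonneg)
  have eq: "u x = 1 + (\<Sum>y\<in>neighbours G x. u y) / card (neighbours G x)" if "x \<in> ?B" for x
  proof (rule LIMSEQ_unique)
    show "(\<lambda>k. ?u (Suc k) x) \<longlonglongrightarrow> u x"
      using lim by (rule LIMSEQ_Suc)
    have "(\<lambda>k. 1 + (\<Sum>y\<in>neighbours G x. ?u k y) / card (neighbours G x))
        \<longlonglongrightarrow> 1 + (\<Sum>y\<in>neighbours G x. u y) / card (neighbours G x)"
      using that ne fin by (intro tendsto_intros lim) (auto simp: gball_def)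
    then show "(\<lambda>k. ?u (Suc k) x) \<longlonglongrightarrow> 1 + (\<Sum>y\<in>neighbours G x. u y) / card (neighbours G x)"
      using that by simp
  qed
  have "expected_exit_time G v ?B = (SUP k. ennreal (?u k v))"
    using ne fin by (intro expected_exit_time_eq_SUP) (auto simp: gball_def)
  also have "\<dots> = ennreal (u v)"
  proof (rule LIMSEQ_unique)
    show "(\<lambda>k. ennreal (?u k v)) \<longlonglongrightarrow> (SUP k. ennreal (?u k v))"
      by (intro LIMSEQ_SUP incseq_SucI ennreal_leI truncated_exit_Suc_mono)
    show "(\<lambda>k. ennreal (?u k v)) \<longlonglongrightarrow> ennreal (u v)"
      by (intro tendsto_ennrealI lim)
  qed
  finally have expected: "expected_exit_time G v ?B = ennreal (u v)" .
  have "(\<Sum>e\<in>arcs G. (h (tail G e) - h (head G e)) * (u (tail G e) - u (head G e)))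
      = (\<Sum>e\<in>arcs G. h (tail G e) + h (head G e))" if h: "\<forall>x\<in>verts G. x \<notin> ?B \<longrightarrow> h x = 0" for h
    unfolding energy_eq_generator[OF G(1)] sum_degree[OF G(1), symmetric]
  proof (rule sum.cong[OF refl])
    fix x
    assume x: "x \<in> verts G"
    let ?N = "neighbours G x"
    have "(\<Sum>y\<in>?N. u x - u y) = card ?N" if "x \<in> ?B"
    proof -
      have d: "0 < card ?N"
        using ne[OF x] fin by (simp add: card_gt_0_iff)
      have "card ?N * u x = card ?N * (1 + (\<Sum>y\<in>?N. u y) / card ?N)"
        using eq[OF that] by simp
      also have "\<dots> = card ?N + (\<Sum>y\<in>?N. u y)"
        using d by (simp add: field_simps)
      finally show ?thesis
        by (simp add: sum_subtractf)
    qed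
    \<comment> \<open>Off the ball u - P u is unknown, but \<open>h\<close> vanishes there.\<close>
    then show "h x * (\<Sum>y\<in>?N. u x - u y) = h x * card ?N"
      using h x by (cases "x \<in> ?B") auto
  qed
  with expected nn show ?thesis
    by (intro exI[of _ u] conjI allI impI)
qed

section \<open>Potentials and flows on a finite network\<close>

text \<open>The bilinear form rather than the quadratic one, because a harmonic function is paired
  with an arbitrary one below.\<close>

definition energy :: "('a, 'b) pre_digraph \<Rightarrow> ('b \<Rightarrow> real) \<Rightarrow> ('a \<Rightarrow> real) \<Rightarrow> ('a \<Rightarrow> real) \<Rightarrow> real" where
  "energy G r f g =
     (\<Sum>e\<in>arcs G. (f (tail G e) - f (head G e)) * (g (tail G e) - g (head G e)) / r e)"

lemma energy_linear:
  "energy G r f (\<lambda>z. s * g z + t * h z) = s * energy G r f g + t * energy G r f h"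
  by (simp add: energy_def sum_distrib_left sum.distrib[symmetric] algebra_simps
      add_divide_distrib diff_divide_distrib)

lemma energy_commute: "energy G r f g = energy G r g f"
  by (simp add: energy_def mult.commute)

lemma energy_const: "energy G r f (\<lambda>_. s) = 0"
  by (simp add: energy_def)

lemma energy_square_nonneg:
  assumes "\<And>e. e \<in> arcs G \<Longrightarrow> 0 < r e"
  shows "0 \<le> energy G r f f"
  unfolding energy_def using assms by (intro sum_nonneg divide_nonneg_pos) auto

locale network =
  fixes R :: "('a, 'b) pre_digraph" and a b :: 'a
  assumes simple: "simple_graph R" and conn: "conn R"
    and a: "a \<in> verts R" and b: "b \<in> verts R" and a_ne_b: "a \<noteq> b"
begin

lemma finite_arcs: "finite (arcs R)"
  using simple_graphD[OF simple] by simp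

lemma arcs_nonempty: "arcs R \<noteq> {}"
proof
  assume "arcs R = {}"
  then have "adj R = {}"
    by (auto simp: adj_iff)
  moreover have "(a, b) \<in> (adj R)\<^sup>*"
    using conn a b by (simp add: conn_def)
  ultimately show False
    using a_ne_b by simp
qed

lemma card_arcs_pos: "0 < card (arcs R)"
  using finite_arcs arcs_nonempty by (simp add: card_gt_0_iff)

text \<open>Clamping a function to values in [0, 1] keeps the boundary values and does not raise the
  energy. So a minimiser over the compact set of clamped functions minimises over all, and it comes
  with its bounds.\<close>

lemma ex_minimizer:
  assumes r: "\<forall>e\<in>arcs R. 0 < r e"
  shows "\<exists>\<psi>. \<psi> a = 1 \<and> \<psi> b = 0 \<and> (\<forall>z. 0 \<le> \<psi> z \<and> \<psi> z \<le> 1) \<and>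
    (\<forall>f. f a = 1 \<longrightarrow> f b = 0 \<longrightarrow> energy R r \<psi> \<psi> \<le> energy R r f f)"
proof -
  define S where "S = PiE (UNIV :: 'a set) (\<lambda>z. if z = a then {1} else if z = b then {0} else {0..1 :: real})"
  have S: "f \<in> S \<longleftrightarrow> f a = 1 \<and> f b = 0 \<and> (\<forall>z. 0 \<le> f z \<and> f z \<le> 1)" for f
  proof
    assume f: "f \<in> S"
    have "f z \<in> (if z = a then {1} else if z = b then {0} else {0..1 :: real})" for z
      using f unfolding S_def by (auto simp: PiE_iff)
    from this[of a] this[of b] this show "f a = 1 \<and> f b = 0 \<and> (\<forall>z. 0 \<le> f z \<and> f z \<le> 1)"
      using a_ne_b by (smt (verit) atLeastAtMost_iff singletonD)
  next
    assume "f a = 1 \<and> f b = 0 \<and> (\<forall>z. 0 \<le> f z \<and> f z \<le> 1)"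
    then show "f \<in> S"
      by (auto simp: S_def PiE_iff)
  qed
  have "compact S"
    unfolding S_def by (rule compact_PiE_UNIV) auto
  moreover have "(\<lambda>z. if z = a then 1 else 0) \<in> S"
    using a_ne_b by (simp add: S)
  moreover have "continuous_on S (\<lambda>f. energy R r f f)"
    unfolding energy_def divide_inverse
    by (intro continuous_intros continuous_on_product_coordinates[THEN continuous_on_subset]) auto
  ultimately obtain \<psi> where \<psi>: "\<psi> \<in> S" "\<And>f. f \<in> S \<Longrightarrow> energy R r \<psi> \<psi> \<le> energy R r f f"
    using continuous_attains_inf[of S "\<lambda>f. energy R r f f"] by blast
  have "energy R r \<psi> \<psi> \<le> energy R r f f" if f: "f a = 1" "f b = 0" for f
  proof -
    define g where "g z = max 0 (min 1 (f z))" for z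
    have "g \<in> S"
      using f by (simp add: S g_def)
    then have "energy R r \<psi> \<psi> \<le> energy R r g g"
      by (rule \<psi>(2))
    also have "\<dots> \<le> energy R r f f"
      unfolding energy_def power2_eq_square[symmetric]
    proof (intro sum_mono divide_right_mono)
      fix e
      assume e: "e \<in> arcs R"
      show "0 \<le> r e"
        using bspec[OF r e] by simp
      have "\<bar>g (tail R e) - g (head R e)\<bar> \<le> \<bar>f (tail R e) - f (head R e)\<bar>"
        unfolding g_def by linarith
      then show "(g (tail R e) - g (head R e))\<^sup>2 \<le> (f (tail R e) - f (head R e))\<^sup>2"
        by (rule abs_le_square_iff[THEN iffD1])
    qed
    finally show ?thesis .
  qed
  then show ?thesis
    using \<psi>(1) by (intro exI[of _ \<psi>]) (simp add: S)
qed

text \<open>Euler-Lagrange equation of the minimiser in weak form: its energy against any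
  \<open>g\<close> sees only \<open>g a - g b\<close>. Connectedness makes the minimal energy
  \<open>q\<close> positive, and the resistance is \<open>1 / q\<close>.\<close>

lemma ex_potential:
  assumes r: "\<forall>e\<in>arcs R. 0 < r e"
  shows "0 < eff_resistance R r a b"
    and "\<exists>\<psi>. \<psi> a = 1 \<and> \<psi> b = 0 \<and> (\<forall>z. 0 \<le> \<psi> z \<and> \<psi> z \<le> 1) \<and>
      (\<forall>g. energy R r \<psi> g = (g a - g b) / eff_resistance R r a b)"
proof -
  obtain \<psi> where \<psi>: "\<psi> a = 1" "\<psi> b = 0" "\<forall>z. 0 \<le> \<psi> z \<and> \<psi> z \<le> 1"
    and min: "\<forall>f. f a = 1 \<longrightarrow> f b = 0 \<longrightarrow> energy R r \<psi> \<psi> \<le> energy R r f f"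
    using ex_minimizer[OF r] by blast
  define q where "q = energy R r \<psi> \<psi>"
  have zero: "energy R r \<psi> g = 0" if g: "g a = 0" "g b = 0" for g
  proof (rule ccontr)
    assume ne: "energy R r \<psi> g \<noteq> 0"
    define E where "E = energy R r \<psi> g"
    define Q where "Q = energy R r g g"
    have Q: "0 \<le> Q"
      unfolding Q_def using r by (intro energy_square_nonneg) auto
    \<comment> \<open>A perturbation size along \<open>g\<close> that would lower the energy;
      \<open>Q + 1\<close> in place of \<open>Q\<close> avoids dividing by 0.\<close>
    define s where "s = - E / (Q + 1)"
    have "q \<le> energy R r (\<lambda>z. 1 * \<psi> z + s * g z) (\<lambda>z. 1 * \<psi> z + s * g z)"
      using min[rule_format, of "\<lambda>z. 1 * \<psi> z + s * g z"] \<psi> g by (simp add: q_def)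
    also have "\<dots> = q + 2 * s * E + s\<^sup>2 * Q"
      unfolding energy_linear
      unfolding energy_commute[of R r "\<lambda>z. 1 * \<psi> z + s * g z"] energy_linear
      by (simp add: q_def E_def Q_def energy_commute[of R r g \<psi>] power2_eq_square algebra_simps)
    finally have "0 \<le> 2 * s * E + s\<^sup>2 * Q"
      by simp
    also have "\<dots> = - (s\<^sup>2 * (Q + 2))"
    proof -
      have E: "E = - (s * (Q + 1))"
        using Q by (simp add: s_def)
      show ?thesis
        by (subst E) (simp add: power2_eq_square algebra_simps)
    qed
    also have "\<dots> < 0"
      using Q ne by (simp add: E_def s_def)
    finally show False
      by simp
  qed
  have E: "energy R r \<psi> g = (g a - g b) * q" for g
  proof -
    \<comment> \<open>Subtracting a multiple of \<psi> and a constant leaves a function vanishing at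
      both ends, for which the first variation is 0.\<close>
    define g' where "g' z = 1 * g z + (- 1) * ((g a - g b) * \<psi> z + g b * 1)" for z
    have "energy R r \<psi> g' = 0"
      using \<psi> by (intro zero) (simp_all add: g'_def)
    moreover have "energy R r \<psi> g' = energy R r \<psi> g - (g a - g b) * q"
      unfolding g'_def energy_linear by (simp add: q_def energy_const)
    ultimately show ?thesis
      by simp
  qed
  have q: "0 < q"
  proof (rule ccontr)
    assume "\<not> 0 < q"
    then have "q = 0"
      using energy_square_nonneg[of R r \<psi>] r by (simp add: q_def)
    then have z: "(\<psi> (tail R e) - \<psi> (head R e)) * (\<psi> (tail R e) - \<psi> (head R e)) / r e = 0"
      if "e \<in> arcs R" for e
      unfolding q_def energy_def using that r finite_arcs
      by (subst (asm) sum_nonneg_eq_0_iff) (auto intro!: divide_nonneg_pos)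
    have "\<psi> (tail R e) = \<psi> (head R e)" if "e \<in> arcs R" for e
      using z[OF that] bspec[OF r that] by simp
    then have step: "\<psi> x = \<psi> y" if "(x, y) \<in> adj R" for x y
      using that unfolding adj_iff by auto
    have "\<psi> x = \<psi> y" if "(x, y) \<in> (adj R)\<^sup>*" for x y
      using that by (induction rule: rtrancl_induct) (auto dest: step)
    from this[of a b] show False
      using \<psi> conn a b by (simp add: conn_def)
  qed
  have "eff_resistance R r a b = 1 / q"
  proof -
    have "(INF f\<in>{f. f a = 1 \<and> f b = 0}. \<Sum>e\<in>arcs R. (f (tail R e) - f (head R e))\<^sup>2 / r e) = q"
    proof (rule cInf_eq_minimum)
      show "q \<in> (\<lambda>f. \<Sum>e\<in>arcs R. (f (tail R e) - f (head R e))\<^sup>2 / r e) ` {f. f a = 1 \<and> f b = 0}"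
        using \<psi> by (intro image_eqI[of _ _ \<psi>]) (auto simp: q_def energy_def power2_eq_square)
      show "q \<le> x" if "x \<in> (\<lambda>f. \<Sum>e\<in>arcs R. (f (tail R e) - f (head R e))\<^sup>2 / r e) ` {f. f a = 1 \<and> f b = 0}" for x
        using that min by (auto simp: q_def energy_def power2_eq_square)
    qed
    then show ?thesis
      by (simp add: eff_resistance_def)
  qed
  then show "0 < eff_resistance R r a b" and "\<exists>\<psi>. \<psi> a = 1 \<and> \<psi> b = 0 \<and> (\<forall>z. 0 \<le> \<psi> z \<and> \<psi> z \<le> 1) \<and>
      (\<forall>g. energy R r \<psi> g = (g a - g b) / eff_resistance R r a b)"
    using q E \<psi> by auto
qed

text \<open>Kirchhoff's node law with unit source at \<open>a\<close> and unit sink at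
  \<open>b\<close>, tested against all functions; indicators of vertices give the usual
  form.\<close>

definition unit_flow :: "('b \<Rightarrow> real) \<Rightarrow> bool" where
  "unit_flow \<theta> \<longleftrightarrow> (\<forall>g. (\<Sum>e\<in>arcs R. \<theta> e * (g (tail R e) - g (head R e))) = g a - g b)"

text \<open>Thomson's principle. The flow paired with the unit potential gives 1, and completing the
  square on each edge separates flow energy from potential energy.\<close>

lemma eff_resistance_le_flow:
  assumes r: "\<forall>e\<in>arcs R. 0 < r e" and \<theta>: "unit_flow \<theta>"
  shows "eff_resistance R r a b \<le> (\<Sum>e\<in>arcs R. r e * (\<theta> e)\<^sup>2)"
proof -
  define \<rho> where "\<rho> = eff_resistance R r a b"
  have \<rho>: "0 < \<rho>"
    unfolding \<rho>_def using r by (rule ex_potential(1))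
  obtain \<psi> where \<psi>: "\<psi> a = 1" "\<psi> b = 0" "\<forall>g. energy R r \<psi> g = (g a - g b) / \<rho>"
    using ex_potential(2)[OF r] unfolding \<rho>_def by blast
  define d where "d e = \<psi> (tail R e) - \<psi> (head R e)" for e
  have "2 = (\<Sum>e\<in>arcs R. 2 * (\<theta> e * d e))"
    using \<theta> \<psi>(1,2) unfolding unit_flow_def d_def sum_distrib_left[symmetric] by simp
  also have "\<dots> \<le> (\<Sum>e\<in>arcs R. r e * (\<theta> e)\<^sup>2 / \<rho> + \<rho> * (d e * d e / r e))"
  proof (intro sum_mono)
    fix e
    assume e: "e \<in> arcs R"
    have "0 \<le> (r e * \<theta> e - \<rho> * d e)\<^sup>2 / (r e * \<rho>)"
      using bspec[OF r e] \<rho> by simp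
    also have "\<dots> = r e * (\<theta> e)\<^sup>2 / \<rho> + \<rho> * (d e * d e / r e) - 2 * (\<theta> e * d e)"
      using bspec[OF r e] \<rho> by (simp add: power2_eq_square field_simps)
    finally show "2 * (\<theta> e * d e) \<le> r e * (\<theta> e)\<^sup>2 / \<rho> + \<rho> * (d e * d e / r e)"
      by simp
  qed
  also have "\<dots> = (\<Sum>e\<in>arcs R. r e * (\<theta> e)\<^sup>2) / \<rho> + \<rho> * energy R r \<psi> \<psi>"
    by (simp add: sum.distrib sum_divide_distrib sum_distrib_left energy_def d_def)
  also have "\<dots> = (\<Sum>e\<in>arcs R. r e * (\<theta> e)\<^sup>2) / \<rho> + 1"
    using \<psi> \<rho> by simp
  finally show ?thesis
    using \<rho> unfolding \<rho>_def[symmetric] by (simp add: field_simps)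
qed

text \<open>The normalised current of the unit potential attains the bound of Thomson's principle.
  Hence the resistance is a minimum, over flows, of functionals linear in \<open>r\<close>.\<close>

lemma ex_optimal_flow:
  assumes r: "\<forall>e\<in>arcs R. 0 < r e"
  shows "\<exists>\<theta>. unit_flow \<theta> \<and> eff_resistance R r a b = (\<Sum>e\<in>arcs R. r e * (\<theta> e)\<^sup>2)"
proof -
  define \<rho> where "\<rho> = eff_resistance R r a b"
  have \<rho>: "0 < \<rho>"
    unfolding \<rho>_def using r by (rule ex_potential(1))
  obtain \<psi> where \<psi>: "\<psi> a = 1" "\<psi> b = 0" "\<forall>g. energy R r \<psi> g = (g a - g b) / \<rho>"
    using ex_potential(2)[OF r] unfolding \<rho>_def by blast
  define \<theta> where "\<theta> e = \<rho> * (\<psi> (tail R e) - \<psi> (head R e)) / r e" for e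
  have "(\<Sum>e\<in>arcs R. \<theta> e * (g (tail R e) - g (head R e))) = \<rho> * energy R r \<psi> g" for g
    by (simp add: \<theta>_def energy_def sum_distrib_left mult.assoc)
  then have "unit_flow \<theta>"
    using \<psi> \<rho> by (simp add: unit_flow_def)
  moreover have "(\<Sum>e\<in>arcs R. r e * (\<theta> e)\<^sup>2) = \<rho>\<^sup>2 * energy R r \<psi> \<psi>"
    unfolding energy_def sum_distrib_left
  proof (rule sum.cong[OF refl])
    fix e
    assume "e \<in> arcs R"
    then show "r e * (\<theta> e)\<^sup>2 = \<rho>\<^sup>2 * ((\<psi> (tail R e) - \<psi> (head R e)) * (\<psi> (tail R e) - \<psi> (head R e)) / r e)"
      using r by (simp add: \<theta>_def power2_eq_square)
  qed
  moreover have "\<rho>\<^sup>2 * energy R r \<psi> \<psi> = \<rho>"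
    using \<psi> \<rho> by (simp add: power2_eq_square)
  ultimately show ?thesis
    unfolding \<rho>_def[symmetric] by (intro exI[of _ \<theta>]) simp
qed

text \<open>Testing the flow against the indicator of the side of \<open>a\<close> shows that the cut \<open>J\<close> carries all of it;
  \<open>N \<theta>\<^sup>2 + 1 / N \<ge> 2 \<bar>\<theta>\<bar>\<close> with \<open>N = card (arcs R)\<close> then bounds its energy from below.\<close>

lemma cut_energy:
  assumes \<theta>: "unit_flow \<theta>" and J: "J \<subseteq> arcs R"
    and cut: "(a, b) \<notin> {(x, y). \<exists>e\<in>arcs R - J. (x = tail R e \<and> y = head R e) \<or> (x = head R e \<and> y = tail R e)}\<^sup>*"
      (is "_ \<notin> ?r\<^sup>*")
  shows "1 / card (arcs R) \<le> (\<Sum>e\<in>J. (\<theta> e)\<^sup>2)"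
proof -
  define N where "N = real (card (arcs R))"
  have N: "0 < N"
    using card_arcs_pos by (simp add: N_def)
  define g :: "'a \<Rightarrow> real" where "g z = (if (a, z) \<in> ?r\<^sup>* then 1 else 0)" for z
  have same: "g (tail R e) = g (head R e)" if "e \<in> arcs R - J" for e
  proof -
    have "(tail R e, head R e) \<in> ?r" "(head R e, tail R e) \<in> ?r"
      using that by auto
    then have "(a, tail R e) \<in> ?r\<^sup>* \<longleftrightarrow> (a, head R e) \<in> ?r\<^sup>*"
      by (meson rtrancl.rtrancl_into_rtrancl)
    then show ?thesis
      by (simp add: g_def)
  qed
  have "1 = g a - g b"
    using cut by (simp add: g_def)
  also have "\<dots> = (\<Sum>e\<in>arcs R. \<theta> e * (g (tail R e) - g (head R e)))"
    using \<theta> by (simp add: unit_flow_def)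
  also have "\<dots> = (\<Sum>e\<in>J. \<theta> e * (g (tail R e) - g (head R e)))"
    using J finite_arcs same by (intro sum.mono_neutral_right) auto
  also have "\<dots> \<le> (\<Sum>e\<in>J. (N * (\<theta> e)\<^sup>2 + 1 / N) / 2)"
  proof (intro sum_mono)
    fix e
    have "0 \<le> (N * \<bar>\<theta> e\<bar> - 1)\<^sup>2 / N"
      using N by simp
    also have "\<dots> = N * (\<theta> e)\<^sup>2 + 1 / N - 2 * \<bar>\<theta> e\<bar>"
      using N by (simp add: power2_eq_square field_simps abs_mult_self_eq)
    finally have "2 * \<bar>\<theta> e\<bar> \<le> N * (\<theta> e)\<^sup>2 + 1 / N"
      by simp
    moreover have "\<theta> e * (g (tail R e) - g (head R e)) \<le> \<bar>\<theta> e\<bar>"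
      by (auto simp: g_def)
    ultimately show "\<theta> e * (g (tail R e) - g (head R e)) \<le> (N * (\<theta> e)\<^sup>2 + 1 / N) / 2"
      by simp
  qed
  also have "\<dots> = (N * (\<Sum>e\<in>J. (\<theta> e)\<^sup>2) + card J / N) / 2"
    by (simp add: sum.distrib sum_divide_distrib[symmetric] sum_distrib_left)
  finally have "2 \<le> N * (\<Sum>e\<in>J. (\<theta> e)\<^sup>2) + card J / N"
    by simp
  moreover have "card J / N \<le> 1"
    using card_mono[OF finite_arcs J] N by (simp add: N_def)
  ultimately have "1 \<le> N * (\<Sum>e\<in>J. (\<theta> e)\<^sup>2)"
    by simp
  then show ?thesis
    using N unfolding N_def[symmetric] by (simp add: field_simps)
qed

text \<open>A Harnack bound: harmonicity makes \<phi>(y) the conductance-weighted average of its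
  neighbours. The neighbour \<open>w\<close> alone contributes its weight, which is at least the
  stated fraction because conductances differ by at most the factor \<kappa>.\<close>

lemma harmonic_lower_bound:
  assumes r: "\<forall>e\<in>arcs R. 0 < r e" and \<kappa>: "1 \<le> \<kappa>" "\<And>e f. e \<in> arcs R \<Longrightarrow> f \<in> arcs R \<Longrightarrow> r e \<le> \<kappa> * r f"
    and \<phi>: "\<And>z. 0 \<le> \<phi> z \<and> \<phi> z \<le> 1" "\<phi> w = 1"
    and harm: "energy R r \<phi> (\<lambda>z. if z = y then 1 else 0) = 0"
    and e: "e \<in> arcs R" "{tail R e, head R e} = {w, y}" "w \<noteq> y"
  shows "1 / (real (card (arcs R)) * \<kappa>) \<le> \<phi> y"
proof -
  define g :: "'a \<Rightarrow> real" where "g z = (if z = y then 1 else 0)" for z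
  define t where "t f = (\<phi> (tail R f) - \<phi> (head R f)) * (g (tail R f) - g (head R f))" for f
  have ne: "tail R f \<noteq> head R f" if "f \<in> arcs R" for f
    using simple_graphD(4)[OF simple that] by simp
  have le: "t f / r f \<le> \<phi> y * \<kappa> / r e" if f: "f \<in> arcs R" for f
  proof -
    have "t f \<le> \<phi> y"
      using \<phi>(1)[of y] \<phi>(1)[of "tail R f"] \<phi>(1)[of "head R f"] ne[OF f] by (auto simp: t_def g_def)
    then have "t f / r f \<le> \<phi> y / r f"
      using bspec[OF r f] by (simp add: divide_right_mono)
    also have "\<dots> \<le> \<phi> y * \<kappa> / r e"
    proof -
      have "\<phi> y * r e \<le> \<phi> y * (\<kappa> * r f)"
        using \<phi>(1)[of y] \<kappa>(2)[OF e(1) f] by (intro mult_left_mono) auto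
      then show ?thesis
        using bspec[OF r f] bspec[OF r e(1)] by (simp add: field_simps)
    qed
    finally show ?thesis .
  qed
  \<comment> \<open>Every other arc contributes at most \<phi>(y), since \<phi> is nonnegative; only
    this one brings in the value 1 at \<open>w\<close>.\<close>
  have te: "t e = \<phi> y - 1"
    using e(2,3) \<phi>(2) by (auto simp: t_def g_def doubleton_eq_iff)
  have "0 = (\<Sum>f\<in>arcs R. t f / r f)"
    using harm by (simp add: energy_def t_def g_def)
  also have "\<dots> = t e / r e + (\<Sum>f\<in>arcs R - {e}. t f / r f)"
    by (rule sum.remove[OF finite_arcs e(1)])
  also have "\<dots> \<le> t e / r e + (\<Sum>f\<in>arcs R - {e}. \<phi> y * \<kappa> / r e)"
    using le by (intro add_left_mono sum_mono) auto
  also have "\<dots> = t e / r e + (real (card (arcs R)) - 1) * (\<phi> y * \<kappa> / r e)"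
    using e(1) card_arcs_pos finite_arcs by (simp add: of_nat_diff Suc_leI)
  finally have "0 \<le> (t e / r e + (real (card (arcs R)) - 1) * (\<phi> y * \<kappa> / r e)) * r e"
    using bspec[OF r e(1)] by simp
  also have "\<dots> = \<phi> y - 1 + (real (card (arcs R)) - 1) * (\<phi> y * \<kappa>)"
    using bspec[OF r e(1)] by (simp add: te field_simps)
  also have "\<dots> \<le> \<phi> y * \<kappa> - 1 + (real (card (arcs R)) - 1) * (\<phi> y * \<kappa>)"
    using mult_left_mono[OF \<kappa>(1), of "\<phi> y"] \<phi>(1)[of y] by simp
  finally have "1 \<le> real (card (arcs R)) * \<kappa> * \<phi> y"
    by (simp add: algebra_simps)
  then show ?thesis
    using card_arcs_pos \<kappa>(1) by (simp add: field_simps)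
qed

end

section \<open>Rule graphs and iterated graphs\<close>

lemma icolour_simps [simp]:
  "icolour S j [] = j"
  "icolour S j (e @ [a]) = ecol S (icolour S j e) a"
  by (simp_all add: icolour_def)

lemma icolour_append: "icolour S j (e @ g) = icolour S (icolour S j e) g"
  by (simp add: icolour_def)

locale eigs_system =
  fixes S :: "('v, 'e) eigs"
  assumes wf: "wf_eigs S" and dist_pos: "distance_positive S"
begin

lemma ncol_pos: "0 < ncol S"
  using wf by (simp add: wf_eigs_def)

lemma icol_less: "icol S < ncol S"
  using wf by (simp add: wf_eigs_def)

lemma network: "i < ncol S \<Longrightarrow> network (rule S i) (bplus S i) (bminus S i)"
  using wf by (auto simp: wf_eigs_def network_def intro: connected_imp_conn)

lemma rule_simple: "i < ncol S \<Longrightarrow> simple_graph (rule S i)"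
  using wf by (simp add: wf_eigs_def)

lemma rule_conn: "i < ncol S \<Longrightarrow> conn (rule S i)"
  using network[of i] by (simp add: network_def)

lemma planting_verts:
  "i < ncol S \<Longrightarrow> bplus S i \<in> verts (rule S i) \<and> bminus S i \<in> verts (rule S i) \<and> bplus S i \<noteq> bminus S i"
  using wf by (simp add: wf_eigs_def)

lemma ecol_less: "i < ncol S \<Longrightarrow> a \<in> arcs (rule S i) \<Longrightarrow> ecol S i a < ncol S"
  using wf by (simp add: wf_eigs_def)

text \<open>Erasing loops from a walk yields a simple path and introduces no new steps, so the path
  stays inside the chosen part of the edges.\<close>

lemma simple_path_in_subrelation:
  assumes i: "i < ncol S" and r: "r \<subseteq> adj (rule S i)" and path: "(bplus S i, bminus S i) \<in> r\<^sup>*"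
  shows "\<exists>p. simple_path_between (rule S i) (bplus S i) (bminus S i) p \<and> set (vwalk_arcs p) \<subseteq> r"
proof -
  define H where "H = with_proj \<lparr> pverts = verts (rule S i), parcs = r \<rparr>"
  have H: "verts H = verts (rule S i)" "arcs_ends H = r"
    by (auto simp: H_def arcs_ends_conv)
  have sub: "r \<subseteq> verts (rule S i) \<times> verts (rule S i)"
    using r adj_verts[OF simple_graphD(1)[OF rule_simple[OF i]]] by auto
  obtain l where "(bplus S i, bminus S i) \<in> r ^^ l"
    using path by (auto simp: rtrancl_is_UN_relpow)
  then obtain p where p: "vwalk p H" "hd p = bplus S i" "last p = bminus S i"
    using relpow_vwalk[of H "bplus S i" "bminus S i" l] sub planting_verts[OF i] by (auto simp: H)
  define q where "q = vwalk_to_vpath p"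
  have q: "vpath q H" "hd q = bplus S i" "last q = bminus S i"
    using p by (simp_all add: q_def vwalk_to_vpath_vpath vwalk_to_vpath_hd vwalk_to_vpath_last)
  have "vpath q (undir (rule S i))"
    using q(1) r by (auto simp: vpath_def vwalk_def H)
  moreover have "set (vwalk_arcs q) \<subseteq> r"
    using q(1) by (auto simp: vpath_def vwalk_def H)
  ultimately show ?thesis
    using q by (intro exI[of _ q]) (simp add: simple_path_between_def)
qed

lemma ex_simple_path: "i < ncol S \<Longrightarrow> \<exists>p. simple_path_between (rule S i) (bplus S i) (bminus S i) p"
  using simple_path_in_subrelation[of i "adj (rule S i)"] rule_conn[of i] planting_verts[of i]
  by (auto simp: conn_def)

text \<open>Distance-positivity speaks of matrices, that is, of a choice of one path in every rule
  graph; hence \<open>p\<close> is completed by arbitrary paths in the others.\<close>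

lemma colour_on_path:
  assumes i: "i < ncol S" and j: "j < ncol S"
    and p: "simple_path_between (rule S i) (bplus S i) (bminus S i) p"
  shows "\<exists>e\<in>path_arcs (rule S i) p. ecol S i e = j"
proof -
  define q where "q i' = (if i' = i then p else
    (SOME p. simple_path_between (rule S i') (bplus S i') (bminus S i') p))" for i'
  have q: "\<forall>i'<ncol S. simple_path_between (rule S i') (bplus S i') (bminus S i') (q i')"
  proof (intro allI impI)
    fix i'
    assume "i' < ncol S"
    then show "simple_path_between (rule S i') (bplus S i') (bminus S i') (q i')"
      using p someI_ex[OF ex_simple_path[of i']] by (simp add: q_def)
  qed
  define A where "A = Matrix.mat (ncol S) (ncol S)
    (\<lambda>(i, j). card {e \<in> path_arcs (rule S i) (q i). ecol S i e = j})"
  have "A \<in> distance_matrices S"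
    unfolding distance_matrices_def A_def using q by blast
  then have "positive_entries A"
    using dist_pos by (simp add: distance_positive_def)
  then have "0 < A $$ (i, j)"
    using i j by (simp add: positive_entries_def A_def)
  then have "0 < card {e \<in> path_arcs (rule S i) p. ecol S i e = j}"
    using i j by (simp add: A_def q_def)
  then have "{e \<in> path_arcs (rule S i) p. ecol S i e = j} \<noteq> {}"
    by (metis card.empty less_irrefl)
  then show ?thesis
    by blast
qed

lemma colour_cut:
  assumes i: "i < ncol S" and j: "j < ncol S"
  shows "(bplus S i, bminus S i) \<notin> {(x, y). \<exists>e\<in>arcs (rule S i) - {e \<in> arcs (rule S i). ecol S i e = j}.
    (x = tail (rule S i) e \<and> y = head (rule S i) e) \<or> (x = head (rule S i) e \<and> y = tail (rule S i) e)}\<^sup>*"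
    (is "_ \<notin> ?r\<^sup>*")
proof
  assume path: "(bplus S i, bminus S i) \<in> ?r\<^sup>*"
  have "?r \<subseteq> adj (rule S i)"
    by (auto simp: adj_iff)
  from simple_path_in_subrelation[OF i this path] obtain p where
    p: "simple_path_between (rule S i) (bplus S i) (bminus S i) p" and arcs: "set (vwalk_arcs p) \<subseteq> ?r"
    by blast
  obtain e where e: "e \<in> path_arcs (rule S i) p" "ecol S i e = j"
    using colour_on_path[OF i j p] by blast
  then have eR: "e \<in> arcs (rule S i)"
    by (simp add: path_arcs_def)
  have "(tail (rule S i) e, head (rule S i) e) \<in> ?r \<or> (head (rule S i) e, tail (rule S i) e) \<in> ?r"
    using e(1) arcs by (auto simp: path_arcs_def)
  \<comment> \<open>The relation remembers pairs of vertices, not arcs. Simplicity identifies the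
    arc \<open>f\<close> of another colour with \<open>e\<close>, a contradiction.\<close>
  then have "\<exists>f\<in>arcs (rule S i). ecol S i f \<noteq> j \<and>
      ((tail (rule S i) e = tail (rule S i) f \<and> head (rule S i) e = head (rule S i) f) \<or>
       (tail (rule S i) e = head (rule S i) f \<and> head (rule S i) e = tail (rule S i) f))"
    by blast
  then obtain f where f: "f \<in> arcs (rule S i)" "ecol S i f \<noteq> j"
    "{tail (rule S i) e, head (rule S i) e} = {tail (rule S i) f, head (rule S i) f}"
    unfolding doubleton_eq_iff by blast
  have "e = f"
    using simple_graphD(5)[OF rule_simple[OF i] eR f(1,3)] .
  then show False
    using e(2) f(2) by simp
qed

text \<open>Such an arc would join the planting vertices using a single colour. With two or more
  colours this contradicts the cut property of another colour; with one colour the distance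
  assumption excludes it.\<close>

lemma no_direct_arc:
  assumes i: "i < ncol S" and e: "e \<in> arcs (rule S i)"
  shows "{tail (rule S i) e, head (rule S i) e} \<noteq> {bplus S i, bminus S i}"
proof
  assume eq: "{tail (rule S i) e, head (rule S i) e} = {bplus S i, bminus S i}"
  show False
  proof (cases "ncol S = 1")
    case True
    then have "2 \<le> gdist (rule S i) (bplus S i) (bminus S i)"
      using dist_pos i by (simp add: distance_positive_def)
    moreover have "(bplus S i, bminus S i) \<in> adj (rule S i)"
      unfolding adj_iff using eq by (intro bexI[OF _ e]) (auto simp: doubleton_eq_iff)
    then have "gdist (rule S i) (bplus S i) (bminus S i) \<le> 1"
      using planting_verts[OF i] simple_graphD(1)[OF rule_simple[OF i]] by (intro gdist_le) auto
    ultimately show False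
      by simp
  next
    case False
    define j :: nat where "j = (if ecol S i e = 0 then 1 else 0)"
    have j: "j < ncol S" "ecol S i e \<noteq> j"
      using False ncol_pos by (auto simp: j_def)
    have "(bplus S i, bminus S i) \<in> {(x, y). \<exists>e\<in>arcs (rule S i) - {e \<in> arcs (rule S i). ecol S i e = j}.
      (x = tail (rule S i) e \<and> y = head (rule S i) e) \<or> (x = head (rule S i) e \<and> y = tail (rule S i) e)}"
      using eq e j(2) by (auto simp: doubleton_eq_iff intro!: bexI[of _ e])
    with colour_cut[OF i j(1)] show False
      by blast
  qed
qed

section \<open>The iterates stay simple and connected\<close>

lemma arcs_Suc:
  "arcs (iterate_graph S j (Suc n)) =
     {e @ [f] | e f. e \<in> arcs (iterate_graph S j n) \<and> f \<in> arcs (rule S (icolour S j e))}"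
  by (simp add: replace_edges_def)

lemma tail_Suc:
  "tail (iterate_graph S j (Suc n)) (e @ [f]) =
     plant S (icolour S j) (iterate_graph S j n) e (tail (rule S (icolour S j e)) f)"
  by (simp add: replace_edges_def)

lemma head_Suc:
  "head (iterate_graph S j (Suc n)) (e @ [f]) =
     plant S (icolour S j) (iterate_graph S j n) e (head (rule S (icolour S j e)) f)"
  by (simp add: replace_edges_def)

lemma verts_Suc:
  "verts (iterate_graph S j (Suc n)) = verts (iterate_graph S j n) \<union>
     (\<Union>e\<in>arcs (iterate_graph S j n).
        plant S (icolour S j) (iterate_graph S j n) e ` verts (rule S (icolour S j e)))"
  by (simp add: replace_edges_def)

declare iterate_graph.simps(2) [simp del]

lemma verts_mono: "n \<le> m \<Longrightarrow> verts (iterate_graph S j n) \<subseteq> verts (iterate_graph S j m)"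
  by (induction rule: dec_induct) (auto simp: verts_Suc)

lemma Vplus_Vminus_verts: "Vplus \<in> verts (iterate_graph S j n)" "Vminus \<in> verts (iterate_graph S j n)"
  using verts_mono[of 0 n j] by auto

lemma length_arcs: "e \<in> arcs (iterate_graph S j n) \<Longrightarrow> length e = n"
  by (induction n arbitrary: e) (auto simp: arcs_Suc)

lemma icolour_less: "j < ncol S \<Longrightarrow> e \<in> arcs (iterate_graph S j n) \<Longrightarrow> icolour S j e < ncol S"
proof (induction n arbitrary: e)
  case (Suc n)
  then obtain e' f where "e = e' @ [f]" "e' \<in> arcs (iterate_graph S j n)" "f \<in> arcs (rule S (icolour S j e'))"
    unfolding arcs_Suc by blast
  with Suc show ?case
    using ecol_less[of "icolour S j e'" f] by simp
qed simp

lemma arc_ends_verts: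
  assumes "j < ncol S" "e \<in> arcs (iterate_graph S j n)"
  shows "tail (iterate_graph S j n) e \<in> verts (iterate_graph S j n) \<and>
    head (iterate_graph S j n) e \<in> verts (iterate_graph S j n)"
proof (cases n)
  case 0
  then show ?thesis
    by simp
next
  case (Suc m)
  then obtain e' f where e: "e = e' @ [f]" "e' \<in> arcs (iterate_graph S j m)"
    "f \<in> arcs (rule S (icolour S j e'))"
    using assms(2) unfolding Suc arcs_Suc by blast
  have "tail (rule S (icolour S j e')) f \<in> verts (rule S (icolour S j e')) \<and>
      head (rule S (icolour S j e')) f \<in> verts (rule S (icolour S j e'))"
    using simple_graphD(4)[OF rule_simple[OF icolour_less[OF assms(1) e(2)]] e(3)] by simp
  then show ?thesis
    using e(2) unfolding Suc e(1) tail_Suc head_Suc verts_Suc by blast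
qed

text \<open>The length of an address is the index of the iterate whose edge was replaced. So
  vertices new in iterate \<open>Suc n\<close>, with addresses of length \<open>n\<close>, never
  clash with old ones.\<close>

lemma length_Inner:
  assumes "j < ncol S" "Inner f x \<in> verts (iterate_graph S j n)"
  shows "length f < n"
  using assms(2)
proof (induction n)
  case (Suc n)
  show ?case
  proof (cases "Inner f x \<in> verts (iterate_graph S j n)")
    case True
    then show ?thesis
      using Suc.IH by simp
  next
    case False
    then obtain e z where e: "e \<in> arcs (iterate_graph S j n)"
        "Inner f x = plant S (icolour S j) (iterate_graph S j n) e z"
      using Suc.prems unfolding verts_Suc by blast
    have "Inner f x \<noteq> tail (iterate_graph S j n) e" "Inner f x \<noteq> head (iterate_graph S j n) e"
      using arc_ends_verts[OF assms(1) e(1)] False by auto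
    then have "f = e"
      using e(2) by (auto simp: plant_def split: if_splits)
    then show ?thesis
      using length_arcs[OF e(1)] by simp
  qed
qed simp

lemma arc_ends_ne_Inner:
  assumes "j < ncol S" "e \<in> arcs (iterate_graph S j n)" "length f = n"
  shows "tail (iterate_graph S j n) e \<noteq> Inner f x" "head (iterate_graph S j n) e \<noteq> Inner f x"
  using arc_ends_verts[OF assms(1,2)] length_Inner[OF assms(1), of f x n] assms(3) by auto

lemma plant_planting:
  assumes "j < ncol S" "e \<in> arcs (iterate_graph S j n)"
  shows "plant S (icolour S j) (iterate_graph S j n) e (bplus S (icolour S j e)) = tail (iterate_graph S j n) e"
    "plant S (icolour S j) (iterate_graph S j n) e (bminus S (icolour S j e)) = head (iterate_graph S j n) e"
  using planting_verts[OF icolour_less[OF assms]] by (auto simp: plant_def)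

lemma plant_inj:
  assumes "j < ncol S" "e \<in> arcs (iterate_graph S j n)"
    and ne: "tail (iterate_graph S j n) e \<noteq> head (iterate_graph S j n) e"
    and eq: "plant S (icolour S j) (iterate_graph S j n) e x = plant S (icolour S j) (iterate_graph S j n) e y"
  shows "x = y"
proof -
  note N = arc_ends_ne_Inner[OF assms(1,2) length_arcs[OF assms(2)]]
  show ?thesis
    using eq ne N[of x] N[of y] N[of x, symmetric] N[of y, symmetric]
    unfolding plant_def by (simp split: if_splits)
qed

lemma finite_iterate:
  assumes "j < ncol S"
  shows "finite (arcs (iterate_graph S j n)) \<and> finite (verts (iterate_graph S j n))"
proof (induction n)
  case (Suc n)
  have fin: "finite (arcs (rule S (icolour S j e))) \<and> finite (verts (rule S (icolour S j e)))"
    if "e \<in> arcs (iterate_graph S j n)" for e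
    using simple_graphD(2,3)[OF rule_simple[OF icolour_less[OF assms that]]] by simp
  have "arcs (iterate_graph S j (Suc n)) =
      (\<Union>e\<in>arcs (iterate_graph S j n). (\<lambda>f. e @ [f]) ` arcs (rule S (icolour S j e)))"
    unfolding arcs_Suc by blast
  then show ?case
    using Suc fin unfolding verts_Suc by simp
qed simp

text \<open>The ends of an arc determine the copy it lies in, by the step below; within one copy
  \<open>plant\<close> is injective, and simplicity of the rule graph determines the arc.\<close>

lemma simple_iterate:
  assumes j: "j < ncol S"
  shows "simple_graph (iterate_graph S j n)"
proof (induction n)
  case 0
  show ?case
    by (auto simp: simple_graph_def fin_digraph_def fin_digraph_axioms_def wf_digraph_def
        loopfree_digraph_def loopfree_digraph_axioms_def)
next
  case (Suc n)
  let ?G = "iterate_graph S j n" and ?H = "iterate_graph S j (Suc n)"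
  let ?P = "plant S (icolour S j) ?G"
  have wf: "wf_digraph ?H"
    unfolding wf_digraph_def using arc_ends_verts[OF j] by blast
  have col: "icolour S j e < ncol S" if "e \<in> arcs ?G" for e
    using icolour_less[OF j that] .
  have ne: "tail ?G e \<noteq> head ?G e" if "e \<in> arcs ?G" for e
    using simple_graphD(4)[OF Suc that] by simp
  have loop: "tail ?H g \<noteq> head ?H g" if "g \<in> arcs ?H" for g
  proof -
    obtain e f where g: "g = e @ [f]" and e: "e \<in> arcs ?G" and f: "f \<in> arcs (rule S (icolour S j e))"
      using \<open>g \<in> arcs ?H\<close> unfolding arcs_Suc by blast
    show ?thesis
      unfolding g tail_Suc head_Suc
      using plant_inj[OF j e ne[OF e]] simple_graphD(4)[OF rule_simple[OF col[OF e]] f] by blast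
  qed
  have uniq: "g = g'" if g: "g \<in> arcs ?H" "g' \<in> arcs ?H"
    and eq: "{tail ?H g, head ?H g} = {tail ?H g', head ?H g'}" for g g'
  proof -
    obtain e f where g: "g = e @ [f]" and e: "e \<in> arcs ?G" and f: "f \<in> arcs (rule S (icolour S j e))"
      using \<open>g \<in> arcs ?H\<close> unfolding arcs_Suc by blast
    obtain e' f' where g': "g' = e' @ [f']" and e': "e' \<in> arcs ?G" and f': "f' \<in> arcs (rule S (icolour S j e'))"
      using \<open>g' \<in> arcs ?H\<close> unfolding arcs_Suc by blast
    let ?R = "rule S (icolour S j e)" and ?R' = "rule S (icolour S j e')"
    have img: "?P e ` {tail ?R f, head ?R f} = ?P e' ` {tail ?R' f', head ?R' f'}"
      using eq unfolding g g' tail_Suc head_Suc by simp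
    \<comment> \<open>By \<open>no_direct_arc\<close> one end is not a planting vertex. Its image is
      an \<open>Inner\<close> vertex, which reveals the address of the replaced edge.\<close>
    have "\<exists>z\<in>{tail ?R f, head ?R f}. z \<notin> {bplus S (icolour S j e), bminus S (icolour S j e)}"
      using no_direct_arc[OF col[OF e] f] simple_graphD(4)[OF rule_simple[OF col[OF e]] f] by auto
    then obtain z where z: "z \<in> {tail ?R f, head ?R f}" "z \<notin> {bplus S (icolour S j e), bminus S (icolour S j e)}"
      by (rule bexE)
    have "?P e z \<in> ?P e' ` {tail ?R' f', head ?R' f'}"
      unfolding img[symmetric] using z(1) by (rule imageI)
    moreover have "?P e z = Inner e z"
      using z(2) by (simp add: plant_def)
    ultimately obtain z' where "Inner e z = ?P e' z'"
      by (metis imageE)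
    then have "e = e'"
      using arc_ends_ne_Inner[OF j e' length_arcs[OF e], of z, symmetric]
      unfolding plant_def by (simp split: if_splits)
    have inj: "inj (?P e)"
      by (rule injI) (rule plant_inj[OF j e ne[OF e]])
    have "?P e ` {tail ?R f, head ?R f} = ?P e ` {tail ?R f', head ?R f'}"
      using img unfolding \<open>e = e'\<close> .
    then have "{tail ?R f, head ?R f} = {tail ?R f', head ?R f'}"
      by (simp only: inj_image_eq_iff[OF inj])
    then have "f = f'"
      using simple_graphD(5)[OF rule_simple[OF col[OF e]] f] f' \<open>e = e'\<close> by simp
    then show ?thesis
      using g g' \<open>e = e'\<close> by simp
  qed
  have "fin_digraph ?H"
    using wf finite_iterate[OF j, of "Suc n"] by (simp add: fin_digraph_def fin_digraph_axioms_def)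
  moreover have "loopfree_digraph ?H"
    using wf loop by (simp add: loopfree_digraph_def loopfree_digraph_axioms_def)
  ultimately show ?case
    unfolding simple_graph_def using uniq by blast
qed

lemma adj_plant:
  assumes "e \<in> arcs (iterate_graph S j n)" "(x, y) \<in> adj (rule S (icolour S j e))"
  shows "(plant S (icolour S j) (iterate_graph S j n) e x, plant S (icolour S j) (iterate_graph S j n) e y)
    \<in> adj (iterate_graph S j (Suc n))"
proof -
  obtain f where f: "f \<in> arcs (rule S (icolour S j e))"
    "(x = tail (rule S (icolour S j e)) f \<and> y = head (rule S (icolour S j e)) f) \<or>
     (x = head (rule S (icolour S j e)) f \<and> y = tail (rule S (icolour S j e)) f)"
    using assms(2) unfolding adj_iff by blast
  have "e @ [f] \<in> arcs (iterate_graph S j (Suc n))"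
    using assms(1) f(1) unfolding arcs_Suc by blast
  then show ?thesis
    unfolding adj_iff by (rule bexI[rotated]) (use f(2) in \<open>auto simp: tail_Suc head_Suc\<close>)
qed

lemma conn_iterate:
  assumes j: "j < ncol S"
  shows "conn (iterate_graph S j n)"
proof (induction n)
  case 0
  have "(Vplus, Vminus) \<in> adj (iterate_graph S j 0)"
    by (simp add: adj_iff)
  then have "(Vplus, Vminus) \<in> (adj (iterate_graph S j 0))\<^sup>*" "(Vminus, Vplus) \<in> (adj (iterate_graph S j 0))\<^sup>*"
    by (blast intro: adj_sym)+
  then show ?case
    unfolding conn_def by simp
next
  case (Suc n)
  let ?G = "iterate_graph S j n" and ?H = "iterate_graph S j (Suc n)"
  let ?P = "plant S (icolour S j) ?G"
  have within: "(?P e x, ?P e y) \<in> (adj ?H)\<^sup>*"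
    if e: "e \<in> arcs ?G" and xy: "x \<in> verts (rule S (icolour S j e))" "y \<in> verts (rule S (icolour S j e))" for e x y
  proof -
    have "(x, y) \<in> (adj (rule S (icolour S j e)))\<^sup>*"
      using rule_conn[OF icolour_less[OF j e]] xy by (simp add: conn_def)
    then show ?thesis
    proof (induction rule: rtrancl_induct)
      case (step y z)
      then show ?case
        using adj_plant[OF e step(2)] by (meson rtrancl.rtrancl_into_rtrancl)
    qed simp
  qed
  have ends: "(?P e x, tail ?G e) \<in> (adj ?H)\<^sup>*" "(tail ?G e, head ?G e) \<in> (adj ?H)\<^sup>*"
    if e: "e \<in> arcs ?G" and x: "x \<in> verts (rule S (icolour S j e))" for e x
    using within[OF e x, of "bplus S (icolour S j e)"]
      within[OF e, of "bplus S (icolour S j e)" "bminus S (icolour S j e)"]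
      planting_verts[OF icolour_less[OF j e]] plant_planting[OF j e] by simp_all
  have step: "(x, y) \<in> (adj ?H)\<^sup>*" if xy: "(x, y) \<in> adj ?G" for x y
  proof -
    obtain e where e: "e \<in> arcs ?G" "(x = tail ?G e \<and> y = head ?G e) \<or> (x = head ?G e \<and> y = tail ?G e)"
      using xy unfolding adj_iff by blast
    have th: "(tail ?G e, head ?G e) \<in> (adj ?H)\<^sup>*"
      using ends(2)[OF e(1)] planting_verts[OF icolour_less[OF j e(1)]] by blast
    show ?thesis
      using e(2) th adj_rtrancl_sym[OF th] by (elim disjE conjE) simp_all
  qed
  have old: "(x, y) \<in> (adj ?H)\<^sup>*" if xy: "x \<in> verts ?G" "y \<in> verts ?G" for x y
  proof -
    have "(x, y) \<in> (adj ?G)\<^sup>*"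
      using Suc xy by (simp add: conn_def)
    then show ?thesis
    proof (induction rule: rtrancl_induct)
      case (step y z)
      then show ?case
        using \<open>\<And>x y. (x, y) \<in> adj ?G \<Longrightarrow> (x, y) \<in> (adj ?H)\<^sup>*\<close> by (meson rtrancl_trans)
    qed simp
  qed
  have root: "(x, Vplus) \<in> (adj ?H)\<^sup>*" if x: "x \<in> verts ?H" for x
  proof (cases "x \<in> verts ?G")
    case True
    then show ?thesis
      using old Vplus_Vminus_verts by blast
  next
    case False
    then obtain e z where e: "e \<in> arcs ?G" "z \<in> verts (rule S (icolour S j e))" "x = ?P e z"
      using x unfolding verts_Suc by blast
    have "(tail ?G e, Vplus) \<in> (adj ?H)\<^sup>*"
      using old arc_ends_verts[OF j e(1)] Vplus_Vminus_verts by blast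
    then show ?thesis
      using ends(1)[OF e(1,2)] e(3) by (meson rtrancl_trans)
  qed
  show ?case
    unfolding conn_def
  proof (intro ballI)
    fix u v
    assume "u \<in> verts ?H" "v \<in> verts ?H"
    then show "(u, v) \<in> (adj ?H)\<^sup>*"
      using rtrancl_trans[OF root adj_rtrancl_sym[OF root]] by simp
  qed
qed

text \<open>Lets estimates at the ends of arcs, the form in which harmonic extensions are
  controlled, be used at all vertices.\<close>

lemma incident_arc:
  assumes j: "j < ncol S" and v: "v \<in> verts (iterate_graph S j n)"
  shows "\<exists>e\<in>arcs (iterate_graph S j n). v = tail (iterate_graph S j n) e \<or> v = head (iterate_graph S j n) e"
proof -
  define w :: "('v, 'e) ivert" where "w = (if v = Vplus then Vminus else Vplus)"
  have w: "w \<in> verts (iterate_graph S j n)" "w \<noteq> v"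
    using Vplus_Vminus_verts[of j n] by (auto simp: w_def)
  then have "(v, w) \<in> (adj (iterate_graph S j n))\<^sup>*"
    using conn_iterate[OF j] v by (simp add: conn_def)
  then have "\<exists>y. (v, y) \<in> adj (iterate_graph S j n)"
    using w(2) by (cases rule: converse_rtranclE) auto
  then show ?thesis
    unfolding adj_iff by blast
qed

lemma neighbours_nonempty:
  assumes j: "j < ncol S" and v: "v \<in> verts (iterate_graph S j n)"
  shows "neighbours (iterate_graph S j n) v \<noteq> {}"
proof -
  obtain e where "e \<in> arcs (iterate_graph S j n)"
    "v = tail (iterate_graph S j n) e \<or> v = head (iterate_graph S j n) e"
    using incident_arc[OF assms] by (elim bexE)
  then have "(v, head (iterate_graph S j n) e) \<in> adj (iterate_graph S j n) \<or>
      (v, tail (iterate_graph S j n) e) \<in> adj (iterate_graph S j n)"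
    unfolding adj_iff by blast
  then show ?thesis
    unfolding neighbours_def by blast
qed

section \<open>Harmonic extension along the iteration\<close>

text \<open>Self-similarity of addresses: iterate \<open>N + m\<close> arises from iterate
  \<open>N\<close> by replacing each edge with the \<open>m\<close>-th iterate of its colour. The
  recursion appends at the end, so the prefix is split off by induction on \<open>m\<close>.\<close>

lemma arcs_add:
  "arcs (iterate_graph S j (N + m)) =
     {e @ g | e g. e \<in> arcs (iterate_graph S j N) \<and> g \<in> arcs (iterate_graph S (icolour S j e) m)}"
proof (induction m)
  case 0
  then show ?case
    by simp
next
  case (Suc m)
  show ?case
  proof (intro equalityI subsetI)
    fix f
    assume "f \<in> arcs (iterate_graph S j (N + Suc m))"
    then obtain f' a where f: "f = f' @ [a]" "f' \<in> arcs (iterate_graph S j (N + m))"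
      "a \<in> arcs (rule S (icolour S j f'))"
      unfolding add_Suc_right arcs_Suc by blast
    then obtain e g where g: "f' = e @ g" "e \<in> arcs (iterate_graph S j N)"
      "g \<in> arcs (iterate_graph S (icolour S j e) m)"
      unfolding Suc by blast
    have "g @ [a] \<in> arcs (iterate_graph S (icolour S j e) (Suc m))"
      using f(3) g(3) unfolding arcs_Suc g(1) icolour_append by blast
    then have "f = e @ (g @ [a]) \<and> e \<in> arcs (iterate_graph S j N) \<and>
        g @ [a] \<in> arcs (iterate_graph S (icolour S j e) (Suc m))"
      using f g by simp
    then show "f \<in> {e @ g | e g. e \<in> arcs (iterate_graph S j N) \<and>
        g \<in> arcs (iterate_graph S (icolour S j e) (Suc m))}"
      by blast
  next
    fix f
    assume "f \<in> {e @ g | e g. e \<in> arcs (iterate_graph S j N) \<and>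
        g \<in> arcs (iterate_graph S (icolour S j e) (Suc m))}"
    then obtain e g' where f: "f = e @ g'" "e \<in> arcs (iterate_graph S j N)"
      "g' \<in> arcs (iterate_graph S (icolour S j e) (Suc m))"
      by blast
    then obtain g a where g: "g' = g @ [a]" "g \<in> arcs (iterate_graph S (icolour S j e) m)"
      "a \<in> arcs (rule S (icolour S (icolour S j e) g))"
      unfolding arcs_Suc by blast
    have "e @ g \<in> arcs (iterate_graph S j (N + m))"
      unfolding Suc using f(2) g(2) by blast
    then have "f = (e @ g) @ [a] \<and> e @ g \<in> arcs (iterate_graph S j (N + m)) \<and>
        a \<in> arcs (rule S (icolour S j (e @ g)))"
      using f g by (simp add: icolour_append)
    then show "f \<in> arcs (iterate_graph S j (N + Suc m))"
      unfolding add_Suc_right arcs_Suc by blast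
  qed
qed

lemma sum_arcs_add:
  fixes \<phi> :: "'e list \<Rightarrow> real"
  assumes j: "j < ncol S"
  shows "(\<Sum>f\<in>arcs (iterate_graph S j (N + m)). \<phi> f) =
    (\<Sum>e\<in>arcs (iterate_graph S j N). \<Sum>g\<in>arcs (iterate_graph S (icolour S j e) m). \<phi> (e @ g))"
proof -
  let ?A = "SIGMA e:arcs (iterate_graph S j N). arcs (iterate_graph S (icolour S j e) m)"
  have "(\<Sum>f\<in>arcs (iterate_graph S j (N + m)). \<phi> f) = (\<Sum>(e, g)\<in>?A. \<phi> (e @ g))"
  proof (rule sum.reindex_cong[of "\<lambda>(e, g). e @ g"])
    show "inj_on (\<lambda>(e, g). e @ g) ?A"
    proof (rule inj_onI)
      fix p q
      assume "p \<in> ?A" "q \<in> ?A" and eq: "(case p of (e, g) \<Rightarrow> e @ g) = (case q of (e, g) \<Rightarrow> e @ g)"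
      then have "length (fst p) = length (fst q)"
        using length_arcs[of _ j N] by auto
      with eq show "p = q"
        by (simp add: case_prod_beta prod_eq_iff)
    qed
    show "arcs (iterate_graph S j (N + m)) = (\<lambda>(e, g). e @ g) ` ?A"
      unfolding arcs_add by (auto simp: image_iff)
  qed auto
  also have "\<dots> = (\<Sum>e\<in>arcs (iterate_graph S j N). \<Sum>g\<in>arcs (iterate_graph S (icolour S j e) m). \<phi> (e @ g))"
    using finite_iterate[OF j] finite_iterate[OF icolour_less[OF j]] by (subst sum.Sigma) auto
  finally show ?thesis .
qed

lemma sum_arcs_Suc:
  fixes \<phi> :: "'e list \<Rightarrow> real"
  assumes j: "j < ncol S"
  shows "(\<Sum>f\<in>arcs (iterate_graph S j (Suc n)). \<phi> f) =
    (\<Sum>e\<in>arcs (iterate_graph S j n). \<Sum>a\<in>arcs (rule S (icolour S j e)). \<phi> (e @ [a]))"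
proof -
  have "(\<Sum>g\<in>arcs (iterate_graph S i 1). \<phi> (e @ g)) = (\<Sum>a\<in>arcs (rule S i). \<phi> (e @ [a]))" for e i
  proof (rule sum.reindex_cong[of "\<lambda>a. [a]"])
    show "arcs (iterate_graph S i 1) = (\<lambda>a. [a]) ` arcs (rule S i)"
      unfolding One_nat_def arcs_Suc by auto
  qed (auto simp: inj_on_def)
  then show ?thesis
    using sum_arcs_add[OF j, of \<phi> n 1] by simp
qed

text \<open>Places the iterate of a single edge in the position of \<open>e\<close>: its two
  original vertices go to the ends of \<open>e\<close>, and inner addresses get the prefix
  \<open>e\<close>.\<close>

definition emb :: "(('v, 'e) ivert, 'e list) pre_digraph \<Rightarrow> 'e list \<Rightarrow> ('v, 'e) ivert \<Rightarrow> ('v, 'e) ivert" where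
  "emb G e w = (case w of Vplus \<Rightarrow> tail G e | Vminus \<Rightarrow> head G e | Inner f x \<Rightarrow> Inner (e @ f) x)"

lemma emb_simps [simp]:
  "emb G e Vplus = tail G e" "emb G e Vminus = head G e" "emb G e (Inner f x) = Inner (e @ f) x"
  by (simp_all add: emb_def)

lemma ends_add:
  assumes "g \<in> arcs (iterate_graph S (icolour S j e) m)" "e \<in> arcs (iterate_graph S j N)"
  shows "tail (iterate_graph S j (N + m)) (e @ g) =
      emb (iterate_graph S j N) e (tail (iterate_graph S (icolour S j e) m) g)"
    "head (iterate_graph S j (N + m)) (e @ g) =
      emb (iterate_graph S j N) e (head (iterate_graph S (icolour S j e) m) g)"
  using assms(1)
proof (induction m arbitrary: g)
  case 0
  {
    case 1
    then show ?case by simp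
  next
    case 2
    then show ?case by simp
  }
next
  case (Suc m)
  have plant: "plant S (icolour S j) (iterate_graph S j (N + m)) (e @ g) x =
      emb (iterate_graph S j N) e
        (plant S (icolour S (icolour S j e)) (iterate_graph S (icolour S j e) m) g x)"
    if "g \<in> arcs (iterate_graph S (icolour S j e) m)" for g x
    using Suc.IH[OF that] by (simp add: plant_def icolour_append)
  {
    case 1
    then obtain h a where g: "g = h @ [a]" "h \<in> arcs (iterate_graph S (icolour S j e) m)"
      unfolding arcs_Suc by blast
    show ?case
      using plant[OF g(2)] tail_Suc[of j "N + m" "e @ h" a] unfolding g(1)
      by (simp add: tail_Suc icolour_append)
  next
    case 2
    then obtain h a where g: "g = h @ [a]" "h \<in> arcs (iterate_graph S (icolour S j e) m)"
      unfolding arcs_Suc by blast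
    show ?case
      using plant[OF g(2)] head_Suc[of j "N + m" "e @ h" a] unfolding g(1)
      by (simp add: head_Suc icolour_append)
  }
qed

definition col_weight :: "nat \<Rightarrow> (nat \<Rightarrow> real) \<Rightarrow> 'e list \<Rightarrow> real" where
  "col_weight j x e = x (icolour S j e)"

definition potential :: "(nat \<Rightarrow> real) \<Rightarrow> nat \<Rightarrow> 'v \<Rightarrow> real" where
  "potential x i = (SOME \<psi>. \<psi> (bplus S i) = 1 \<and> \<psi> (bminus S i) = 0 \<and> (\<forall>z. 0 \<le> \<psi> z \<and> \<psi> z \<le> 1) \<and>
     (\<forall>g. energy (rule S i) (\<lambda>e. x (ecol S i e)) \<psi> g = (g (bplus S i) - g (bminus S i)) / resistance_map S x i))"

lemma weights_pos:
  assumes "i < ncol S" "\<forall>j<ncol S. 0 < x j"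
  shows "\<forall>e\<in>arcs (rule S i). 0 < x (ecol S i e)"
  using ecol_less[OF assms(1)] assms(2) by simp

lemma potential:
  assumes "i < ncol S" "\<forall>j<ncol S. 0 < x j"
  shows "potential x i (bplus S i) = 1" "potential x i (bminus S i) = 0"
    "0 \<le> potential x i z" "potential x i z \<le> 1"
    "energy (rule S i) (\<lambda>e. x (ecol S i e)) (potential x i) g =
      (g (bplus S i) - g (bminus S i)) / resistance_map S x i"
proof -
  interpret network "rule S i" "bplus S i" "bminus S i"
    using network[OF assms(1)] .
  note P = someI_ex[OF ex_potential(2)[OF weights_pos[OF assms]], folded resistance_map_def, folded potential_def]
  show "potential x i (bplus S i) = 1" "potential x i (bminus S i) = 0"
    "0 \<le> potential x i z" "potential x i z \<le> 1"
    "energy (rule S i) (\<lambda>e. x (ecol S i e)) (potential x i) g =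
      (g (bplus S i) - g (bminus S i)) / resistance_map S x i"
    using P by simp_all
qed

lemma resistance_map_pos:
  assumes "i < ncol S" "\<forall>j<ncol S. 0 < x j"
  shows "0 < resistance_map S x i"
proof -
  interpret network "rule S i" "bplus S i" "bminus S i"
    using network[OF assms(1)] .
  show ?thesis
    unfolding resistance_map_def by (rule ex_potential(1)[OF weights_pos[OF assms]])
qed

text \<open>Harmonic extension by one substitution: addresses of length \<open>n\<close> name
  exactly the new inner vertices, where the end values are interpolated along the unit potential.
  \<open>x\<close> holds the resistances after the substitution.\<close>

definition ext :: "nat \<Rightarrow> nat \<Rightarrow> (nat \<Rightarrow> real) \<Rightarrow> (('v, 'e) ivert \<Rightarrow> real) \<Rightarrow> ('v, 'e) ivert \<Rightarrow> real" where
  "ext j n x f w = (case w of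
     Inner e z \<Rightarrow>
       if length e = n then f (head (iterate_graph S j n) e) +
         (f (tail (iterate_graph S j n) e) - f (head (iterate_graph S j n) e)) * potential x (icolour S j e) z
       else f w
   | _ \<Rightarrow> f w)"

lemma ext_old:
  assumes "j < ncol S" "w \<in> verts (iterate_graph S j n)"
  shows "ext j n x f w = f w"
  using length_Inner[OF assms(1)] assms(2) by (cases w) (auto simp: ext_def)

lemma ext_plant:
  assumes j: "j < ncol S" and e: "e \<in> arcs (iterate_graph S j n)" and x: "\<forall>j<ncol S. 0 < x j"
  shows "ext j n x f (plant S (icolour S j) (iterate_graph S j n) e z) =
    f (head (iterate_graph S j n) e) +
      (f (tail (iterate_graph S j n) e) - f (head (iterate_graph S j n) e)) * potential x (icolour S j e) z"
proof -
  note P = potential(1,2)[OF icolour_less[OF j e] x]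
  note E = ext_old[OF j conjunct1[OF arc_ends_verts[OF j e]]] ext_old[OF j conjunct2[OF arc_ends_verts[OF j e]]]
  consider "z = bplus S (icolour S j e)" | "z \<noteq> bplus S (icolour S j e)" "z = bminus S (icolour S j e)"
    | "z \<noteq> bplus S (icolour S j e)" "z \<noteq> bminus S (icolour S j e)"
    by blast
  then show ?thesis
  proof cases
    case 1
    then show ?thesis
      using P E by (simp add: plant_def)
  next
    case 2
    then show ?thesis
      using P E by (simp add: plant_def)
  next
    case 3
    then show ?thesis
      using length_arcs[OF e] by (simp add: plant_def ext_def)
  qed
qed

text \<open>On each copy the extension is affine in the unit potential, whose weak equation leaves
  only the end values of \<open>g\<close> and the resistance of the copy.\<close>

lemma energy_ext:
  assumes j: "j < ncol S" and x: "\<forall>j<ncol S. 0 < x j"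
  shows "energy (iterate_graph S j (Suc n)) (col_weight j x) (ext j n x f) g =
    energy (iterate_graph S j n) (col_weight j (resistance_map S x)) f g"
proof -
  let ?G = "iterate_graph S j n" and ?H = "iterate_graph S j (Suc n)"
  let ?P = "plant S (icolour S j) ?G" and ?R = "\<lambda>e. rule S (icolour S j e)"
  let ?h = "ext j n x f"
  have "energy ?H (col_weight j x) ?h g = (\<Sum>e\<in>arcs ?G. \<Sum>a\<in>arcs (?R e).
      (?h (?P e (tail (?R e) a)) - ?h (?P e (head (?R e) a))) *
      (g (?P e (tail (?R e) a)) - g (?P e (head (?R e) a))) / x (ecol S (icolour S j e) a))"
    unfolding energy_def sum_arcs_Suc[OF j] tail_Suc head_Suc by (simp add: col_weight_def)
  also have "\<dots> = (\<Sum>e\<in>arcs ?G. (f (tail ?G e) - f (head ?G e)) * (g (tail ?G e) - g (head ?G e)) /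
      col_weight j (resistance_map S x) e)"
  proof (rule sum.cong[OF refl])
    fix e
    assume e: "e \<in> arcs ?G"
    let ?\<psi> = "potential x (icolour S j e)"
    have "(\<Sum>a\<in>arcs (?R e). (?h (?P e (tail (?R e) a)) - ?h (?P e (head (?R e) a))) *
        (g (?P e (tail (?R e) a)) - g (?P e (head (?R e) a))) / x (ecol S (icolour S j e) a))
      = (f (tail ?G e) - f (head ?G e)) *
        energy (?R e) (\<lambda>a. x (ecol S (icolour S j e) a)) ?\<psi> (\<lambda>z. g (?P e z))"
      unfolding energy_def sum_distrib_left ext_plant[OF j e x]
      by (rule sum.cong[OF refl]) (simp add: algebra_simps)
    then show "(\<Sum>a\<in>arcs (?R e). (?h (?P e (tail (?R e) a)) - ?h (?P e (head (?R e) a))) *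
        (g (?P e (tail (?R e) a)) - g (?P e (head (?R e) a))) / x (ecol S (icolour S j e) a))
      = (f (tail ?G e) - f (head ?G e)) * (g (tail ?G e) - g (head ?G e)) / col_weight j (resistance_map S x) e"
      unfolding potential(5)[OF icolour_less[OF j e] x] plant_planting[OF j e]
      by (simp add: col_weight_def)
  qed
  finally show ?thesis
    by (simp add: energy_def)
qed

text \<open>Maximum principle: the potential lies in [0, 1], so each new value is a convex
  combination of the two end values.\<close>

lemma ext_between:
  assumes j: "j < ncol S" and x: "\<forall>j<ncol S. 0 < x j"
    and g: "g \<in> arcs (iterate_graph S j n)" and a: "a \<in> arcs (rule S (icolour S j g))"
    and lo: "lo \<le> f (tail (iterate_graph S j n) g)" "lo \<le> f (head (iterate_graph S j n) g)"
    and hi: "f (tail (iterate_graph S j n) g) \<le> hi" "f (head (iterate_graph S j n) g) \<le> hi"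
  shows "lo \<le> ext j n x f (tail (iterate_graph S j (Suc n)) (g @ [a])) \<and>
      ext j n x f (tail (iterate_graph S j (Suc n)) (g @ [a])) \<le> hi \<and>
      lo \<le> ext j n x f (head (iterate_graph S j (Suc n)) (g @ [a])) \<and>
      ext j n x f (head (iterate_graph S j (Suc n)) (g @ [a])) \<le> hi"
proof -
  have conv: "lo \<le> q + (p - q) * s \<and> q + (p - q) * s \<le> hi"
    if "lo \<le> p" "lo \<le> q" "p \<le> hi" "q \<le> hi" "0 \<le> s" "s \<le> 1" for p q s :: real
  proof -
    have eq: "q + (p - q) * s = (1 - s) * q + s * p"
      by (simp add: algebra_simps)
    have "(1 - s) * lo + s * lo \<le> (1 - s) * q + s * p"
      using that by (intro add_mono mult_left_mono) auto
    moreover have "(1 - s) * q + s * p \<le> (1 - s) * hi + s * hi"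
      using that by (intro add_mono mult_left_mono) auto
    ultimately show ?thesis
      unfolding eq by (simp add: algebra_simps)
  qed
  note P = potential(3,4)[OF icolour_less[OF j g] x]
  show ?thesis
    unfolding tail_Suc head_Suc ext_plant[OF j g x]
    using conv[OF lo hi P] conv[OF lo hi P] by blast
qed

lemma pos_resistance_funpow:
  assumes "\<forall>j<ncol S. 0 < x j"
  shows "\<forall>j<ncol S. 0 < (resistance_map S ^^ m) x j"
proof (induction m)
  case (Suc m)
  show ?case
  proof (intro allI impI)
    fix i
    assume "i < ncol S"
    from resistance_map_pos[OF this Suc] show "0 < (resistance_map S ^^ Suc m) x i"
      by simp
  qed
qed (use assms in simp)

text \<open>The last substitution uses the weights \<open>x\<close> and the earlier ones see
  \<Psi>(x), so the induction varies \<open>x\<close>. The bounds are kept copy by copy: this yields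
  the range [0, 1], vanishing away from \<open>v\<close>, and later lower bounds as well.\<close>

lemma ex_extension:
  assumes j: "j < ncol S" and x: "\<forall>j<ncol S. 0 < x j"
  shows "\<exists>h. (\<forall>g. energy (iterate_graph S j (n + m)) (col_weight j x) h g =
        energy (iterate_graph S j n) (col_weight j ((resistance_map S ^^ m) x)) f g) \<and>
      (\<forall>e g lo hi. e \<in> arcs (iterate_graph S j n) \<longrightarrow> g \<in> arcs (iterate_graph S (icolour S j e) m) \<longrightarrow>
        lo \<le> f (tail (iterate_graph S j n) e) \<longrightarrow> lo \<le> f (head (iterate_graph S j n) e) \<longrightarrow>
        f (tail (iterate_graph S j n) e) \<le> hi \<longrightarrow> f (head (iterate_graph S j n) e) \<le> hi \<longrightarrow>
        lo \<le> h (tail (iterate_graph S j (n + m)) (e @ g)) \<and> h (tail (iterate_graph S j (n + m)) (e @ g)) \<le> hi \<and>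
        lo \<le> h (head (iterate_graph S j (n + m)) (e @ g)) \<and> h (head (iterate_graph S j (n + m)) (e @ g)) \<le> hi)"
    (is "\<exists>h. ?E m x h \<and> ?B m h")
  using x
proof (induction m arbitrary: x)
  case 0
  have "?E 0 x f \<and> ?B 0 f"
    by simp
  then show ?case
    by (intro exI[of "\<lambda>h. ?E 0 x h \<and> ?B 0 h" f])
next
  case (Suc m)
  have "\<forall>j<ncol S. 0 < resistance_map S x j"
    using resistance_map_pos Suc.prems by blast
  from Suc.IH[OF this] obtain h where hE: "?E m (resistance_map S x) h" and hB: "?B m h"
    by (elim exE conjE)
  let ?h = "ext j (n + m) x h"
  have "?E (Suc m) x ?h"
    unfolding add_Suc_right energy_ext[OF j Suc.prems] using hE
    by (simp add: funpow_swap1)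
  moreover have "?B (Suc m) ?h"
  proof (intro allI impI)
    fix e g' lo hi
    assume e: "e \<in> arcs (iterate_graph S j n)" and g': "g' \<in> arcs (iterate_graph S (icolour S j e) (Suc m))"
      and lo: "lo \<le> f (tail (iterate_graph S j n) e)" "lo \<le> f (head (iterate_graph S j n) e)"
      and hi: "f (tail (iterate_graph S j n) e) \<le> hi" "f (head (iterate_graph S j n) e) \<le> hi"
    obtain g a where g: "g' = g @ [a]" "g \<in> arcs (iterate_graph S (icolour S j e) m)"
      "a \<in> arcs (rule S (icolour S (icolour S j e) g))"
      using g' unfolding arcs_Suc by blast
    have eg: "e @ g \<in> arcs (iterate_graph S j (n + m))"
      unfolding arcs_add using e g(2) by blast
    have a: "a \<in> arcs (rule S (icolour S j (e @ g)))"
      using g(3) by (simp add: icolour_append)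
    from hB e g(2) lo hi
    have b: "lo \<le> h (tail (iterate_graph S j (n + m)) (e @ g)) \<and> h (tail (iterate_graph S j (n + m)) (e @ g)) \<le> hi \<and>
        lo \<le> h (head (iterate_graph S j (n + m)) (e @ g)) \<and> h (head (iterate_graph S j (n + m)) (e @ g)) \<le> hi"
      by simp
    then show "lo \<le> ?h (tail (iterate_graph S j (n + Suc m)) (e @ g')) \<and>
        ?h (tail (iterate_graph S j (n + Suc m)) (e @ g')) \<le> hi \<and>
        lo \<le> ?h (head (iterate_graph S j (n + Suc m)) (e @ g')) \<and>
        ?h (head (iterate_graph S j (n + Suc m)) (e @ g')) \<le> hi"
      using ext_between[OF j Suc.prems eg a, of lo h hi] unfolding g(1) by simp
  qed
  ultimately show ?case
    by (intro exI[of _ ?h] conjI)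
qed

section \<open>Growth rates\<close>

definition arcs_total :: nat where
  "arcs_total = (\<Sum>i<ncol S. card (arcs (rule S i)))"

lemma card_arcs_le_total: "i < ncol S \<Longrightarrow> card (arcs (rule S i)) \<le> arcs_total"
  unfolding arcs_total_def by (rule member_le_sum) auto

lemma arcs_total_pos: "0 < arcs_total"
proof -
  interpret network "rule S 0" "bplus S 0" "bminus S 0"
    by (rule network[OF ncol_pos])
  show ?thesis
    using card_arcs_pos card_arcs_le_total[OF ncol_pos] by linarith
qed

lemma sum_by_colour:
  fixes \<phi> :: "'e \<Rightarrow> real"
  assumes "i < ncol S"
  shows "(\<Sum>a\<in>arcs (rule S i). \<phi> a) =
    (\<Sum>j<ncol S. \<Sum>a\<in>{a \<in> arcs (rule S i). ecol S i a = j}. \<phi> a)"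
  using simple_graphD(2)[OF rule_simple[OF assms]] ecol_less[OF assms]
  by (intro sum.group[symmetric]) auto

text \<open>The optimal flow for \<open>x\<close> is admissible for every other \<open>y\<close>.
  Grouping its energy by colour gives the coefficients, and \<open>cut_energy\<close> bounds each
  from below because every colour is a cut.\<close>

lemma resistance_support:
  assumes i: "i < ncol S" and x: "\<forall>j<ncol S. 0 < x j"
  shows "\<exists>a. (\<forall>j<ncol S. 1 / arcs_total \<le> a j) \<and> resistance_map S x i = (\<Sum>j<ncol S. a j * x j) \<and>
    (\<forall>y. (\<forall>j<ncol S. 0 < y j) \<longrightarrow> resistance_map S y i \<le> (\<Sum>j<ncol S. a j * y j))"
proof -
  interpret network "rule S i" "bplus S i" "bminus S i"
    by (rule network[OF i])
  let ?A = "\<lambda>j. {e \<in> arcs (rule S i). ecol S i e = j}"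
  obtain \<theta> where \<theta>: "unit_flow \<theta>"
    "resistance_map S x i = (\<Sum>e\<in>arcs (rule S i). x (ecol S i e) * (\<theta> e)\<^sup>2)"
    using ex_optimal_flow[OF weights_pos[OF i x]] unfolding resistance_map_def by (elim exE conjE)
  define a where "a j = (\<Sum>e\<in>?A j. (\<theta> e)\<^sup>2)" for j
  have sum: "(\<Sum>e\<in>arcs (rule S i). y (ecol S i e) * (\<theta> e)\<^sup>2) = (\<Sum>j<ncol S. a j * y j)" for y
    unfolding sum_by_colour[OF i] a_def sum_distrib_right
    by (intro sum.cong refl) (simp add: mult.commute)
  have "1 / arcs_total \<le> a j" if j: "j < ncol S" for j
  proof -
    have "1 / arcs_total \<le> 1 / card (arcs (rule S i))"
      using card_arcs_pos card_arcs_le_total[OF i] by (intro divide_left_mono) auto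
    also have "\<dots> \<le> a j"
      unfolding a_def by (rule cut_energy[OF \<theta>(1) _ colour_cut[OF i j]]) auto
    finally show ?thesis .
  qed
  moreover have "resistance_map S x i = (\<Sum>j<ncol S. a j * x j)"
    unfolding \<theta>(2) by (rule sum)
  moreover have "resistance_map S y i \<le> (\<Sum>j<ncol S. a j * y j)" if y: "\<forall>j<ncol S. 0 < y j" for y
    using eff_resistance_le_flow[OF weights_pos[OF i y] \<theta>(1)] unfolding resistance_map_def sum .
  ultimately show ?thesis
    by (intro exI[of _ a] conjI allI impI) simp_all
qed

sublocale resistance: min_linear_map "ncol S" "resistance_map S" "1 / arcs_total"
proof
  show "0 < ncol S"
    by (rule ncol_pos)
  show "0 < 1 / real arcs_total"
    using arcs_total_pos by simp
  show "\<exists>a. (\<forall>j<ncol S. 1 / real arcs_total \<le> a j) \<and> resistance_map S x i = (\<Sum>j<ncol S. a j * x j) \<and>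
      (\<forall>y. (\<forall>j<ncol S. 0 < y j) \<longrightarrow> resistance_map S y i \<le> (\<Sum>j<ncol S. a j * y j))"
    if "i < ncol S" "\<forall>j<ncol S. 0 < x j" for i x
    using resistance_support[OF that] .
qed

lemma eigenvalue_rho_resistance: "resistance.positive_eigenvalue (rho_resistance S)"
  using theI'[OF resistance.ex1_eigenvalue]
  unfolding rho_resistance_def resistance.positive_eigenvalue_def .

section \<open>Edge counts and the spectral radius\<close>

definition edge_map :: "(nat \<Rightarrow> real) \<Rightarrow> nat \<Rightarrow> real" where
  "edge_map x i = (\<Sum>k<ncol S. real (edge_matrix S $$ (i, k)) * x k)"

lemma edge_matrix_entry:
  "i < ncol S \<Longrightarrow> k < ncol S \<Longrightarrow> edge_matrix S $$ (i, k) = card {e \<in> arcs (rule S i). ecol S i e = k}"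
  by (simp add: edge_matrix_def)

lemma edge_matrix_pos:
  assumes "i < ncol S" "k < ncol S"
  shows "1 \<le> edge_matrix S $$ (i, k)"
proof -
  obtain p where p: "simple_path_between (rule S i) (bplus S i) (bminus S i) p"
    using ex_simple_path[OF assms(1)] by blast
  obtain e where e: "e \<in> path_arcs (rule S i) p" "ecol S i e = k"
    using colour_on_path[OF assms p] by blast
  then have "e \<in> {e \<in> arcs (rule S i). ecol S i e = k}"
    by (simp add: path_arcs_def)
  moreover have "finite {e \<in> arcs (rule S i). ecol S i e = k}"
    using simple_graphD(2)[OF rule_simple[OF assms(1)]] by simp
  ultimately have "0 < card {e \<in> arcs (rule S i). ecol S i e = k}"
    by (auto simp: card_gt_0_iff)
  then show ?thesis
    by (simp add: edge_matrix_entry[OF assms])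
qed

sublocale edges: min_linear_map "ncol S" edge_map 1
proof
  show "0 < ncol S"
    by (rule ncol_pos)
  show "0 < (1 :: real)"
    by simp
  show "\<exists>a. (\<forall>j<ncol S. 1 \<le> a j) \<and> edge_map x i = (\<Sum>j<ncol S. a j * x j) \<and>
      (\<forall>y. (\<forall>j<ncol S. 0 < y j) \<longrightarrow> edge_map y i \<le> (\<Sum>j<ncol S. a j * y j))"
    if "i < ncol S" for x i
    using edge_matrix_pos[OF that]
    by (intro exI[of _ "\<lambda>k. real (edge_matrix S $$ (i, k))"]) (simp add: edge_map_def)
qed

text \<open>The positive eigenvalue belongs to the complex spectrum, so it is at most the spectral
  radius. Conversely, an eigenvector of a spectral value of maximal modulus is compared entrywise
  with the positive eigenvector.\<close>

lemma eigenvalue_rho_edge_matrix: "edges.positive_eigenvalue (rho (edge_matrix S))"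
proof -
  obtain t where t: "edges.positive_eigenvalue t"
    using edges.ex1_eigenvalue by (elim ex1E)
  obtain x where x: "\<forall>i<ncol S. 0 < x i" "\<forall>i<ncol S. edge_map x i = t * x i" and t0: "0 < t"
    using t unfolding edges.positive_eigenvalue_def by (elim conjE exE)
  define A :: "complex mat" where "A = map_mat of_nat (edge_matrix S)"
  have A: "A \<in> carrier_mat (ncol S) (ncol S)" "dim_row A = ncol S"
    by (simp_all add: A_def edge_matrix_def)
  have mult: "(A *\<^sub>v w) $ i = (\<Sum>k<ncol S. of_nat (edge_matrix S $$ (i, k)) * w $ k)"
    if "i < ncol S" "dim_vec w = ncol S" for i w
    using that by (simp add: A_def edge_matrix_def scalar_prod_def lessThan_atLeast0)
  have "Char_Poly.eigenvalue A (of_real t)"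
  proof -
    define w where "w = vec (ncol S) (\<lambda>i. complex_of_real (x i))"
    have "A *\<^sub>v w = of_real t \<cdot>\<^sub>v w"
    proof (rule eq_vecI)
      fix i
      assume "i < dim_vec (of_real t \<cdot>\<^sub>v w)"
      then have i: "i < ncol S"
        by (simp add: w_def)
      have "(A *\<^sub>v w) $ i = of_real (edge_map x i)"
        using i by (simp add: mult w_def edge_map_def)
      also have "\<dots> = (of_real t \<cdot>\<^sub>v w) $ i"
        using i x(2) by (simp add: w_def)
      finally show "(A *\<^sub>v w) $ i = (of_real t \<cdot>\<^sub>v w) $ i" .
    qed (simp add: w_def A)
    moreover have "w \<noteq> 0\<^sub>v (ncol S)"
    proof
      assume "w = 0\<^sub>v (ncol S)"
      then have "w $ 0 = 0"
        using ncol_pos by simp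
      moreover have "0 < x 0"
        using x(1) ncol_pos by blast
      ultimately show False
        using ncol_pos by (simp add: w_def)
    qed
    ultimately have "eigenvector A w (of_real t)"
      by (simp add: eigenvector_def A w_def)
    then show ?thesis
      unfolding Char_Poly.eigenvalue_def by (rule exI)
  qed
  then have "of_real t \<in> spectrum A"
    by (simp add: spectrum_def)
  then have "norm (of_real t :: complex) \<in> norm ` spectrum A"
    by (rule imageI)
  then have "t \<le> spectral_radius A"
    using spectral_radius_mem_max(2)[OF A(1) ncol_pos] t0 by simp
  moreover have "spectral_radius A \<le> t"
  proof -
    obtain l where l: "l \<in> spectrum A" "spectral_radius A = norm l"
      using spectral_radius_mem_max(1)[OF A(1) ncol_pos] by blast
    have "Char_Poly.eigenvalue A l"
      using l(1) by (simp add: spectrum_def)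
    then obtain w where "eigenvector A w l"
      unfolding Char_Poly.eigenvalue_def by (rule exE)
    then have w: "dim_vec w = ncol S" "w \<noteq> 0\<^sub>v (ncol S)" "A *\<^sub>v w = l \<cdot>\<^sub>v w"
      unfolding eigenvector_def A(2) carrier_vec_def by simp_all
    \<comment> \<open>The least multiple of \<open>x\<close> dominating the moduli of
      \<open>w\<close>; at the index \<open>i\<close> it is attained, and row \<open>i\<close> of
      the eigenvalue equation then bounds the modulus of \<open>l\<close> by
      \<open>t\<close>.\<close>
    define s where "s = Max ((\<lambda>i. norm (w $ i) / x i) ` {..<ncol S})"
    have ne: "finite ((\<lambda>i. norm (w $ i) / x i) ` {..<ncol S})" "(\<lambda>i. norm (w $ i) / x i) ` {..<ncol S} \<noteq> {}"
      using ncol_pos by auto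
    obtain i where i: "i < ncol S" "s = norm (w $ i) / x i"
      using Max_in[OF ne] unfolding s_def by auto
    have le: "norm (w $ k) \<le> s * x k" if "k < ncol S" for k
    proof -
      have "norm (w $ k) / x k \<le> s"
        unfolding s_def using that by (intro Max_ge) auto
      then show ?thesis
        using x(1) that by (simp add: field_simps)
    qed
    obtain k where k: "k < ncol S" "w $ k \<noteq> 0"
    proof (rule ccontr)
      assume "\<not> thesis"
      then have "w = 0\<^sub>v (ncol S)"
        using w(1) that by (intro eq_vecI) auto
      then show False
        using w(2) by simp
    qed
    have "0 < s"
      using le[OF k(1)] k x(1) by (smt (verit) mult_nonpos_nonneg zero_less_norm_iff)
    have xi: "0 < x i"
      using x(1) i(1) by blast
    have wi: "norm (w $ i) = s * x i"
      using i(2) xi by simp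
    have "norm l * norm (w $ i) = norm ((A *\<^sub>v w) $ i)"
      using i(1) w(1) unfolding w(3) by (simp add: norm_mult)
    also have "\<dots> \<le> (\<Sum>k<ncol S. norm (of_nat (edge_matrix S $$ (i, k)) * w $ k))"
      unfolding mult[OF i(1) w(1)] by (rule norm_sum)
    also have "\<dots> \<le> (\<Sum>k<ncol S. real (edge_matrix S $$ (i, k)) * (s * x k))"
      using le by (intro sum_mono) (auto simp: norm_mult intro: mult_left_mono)
    also have "\<dots> = s * edge_map x i"
      by (simp add: edge_map_def sum_distrib_left mult_ac)
    also have "\<dots> = t * norm (w $ i)"
      using x(2) i(1) by (simp add: wi)
    finally show ?thesis
      using \<open>0 < s\<close> xi unfolding l(2) wi by simp
  qed
  ultimately have "rho (edge_matrix S) = t"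
    by (simp add: rho_def A_def)
  then show ?thesis
    using t by simp
qed

lemma card_arcs_iterate:
  "j < ncol S \<Longrightarrow> real (card (arcs (iterate_graph S j m))) = (edge_map ^^ m) (\<lambda>_. 1) j"
proof (induction m arbitrary: j)
  case (Suc m)
  \<comment> \<open>The split comes after the first substitution, so that the induction hypothesis
    applies to the iterates of each colour.\<close>
  have "real (card (arcs (iterate_graph S j (Suc m)))) = (\<Sum>f\<in>arcs (iterate_graph S j (Suc 0 + m)). 1)"
    by simp
  also have "\<dots> = (\<Sum>e\<in>arcs (iterate_graph S j (Suc 0)). real (card (arcs (iterate_graph S (icolour S j e) m))))"
    unfolding sum_arcs_add[OF Suc.prems] by simp
  also have "\<dots> = (\<Sum>a\<in>arcs (rule S j). real (card (arcs (iterate_graph S (ecol S j a) m))))"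
    unfolding sum_arcs_Suc[OF Suc.prems] by simp (simp add: icolour_def)
  also have "\<dots> = (\<Sum>k<ncol S. \<Sum>a\<in>{a \<in> arcs (rule S j). ecol S j a = k}. (edge_map ^^ m) (\<lambda>_. 1) k)"
    unfolding sum_by_colour[OF Suc.prems] using Suc.IH by (intro sum.cong refl) auto
  also have "\<dots> = edge_map ((edge_map ^^ m) (\<lambda>_. 1)) j"
    unfolding edge_map_def using Suc.prems by (intro sum.cong refl) (simp add: edge_matrix_entry)
  finally show ?case
    by simp
qed simp

end

section \<open>Stars in a coarser iterate\<close>

lemma gdist_le_gdiam:
  assumes "finite (verts G)" "u \<in> verts G" "v \<in> verts G"
  shows "gdist G u v \<le> gdiam G"
  unfolding gdiam_def
proof (rule Max_ge)
  have "{gdist G u v | u v. u \<in> verts G \<and> v \<in> verts G} = (\<lambda>(u, v). gdist G u v) ` (verts G \<times> verts G)"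
    by auto
  then show "finite {gdist G u v | u v. u \<in> verts G \<and> v \<in> verts G}"
    using assms(1) by simp
  show "gdist G u v \<in> {gdist G u v | u v. u \<in> verts G \<and> v \<in> verts G}"
    using assms(2,3) by blast
qed

context eigs_system
begin

lemma wf_iterate: "j < ncol S \<Longrightarrow> wf_digraph (iterate_graph S j n)"
  using simple_graphD(1)[OF simple_iterate] .

lemma relpow_iterate:
  assumes "j < ncol S" "x \<in> verts (iterate_graph S j n)" "y \<in> verts (iterate_graph S j n)"
  shows "(x, y) \<in> adj (iterate_graph S j n) ^^ gdist (iterate_graph S j n) x y"
  using assms conn_iterate[OF assms(1)] by (intro gdist_relpow wf_iterate) (auto simp: conn_def)

lemma gdist_iterate_sym:
  assumes "j < ncol S" "x \<in> verts (iterate_graph S j n)" "y \<in> verts (iterate_graph S j n)"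
  shows "gdist (iterate_graph S j n) x y \<le> gdist (iterate_graph S j n) y x"
  by (rule gdist_le[OF wf_iterate[OF assms(1)] assms(2) adj_relpow_sym[OF relpow_iterate[OF assms(1,3,2)]]])

lemma gdist_iterate_adj:
  assumes j: "j < ncol S" and u: "u \<in> verts (iterate_graph S j n)"
    and xy: "(x, y) \<in> adj (iterate_graph S j n)"
  shows "gdist (iterate_graph S j n) u y \<le> Suc (gdist (iterate_graph S j n) u x)"
proof -
  have "x \<in> verts (iterate_graph S j n)"
    using adj_verts[OF wf_iterate[OF j] xy] by simp
  then have "(u, y) \<in> adj (iterate_graph S j n) ^^ Suc (gdist (iterate_graph S j n) u x)"
    using relpow_iterate[OF j u] xy by (intro relpow_Suc_I) auto
  then show ?thesis
    by (rule gdist_le[OF wf_iterate[OF j] u])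
qed

lemma emb_relpow:
  assumes e: "e \<in> arcs (iterate_graph S j N)" and xy: "(x, y) \<in> adj (iterate_graph S (icolour S j e) m) ^^ l"
  shows "(emb (iterate_graph S j N) e x, emb (iterate_graph S j N) e y) \<in> adj (iterate_graph S j (N + m)) ^^ l"
  using xy
proof (induction l arbitrary: y)
  case (Suc l)
  then obtain z where z: "(x, z) \<in> adj (iterate_graph S (icolour S j e) m) ^^ l"
    "(z, y) \<in> adj (iterate_graph S (icolour S j e) m)"
    by auto
  from z(2) obtain g where g: "g \<in> arcs (iterate_graph S (icolour S j e) m)"
    "(z = tail (iterate_graph S (icolour S j e) m) g \<and> y = head (iterate_graph S (icolour S j e) m) g) \<or>
     (z = head (iterate_graph S (icolour S j e) m) g \<and> y = tail (iterate_graph S (icolour S j e) m) g)"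
    unfolding adj_iff by (elim bexE)
  have eg: "e @ g \<in> arcs (iterate_graph S j (N + m))"
    unfolding arcs_add using e g(1) by blast
  have "(emb (iterate_graph S j N) e z, emb (iterate_graph S j N) e y) \<in> adj (iterate_graph S j (N + m))"
    unfolding adj_iff using g(2) ends_add[OF g(1) e] by (intro bexI[OF _ eg]) auto
  with Suc.IH[OF z(1)] show ?case
    by (rule relpow_Suc_I)
qed simp

lemma gdist_in_copy:
  assumes j: "j < ncol S" and e: "e \<in> arcs (iterate_graph S j N)"
    and v: "v = tail (iterate_graph S j N) e \<or> v = head (iterate_graph S j N) e"
    and w: "w \<in> verts (iterate_graph S (icolour S j e) m)"
  shows "gdist (iterate_graph S j (N + m)) v (emb (iterate_graph S j N) e w)
    \<le> gdiam (iterate_graph S (icolour S j e) m)"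
proof -
  let ?C = "iterate_graph S (icolour S j e) m"
  note c = icolour_less[OF j e]
  define p :: "('v, 'e) ivert" where "p = (if v = tail (iterate_graph S j N) e then Vplus else Vminus)"
  have p: "p \<in> verts ?C" "emb (iterate_graph S j N) e p = v"
    using v Vplus_Vminus_verts by (auto simp: p_def)
  have "v \<in> verts (iterate_graph S j (N + m))"
    using v arc_ends_verts[OF j e] verts_mono[of N "N + m" j] by auto
  then have "gdist (iterate_graph S j (N + m)) v (emb (iterate_graph S j N) e w) \<le> gdist ?C p w"
    using emb_relpow[OF e relpow_iterate[OF c p(1) w]] unfolding p(2)
    by (intro gdist_le wf_iterate j)
  also have "\<dots> \<le> gdiam ?C"
    using finite_iterate[OF c] p(1) w by (intro gdist_le_gdiam) auto
  finally show ?thesis .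
qed

text \<open>The function \<open>F\<close> of the proof is the distance to \<open>v\<close> truncated at \<open>L\<close>, glued together from the
  copies at \<open>v\<close>. It is 1-Lipschitz, vanishes at \<open>v\<close> and equals \<open>L\<close> at the other old vertices.\<close>

lemma gdist_old_vertices:
  assumes j: "j < ncol S" and v: "v \<in> verts (iterate_graph S j N)" and y: "y \<in> verts (iterate_graph S j N)"
    and vy: "v \<noteq> y" and L0: "0 \<le> L"
    and L: "\<forall>i<ncol S. L \<le> real (gdist (iterate_graph S i m) Vplus Vminus)"
  shows "L \<le> real (gdist (iterate_graph S j (N + m)) v y)"
proof -
  let ?G = "iterate_graph S j N" and ?H = "iterate_graph S j (N + m)"
  let ?C = "\<lambda>e. iterate_graph S (icolour S j e) m"
  define loc :: "'e list \<Rightarrow> ('v, 'e) ivert \<Rightarrow> real" where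
    "loc e w = (if tail ?G e = v then min L (real (gdist (?C e) Vplus w))
      else if head ?G e = v then min L (real (gdist (?C e) Vminus w)) else L)" for e w
  define old where "old w = (if w = v then 0 else L)" for w
  define F where "F w = (case w of
      Inner f x \<Rightarrow> if N \<le> length f then loc (take N f) (Inner (drop N f) x) else old w
    | _ \<Rightarrow> old w)" for w
  have F_old: "F w = old w" if "w \<in> verts ?G" for w
  proof (cases w)
    case (Inner f x)
    then have "length f < N"
      using length_Inner[OF j] that by simp
    then show ?thesis
      by (simp add: F_def Inner)
  qed (simp_all add: F_def)
  have F_emb: "F (emb ?G e w) = loc e w" if e: "e \<in> arcs ?G" for e w
  proof -
    note c = icolour_less[OF j e]
    have ne: "tail ?G e \<noteq> head ?G e"
      using simple_graphD(4)[OF simple_iterate[OF j] e] by simp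
    have V: "Vplus \<in> verts (?C e)" "Vminus \<in> verts (?C e)"
      by (rule Vplus_Vminus_verts)+
    have zero: "gdist (?C e) x x = 0" if "x \<in> verts (?C e)" for x
      using gdist_le[OF wf_iterate[OF c] that, of x 0] by simp
    have "L \<le> real (gdist (?C e) Vplus Vminus)" "L \<le> real (gdist (?C e) Vminus Vplus)"
      using L c gdist_iterate_sym[OF c V] by (auto intro: order_trans)
    then show ?thesis
      using L0 ne zero[OF V(1)] zero[OF V(2)] F_old arc_ends_verts[OF j e] length_arcs[OF e]
      by (cases w) (auto simp: loc_def old_def F_def)
  qed
  have "\<bar>F (tail ?H f) - F (head ?H f)\<bar> \<le> 1" if f: "f \<in> arcs ?H" for f
  proof -
    obtain e g where eg: "f = e @ g" "e \<in> arcs ?G" "g \<in> arcs (?C e)"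
      using f unfolding arcs_add by blast
    note c = icolour_less[OF j eg(2)]
    have adj: "(tail (?C e) g, head (?C e) g) \<in> adj (?C e)"
      unfolding adj_iff by (rule bexI[OF _ eg(3)]) simp
    have lip: "\<bar>min L (real (gdist (?C e) p (tail (?C e) g))) - min L (real (gdist (?C e) p (head (?C e) g)))\<bar> \<le> 1"
      if "p \<in> verts (?C e)" for p
      using gdist_iterate_adj[OF c that adj] gdist_iterate_adj[OF c that adj_sym[OF adj]] by linarith
    show ?thesis
      unfolding eg(1) ends_add[OF eg(3,2)] F_emb[OF eg(2)] loc_def
      using lip Vplus_Vminus_verts by simp
  qed
  moreover have "(v, y) \<in> adj ?H ^^ gdist ?H v y"
    using v y verts_mono[of N "N + m" j] by (intro relpow_iterate j) auto
  ultimately have "\<bar>F v - F y\<bar> \<le> real (gdist ?H v y)"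
    by (rule lipschitz_relpow)
  then show ?thesis
    using F_old[OF v] F_old[OF y] vy by (simp add: old_def)
qed

section \<open>Exit time against the star of a vertex\<close>

definition incident :: "nat \<Rightarrow> nat \<Rightarrow> ('v, 'e) ivert \<Rightarrow> 'e list set" where
  "incident j N v = {e \<in> arcs (iterate_graph S j N).
     v = tail (iterate_graph S j N) e \<or> v = head (iterate_graph S j N) e}"

lemma card_incident_pos:
  assumes "j < ncol S" "v \<in> verts (iterate_graph S j N)"
  shows "0 < card (incident j N v)"
proof -
  have "incident j N v \<noteq> {}"
    using incident_arc[OF assms] by (auto simp: incident_def)
  moreover have "finite (incident j N v)"
    using finite_iterate[OF assms(1), of N] by (simp add: incident_def)
  ultimately show ?thesis
    by (simp add: card_gt_0_iff)
qed

lemma sum_incident: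
  fixes \<phi> :: "'e list \<Rightarrow> real"
  assumes "j < ncol S"
  shows "(\<Sum>e\<in>arcs (iterate_graph S j N). if e \<in> incident j N v then \<phi> e else 0) = (\<Sum>e\<in>incident j N v. \<phi> e)"
proof -
  have "incident j N v = {e \<in> arcs (iterate_graph S j N). e \<in> incident j N v}"
    by (auto simp: incident_def)
  then show ?thesis
    using finite_iterate[OF assms, of N] sum.inter_filter[of "arcs (iterate_graph S j N)" \<phi> "\<lambda>e. e \<in> incident j N v"]
    by simp
qed

definition delta :: "('v, 'e) ivert \<Rightarrow> ('v, 'e) ivert \<Rightarrow> real" where
  "delta v w = (if w = v then 1 else 0)"

lemma energy_one:
  "energy (iterate_graph S j n) (col_weight j (\<lambda>_. 1)) h u =
    (\<Sum>e\<in>arcs (iterate_graph S j n). (h (tail (iterate_graph S j n) e) - h (head (iterate_graph S j n) e)) *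
      (u (tail (iterate_graph S j n) e) - u (head (iterate_graph S j n) e)))"
  by (simp add: energy_def col_weight_def)

text \<open>As \<open>u\<close> vanishes at all old vertices but \<open>v\<close>, the coarse energy
  is exactly u(v) times the conductance of the star. The mass is at most 2 for each arc in the
  copies at \<open>v\<close>, since h <= 1 there and h = 0 elsewhere.\<close>

lemma truncated_exit_star:
  assumes j: "j < ncol S" and v: "v \<in> verts (iterate_graph S j N)" and r: "0 \<le> r"
    and dist: "\<forall>i<ncol S. r \<le> real (gdist (iterate_graph S i m) Vplus Vminus)"
  shows "truncated_exit (iterate_graph S j (N + m)) (gball (iterate_graph S j (N + m)) v r) k v *
      (\<Sum>e\<in>incident j N v. 1 / (resistance_map S ^^ m) (\<lambda>_. 1) (icolour S j e))
    \<le> (\<Sum>e\<in>incident j N v. 2 * real (card (arcs (iterate_graph S (icolour S j e) m))))"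
proof -
  let ?G = "iterate_graph S j N" and ?H = "iterate_graph S j (N + m)"
  let ?C = "\<lambda>e. iterate_graph S (icolour S j e) m"
  let ?w = "\<lambda>e. (resistance_map S ^^ m) (\<lambda>_. 1) (icolour S j e)"
  define u where "u = truncated_exit ?H (gball ?H v r) k"
  have pos: "\<forall>i<ncol S. (0 :: real) < 1"
    by simp
  obtain h where hE: "\<forall>g. energy ?H (col_weight j (\<lambda>_. 1)) h g =
        energy ?G (col_weight j ((resistance_map S ^^ m) (\<lambda>_. 1))) (delta v) g"
    and hB: "\<forall>e g lo hi. e \<in> arcs ?G \<longrightarrow> g \<in> arcs (?C e) \<longrightarrow>
        lo \<le> delta v (tail ?G e) \<longrightarrow> lo \<le> delta v (head ?G e) \<longrightarrow>
        delta v (tail ?G e) \<le> hi \<longrightarrow> delta v (head ?G e) \<le> hi \<longrightarrow>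
        lo \<le> h (tail ?H (e @ g)) \<and> h (tail ?H (e @ g)) \<le> hi \<and>
        lo \<le> h (head ?H (e @ g)) \<and> h (head ?H (e @ g)) \<le> hi"
    using ex_extension[OF j pos, of N m "delta v"] by (elim exE conjE)
  have h01: "0 \<le> h (tail ?H (e @ g)) \<and> h (tail ?H (e @ g)) \<le> 1 \<and>
      0 \<le> h (head ?H (e @ g)) \<and> h (head ?H (e @ g)) \<le> 1"
    if "e \<in> arcs ?G" "g \<in> arcs (?C e)" for e g
    using hB[rule_format, OF that, of 0 1] by (simp add: delta_def)
  have h0: "h (tail ?H (e @ g)) = 0 \<and> h (head ?H (e @ g)) = 0"
    if "e \<in> arcs ?G" "g \<in> arcs (?C e)" "e \<notin> incident j N v" for e g
    using hB[rule_format, OF that(1,2), of 0 0] that(1,3) by (auto simp: delta_def incident_def)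
  have nonneg: "0 \<le> h x" if x: "x \<in> verts ?H" for x
  proof -
    obtain f where f: "f \<in> arcs ?H" "x = tail ?H f \<or> x = head ?H f"
      using incident_arc[OF j x] by (elim bexE)
    then obtain e g where "f = e @ g" "e \<in> arcs ?G" "g \<in> arcs (?C e)"
      unfolding arcs_add by blast
    then show ?thesis
      using f(2) h01[of e g] by auto
  qed
  \<comment> \<open>Distance at least \<open>r\<close> suffices, because the ball is open.\<close>
  have u0: "u x = 0" if x: "x \<in> verts ?G" "x \<noteq> v" for x
  proof -
    have "r \<le> real (gdist ?H v x)"
      using gdist_old_vertices[OF j v x(1) _ r dist] x(2) by simp
    then show ?thesis
      unfolding u_def by (intro truncated_exit_outside) (simp add: gball_def)
  qed
  have "u v * (\<Sum>e\<in>incident j N v. 1 / ?w e) = (\<Sum>e\<in>arcs ?G. if e \<in> incident j N v then u v / ?w e else 0)"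
    unfolding sum_incident[OF j] by (simp add: sum_distrib_left)
  also have "\<dots> = energy ?G (col_weight j ((resistance_map S ^^ m) (\<lambda>_. 1))) (delta v) u"
    unfolding energy_def
  proof (rule sum.cong[OF refl])
    fix e
    assume e: "e \<in> arcs ?G"
    have "tail ?G e \<noteq> head ?G e" "tail ?G e \<in> verts ?G" "head ?G e \<in> verts ?G"
      using simple_graphD(4)[OF simple_iterate[OF j] e] by simp_all
    then show "(if e \<in> incident j N v then u v / ?w e else 0) =
        (delta v (tail ?G e) - delta v (head ?G e)) * (u (tail ?G e) - u (head ?G e)) /
        col_weight j ((resistance_map S ^^ m) (\<lambda>_. 1)) e"
      using e u0[of "tail ?G e"] u0[of "head ?G e"] by (auto simp: delta_def incident_def col_weight_def)
  qed
  also have "\<dots> = energy ?H (col_weight j (\<lambda>_. 1)) h u"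
    using hE by simp
  also have "\<dots> \<le> (\<Sum>f\<in>arcs ?H. h (tail ?H f) + h (head ?H f))"
    unfolding energy_one u_def by (rule truncated_exit_energy_le[OF simple_iterate[OF j] nonneg])
  also have "\<dots> = (\<Sum>e\<in>arcs ?G. \<Sum>g\<in>arcs (?C e). h (tail ?H (e @ g)) + h (head ?H (e @ g)))"
    by (rule sum_arcs_add[OF j])
  also have "\<dots> \<le> (\<Sum>e\<in>arcs ?G. if e \<in> incident j N v then 2 * real (card (arcs (?C e))) else 0)"
  proof (rule sum_mono)
    fix e
    assume e: "e \<in> arcs ?G"
    show "(\<Sum>g\<in>arcs (?C e). h (tail ?H (e @ g)) + h (head ?H (e @ g)))
        \<le> (if e \<in> incident j N v then 2 * real (card (arcs (?C e))) else 0)"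
    proof (cases "e \<in> incident j N v")
      case True
      have "(\<Sum>g\<in>arcs (?C e). h (tail ?H (e @ g)) + h (head ?H (e @ g))) \<le> (\<Sum>g\<in>arcs (?C e). 2)"
      proof (rule sum_mono)
        show "h (tail ?H (e @ g)) + h (head ?H (e @ g)) \<le> 2" if "g \<in> arcs (?C e)" for g
          using h01[OF e that] by linarith
      qed
      then show ?thesis
        using True by simp
    next
      case False
      then show ?thesis
        using h0[OF e _ False] by simp
    qed
  qed
  also have "\<dots> = (\<Sum>e\<in>incident j N v. 2 * real (card (arcs (?C e))))"
    by (rule sum_incident[OF j])
  finally show ?thesis
    unfolding u_def .
qed

text \<open>The planting vertex with value 1 has a neighbour, which by \<open>no_direct_arc\<close>
  is not the other planting vertex. So \<phi> is harmonic there and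
  \<open>harmonic_lower_bound\<close> applies.\<close>

lemma corner_arc:
  assumes i: "i < ncol S" and x: "\<forall>j<ncol S. 0 < x j"
    and \<kappa>: "1 \<le> \<kappa>" "\<forall>j<ncol S. \<forall>k<ncol S. x j \<le> \<kappa> * x k"
    and w: "w = bplus S i \<or> w = bminus S i"
    and \<phi>: "\<forall>z. 0 \<le> \<phi> z \<and> \<phi> z \<le> 1" "\<phi> w = 1"
    and harm: "\<forall>y. y \<noteq> bplus S i \<longrightarrow> y \<noteq> bminus S i \<longrightarrow>
      energy (rule S i) (\<lambda>e. x (ecol S i e)) \<phi> (\<lambda>z. if z = y then 1 else 0) = 0"
  shows "\<exists>a\<in>arcs (rule S i). 1 / (real arcs_total * \<kappa>) \<le> \<phi> (tail (rule S i) a) \<and>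
    1 / (real arcs_total * \<kappa>) \<le> \<phi> (head (rule S i) a)"
proof -
  interpret network "rule S i" "bplus S i" "bminus S i"
    by (rule network[OF i])
  let ?R = "rule S i"
  define w' where "w' = (if w = bplus S i then bminus S i else bplus S i)"
  have w': "w \<in> verts ?R" "w' \<in> verts ?R" "w \<noteq> w'" "{w, w'} = {bplus S i, bminus S i}"
    using w planting_verts[OF i] by (auto simp: w'_def)
  then have "(w, w') \<in> (adj ?R)\<^sup>*"
    using rule_conn[OF i] by (simp add: conn_def)
  then have "\<exists>y. (w, y) \<in> adj ?R"
    using w'(3) by (cases rule: converse_rtranclE) auto
  then obtain y where "(w, y) \<in> adj ?R"
    by (elim exE)
  then obtain a where a: "a \<in> arcs ?R"
    "(w = tail ?R a \<and> y = head ?R a) \<or> (w = head ?R a \<and> y = tail ?R a)"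
    unfolding adj_iff by (elim bexE)
  have ends: "{tail ?R a, head ?R a} = {w, y}" "w \<noteq> y"
    using a(2) simple_graphD(4)[OF simple a(1)] by auto
  have "y \<noteq> w'"
    using no_direct_arc[OF i a(1)] ends(1) w'(4) by auto
  then have "y \<noteq> bplus S i" "y \<noteq> bminus S i"
    using ends(2) w'(4) by (auto simp: doubleton_eq_iff)
  then have h: "energy ?R (\<lambda>e. x (ecol S i e)) \<phi> (\<lambda>z. if z = y then 1 else 0) = 0"
    using harm by simp
  have "1 / (real (card (arcs ?R)) * \<kappa>) \<le> \<phi> y"
    using \<kappa> \<phi> ecol_less[OF i]
    by (intro harmonic_lower_bound[OF weights_pos[OF i x] _ _ _ _ h a(1) ends]) auto
  moreover have "1 / (real arcs_total * \<kappa>) \<le> 1 / (real (card (arcs ?R)) * \<kappa>)"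
    using card_arcs_le_total[OF i] card_arcs_pos \<kappa>(1) by (intro divide_left_mono mult_right_mono) auto
  moreover have "1 / (real arcs_total * \<kappa>) \<le> 1"
  proof -
    have "1 * 1 \<le> real arcs_total * \<kappa>"
      using arcs_total_pos \<kappa>(1) by (intro mult_mono) auto
    then show ?thesis
      by simp
  qed
  ultimately have "1 / (real arcs_total * \<kappa>) \<le> \<phi> y" "1 / (real arcs_total * \<kappa>) \<le> \<phi> w"
    unfolding \<phi>(2) by linarith+
  then show ?thesis
    using a(2) by (intro bexI[OF _ a(1)]) (elim disjE conjE, simp_all)
qed

text \<open>Inside a copy at \<open>v\<close> the extension is the unit potential if
  \<open>v\<close> is the tail, and 1 minus it if \<open>v\<close> is the head; either is 1 at
  \<open>v\<close> and harmonic at the inner vertices.\<close>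

lemma ext_delta_corner:
  assumes j: "j < ncol S" and e: "e \<in> incident j N v" and x: "\<forall>j<ncol S. 0 < x j"
    and \<kappa>: "1 \<le> \<kappa>" "\<forall>j<ncol S. \<forall>k<ncol S. x j \<le> \<kappa> * x k"
  shows "\<exists>a\<in>arcs (rule S (icolour S j e)).
    1 / (real arcs_total * \<kappa>) \<le> ext j N x (delta v) (tail (iterate_graph S j (Suc N)) (e @ [a])) \<and>
    1 / (real arcs_total * \<kappa>) \<le> ext j N x (delta v) (head (iterate_graph S j (Suc N)) (e @ [a]))"
proof -
  let ?G = "iterate_graph S j N" and ?i = "icolour S j e"
  have eG: "e \<in> arcs ?G" and v: "v = tail ?G e \<or> v = head ?G e"
    using e by (auto simp: incident_def)
  note i = icolour_less[OF j eG]
  note P = potential[OF i x]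
  have ne: "tail ?G e \<noteq> head ?G e"
    using simple_graphD(4)[OF simple_iterate[OF j] eG] by simp
  define \<phi> where "\<phi> z = delta v (head ?G e) + (delta v (tail ?G e) - delta v (head ?G e)) * potential x ?i z" for z
  define w where "w = (if v = tail ?G e then bplus S ?i else bminus S ?i)"
  define s where "s = delta v (tail ?G e) - delta v (head ?G e)"
  have E: "energy (rule S ?i) (\<lambda>e. x (ecol S ?i e)) \<phi> g =
      s * energy (rule S ?i) (\<lambda>e. x (ecol S ?i e)) (potential x ?i) g" for g
    unfolding energy_def sum_distrib_left \<phi>_def s_def
    by (rule sum.cong[OF refl]) (simp add: algebra_simps)
  have "\<exists>a\<in>arcs (rule S ?i). 1 / (real arcs_total * \<kappa>) \<le> \<phi> (tail (rule S ?i) a) \<and>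
    1 / (real arcs_total * \<kappa>) \<le> \<phi> (head (rule S ?i) a)"
  proof (rule corner_arc[OF i x \<kappa>])
    show "w = bplus S ?i \<or> w = bminus S ?i"
      by (simp add: w_def)
    show "\<forall>z. 0 \<le> \<phi> z \<and> \<phi> z \<le> 1"
      using v ne P(3,4) by (auto simp: \<phi>_def delta_def)
    show "\<phi> w = 1"
      using v ne P(1,2) by (auto simp: \<phi>_def delta_def w_def)
    show "\<forall>y. y \<noteq> bplus S ?i \<longrightarrow> y \<noteq> bminus S ?i \<longrightarrow>
      energy (rule S ?i) (\<lambda>e. x (ecol S ?i e)) \<phi> (\<lambda>z. if z = y then 1 else 0) = 0"
      by (simp add: E P(5))
  qed
  then show ?thesis
    unfolding tail_Suc head_Suc ext_plant[OF j eG x] \<phi>_def .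
qed

text \<open>Level \<open>Suc m\<close> is one explicit substitution, giving a corner arc in each
  copy at \<open>v\<close>, followed by \<open>m\<close> further ones, through which the maximum
  principle keeps the lower bound. The premise on truncations provides the finite solution
  \<open>u\<close>.\<close>

lemma expected_exit_star_lower:
  assumes j: "j < ncol S" and v: "v \<in> verts (iterate_graph S j N)"
    and diam: "\<forall>i<ncol S. real (gdiam (iterate_graph S i (Suc m))) < r"
    and bdd: "\<And>k. truncated_exit (iterate_graph S j (N + Suc m)) (gball (iterate_graph S j (N + Suc m)) v r) k v \<le> C"
    and \<kappa>: "1 \<le> \<kappa>" "\<forall>i<ncol S. \<forall>k<ncol S. (resistance_map S ^^ m) (\<lambda>_. 1) i \<le> \<kappa> * (resistance_map S ^^ m) (\<lambda>_. 1) k"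
    and b: "0 \<le> b" "\<forall>i<ncol S. b \<le> real (card (arcs (iterate_graph S i m)))"
  shows "\<exists>T\<ge>0. expected_exit_time (iterate_graph S j (N + Suc m)) v (gball (iterate_graph S j (N + Suc m)) v r) = ennreal T \<and>
    card (incident j N v) * (2 * b / (real arcs_total * \<kappa>))
      \<le> T * (\<Sum>e\<in>incident j N v. 1 / (resistance_map S ^^ Suc m) (\<lambda>_. 1) (icolour S j e))"
proof -
  let ?G = "iterate_graph S j N" and ?G' = "iterate_graph S j (Suc N)" and ?H = "iterate_graph S j (N + Suc m)"
  let ?C = "\<lambda>e. iterate_graph S (icolour S j e) m"
  let ?w = "\<lambda>e. (resistance_map S ^^ Suc m) (\<lambda>_. 1) (icolour S j e)"
  define \<delta> where "\<delta> = 1 / (real arcs_total * \<kappa>)"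
  have \<delta>: "0 \<le> \<delta>"
    using \<kappa>(1) by (simp add: \<delta>_def)
  define y where "y = (resistance_map S ^^ m) (\<lambda>_. 1)"
  have one: "\<forall>i<ncol S. (0 :: real) < 1"
    by simp
  have y: "\<forall>i<ncol S. 0 < y i"
    unfolding y_def by (rule pos_resistance_funpow[OF one])
  have Suc_y: "(resistance_map S ^^ Suc m) (\<lambda>_. 1) = resistance_map S y"
    by (simp add: y_def)
  have HSuc: "?H = iterate_graph S j (Suc N + m)"
    by simp
  \<comment> \<open>The first substitution already sees the resistances \<Psi>^m(1) of the copies
    that later replace its arcs.\<close>
  define f where "f = ext j N y (delta v)"
  obtain h where hE: "\<forall>g. energy (iterate_graph S j (Suc N + m)) (col_weight j (\<lambda>_. 1)) h g = energy ?G' (col_weight j ((resistance_map S ^^ m) (\<lambda>_. 1))) f g"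
    and hB: "\<forall>e g lo hi. e \<in> arcs ?G' \<longrightarrow> g \<in> arcs (?C e) \<longrightarrow>
        lo \<le> f (tail ?G' e) \<longrightarrow> lo \<le> f (head ?G' e) \<longrightarrow>
        f (tail ?G' e) \<le> hi \<longrightarrow> f (head ?G' e) \<le> hi \<longrightarrow>
        lo \<le> h (tail (iterate_graph S j (Suc N + m)) (e @ g)) \<and> h (tail (iterate_graph S j (Suc N + m)) (e @ g)) \<le> hi \<and>
        lo \<le> h (head (iterate_graph S j (Suc N + m)) (e @ g)) \<and> h (head (iterate_graph S j (Suc N + m)) (e @ g)) \<le> hi"
    using ex_extension[OF j one, of "Suc N" m f] by (elim exE conjE)
  have E: "energy ?H (col_weight j (\<lambda>_. 1)) h g = energy ?G (col_weight j (resistance_map S y)) (delta v) g" for g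
    unfolding HSuc using hE energy_ext[OF j y, of N "delta v" g] by (simp add: f_def y_def)
  have f01: "0 \<le> f (tail ?G' (e @ [a])) \<and> f (tail ?G' (e @ [a])) \<le> 1 \<and>
      0 \<le> f (head ?G' (e @ [a])) \<and> f (head ?G' (e @ [a])) \<le> 1"
    if "e \<in> arcs ?G" "a \<in> arcs (rule S (icolour S j e))" for e a
    using ext_between[OF j y that, of 0 "delta v" 1] by (simp add: delta_def f_def)
  have f0: "f (tail ?G' (e @ [a])) = 0 \<and> f (head ?G' (e @ [a])) = 0"
    if "e \<in> arcs ?G" "a \<in> arcs (rule S (icolour S j e))" "e \<notin> incident j N v" for e a
    using ext_between[OF j y that(1,2), of 0 "delta v" 0] that(1,3)
    by (auto simp: delta_def f_def incident_def)
  have arc': "e @ [a] \<in> arcs ?G'" if "e \<in> arcs ?G" "a \<in> arcs (rule S (icolour S j e))" for e a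
    unfolding arcs_Suc using that by blast
  have h_ge: "lo \<le> h (tail ?H ((e @ [a]) @ g)) \<and> lo \<le> h (head ?H ((e @ [a]) @ g))"
    if "e \<in> arcs ?G" "a \<in> arcs (rule S (icolour S j e))" "g \<in> arcs (?C (e @ [a]))"
      "lo \<le> f (tail ?G' (e @ [a]))" "lo \<le> f (head ?G' (e @ [a]))" for e a g lo
    using hB[rule_format, OF arc'[OF that(1,2)] that(3) that(4,5), of 1] f01[OF that(1,2)] by simp
  have h_zero: "h (tail ?H ((e @ [a]) @ g)) = 0 \<and> h (head ?H ((e @ [a]) @ g)) = 0"
    if "e \<in> arcs ?G" "a \<in> arcs (rule S (icolour S j e))" "g \<in> arcs (?C (e @ [a]))" "e \<notin> incident j N v" for e a g
    using hB[rule_format, OF arc'[OF that(1,2)] that(3), of 0 0] f0[OF that(1,2,4)] by simp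
  have decomp: "\<exists>e a g. f' = (e @ [a]) @ g \<and> e \<in> arcs ?G \<and> a \<in> arcs (rule S (icolour S j e)) \<and> g \<in> arcs (?C (e @ [a]))"
    if "f' \<in> arcs ?H" for f'
  proof -
    have "f' \<in> arcs (iterate_graph S j (Suc N + m))"
      using that by simp
    then obtain e' g where eg: "f' = e' @ g" "e' \<in> arcs ?G'" "g \<in> arcs (?C e')"
      unfolding arcs_add by blast
    from eg(2) obtain e a where ea: "e' = e @ [a]" "e \<in> arcs ?G" "a \<in> arcs (rule S (icolour S j e))"
      unfolding arcs_Suc by blast
    show ?thesis
      by (rule exI[of _ e], rule exI[of _ a], rule exI[of _ g])
        (intro conjI eg(1)[unfolded ea(1)] ea(2,3) eg(3)[unfolded ea(1)])
  qed
  \<comment> \<open>Admissibility of \<open>h\<close> in the energy identity: it is nonzero only in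
    the copies at \<open>v\<close>, whose diameter is below \<open>r\<close>.\<close>
  have supp: "h x = 0" if x: "x \<in> verts ?H" "x \<notin> gball ?H v r" for x
  proof -
    obtain f' where f': "f' \<in> arcs ?H" "x = tail ?H f' \<or> x = head ?H f'"
      using incident_arc[OF j x(1)] by (elim bexE)
    obtain e a g where d: "f' = (e @ [a]) @ g" "e \<in> arcs ?G" "a \<in> arcs (rule S (icolour S j e))" "g \<in> arcs (?C (e @ [a]))"
      using decomp[OF f'(1)] by (elim exE conjE)
    have "e \<notin> incident j N v"
    proof
      assume inc: "e \<in> incident j N v"
      have len: "length e = N"
        using length_arcs[OF d(2)] .
      \<comment> \<open>The same address is now cut after \<open>N\<close> letters instead of
        \<open>N + 1\<close>, to match the diameter of a copy of level \<open>Suc m\<close>.\<close>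
      obtain e1 g1 where eg: "f' = e1 @ g1" "e1 \<in> arcs ?G" "g1 \<in> arcs (iterate_graph S (icolour S j e1) (Suc m))"
        using f'(1) unfolding arcs_add by blast
      have "e1 = e"
        using d(1) eg(1) len length_arcs[OF eg(2)] by simp
      note eg' = eg(2,3)[unfolded \<open>e1 = e\<close>]
      note c = icolour_less[OF j d(2)]
      let ?D = "iterate_graph S (icolour S j e) (Suc m)"
      have "x = emb ?G e (tail ?D g1) \<or> x = emb ?G e (head ?D g1)"
        using f'(2) unfolding eg(1) \<open>e1 = e\<close> ends_add[OF eg'(2,1)] .
      then have "\<exists>z\<in>verts ?D. x = emb ?G e z"
        using arc_ends_verts[OF c eg'(2)] by blast
      then obtain z where z: "z \<in> verts ?D" "x = emb ?G e z"
        by (elim bexE)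
      have "v = tail ?G e \<or> v = head ?G e"
        using inc by (simp add: incident_def)
      from gdist_in_copy[OF j d(2) this z(1)] have "gdist ?H v x \<le> gdiam ?D"
        unfolding z(2) .
      moreover have "real (gdiam ?D) < r"
        using diam c by blast
      ultimately show False
        using x by (simp add: gball_def)
    qed
    then show ?thesis
      using h_zero[OF d(2,3,4)] f'(2) d(1) by auto
  qed
  have vH: "v \<in> verts ?H"
    using v verts_mono[of N "N + Suc m" j] by auto
  have "\<exists>u. expected_exit_time ?H v (gball ?H v r) = ennreal (u v) \<and> (\<forall>x. 0 \<le> u x) \<and>
    (\<forall>h. (\<forall>x\<in>verts ?H. x \<notin> gball ?H v r \<longrightarrow> h x = 0) \<longrightarrow>
      (\<Sum>e\<in>arcs ?H. (h (tail ?H e) - h (head ?H e)) * (u (tail ?H e) - u (head ?H e)))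
      = (\<Sum>e\<in>arcs ?H. h (tail ?H e) + h (head ?H e)))"
    by (rule exit_time_energy[OF simple_iterate[OF j] conn_iterate[OF j] vH])
      (erule neighbours_nonempty[OF j], rule bdd)
  then obtain u where u: "expected_exit_time ?H v (gball ?H v r) = ennreal (u v)" "\<forall>x. 0 \<le> u x"
    "\<forall>h. (\<forall>x\<in>verts ?H. x \<notin> gball ?H v r \<longrightarrow> h x = 0) \<longrightarrow>
      (\<Sum>e\<in>arcs ?H. (h (tail ?H e) - h (head ?H e)) * (u (tail ?H e) - u (head ?H e)))
      = (\<Sum>e\<in>arcs ?H. h (tail ?H e) + h (head ?H e))"
    by (elim exE conjE)
  have "card (incident j N v) * (2 * b / (real arcs_total * \<kappa>)) = (\<Sum>e\<in>incident j N v. 2 * b * \<delta>)"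
    by (simp add: \<delta>_def)
  also have "\<dots> = (\<Sum>e\<in>arcs ?G. if e \<in> incident j N v then 2 * b * \<delta> else 0)"
    by (rule sum_incident[OF j, symmetric])
  also have "\<dots> \<le> (\<Sum>e\<in>arcs ?G. \<Sum>a\<in>arcs (rule S (icolour S j e)). \<Sum>g\<in>arcs (?C (e @ [a])).
      h (tail ?H ((e @ [a]) @ g)) + h (head ?H ((e @ [a]) @ g)))"
  proof (rule sum_mono)
    fix e
    assume e: "e \<in> arcs ?G"
    define \<Phi> where "\<Phi> a = (\<Sum>g\<in>arcs (?C (e @ [a])). h (tail ?H ((e @ [a]) @ g)) + h (head ?H ((e @ [a]) @ g)))" for a
    have nn: "0 \<le> \<Phi> a" if "a \<in> arcs (rule S (icolour S j e))" for a
      unfolding \<Phi>_def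
    proof (rule sum_nonneg)
      fix g
      assume "g \<in> arcs (?C (e @ [a]))"
      from h_ge[OF e that this, of 0] f01[OF e that]
      show "0 \<le> h (tail ?H ((e @ [a]) @ g)) + h (head ?H ((e @ [a]) @ g))"
        by simp
    qed
    have "(if e \<in> incident j N v then 2 * b * \<delta> else 0) \<le> (\<Sum>a\<in>arcs (rule S (icolour S j e)). \<Phi> a)"
    proof (cases "e \<in> incident j N v")
      case True
      \<comment> \<open>The corner arc is replaced by at least \<open>b\<close> arcs, each with both
        end values at least \<delta>; this is the contribution 2 b \<delta>.\<close>
      obtain a where a: "a \<in> arcs (rule S (icolour S j e))" "\<delta> \<le> f (tail ?G' (e @ [a]))" "\<delta> \<le> f (head ?G' (e @ [a]))"
        using ext_delta_corner[OF j True y \<kappa>(1) \<kappa>(2)[folded y_def]]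
        unfolding \<delta>_def f_def by (elim bexE conjE)
      have ca: "icolour S j (e @ [a]) < ncol S"
        using icolour_less[OF j arc'[OF e a(1)]] .
      have "2 * b * \<delta> \<le> 2 * real (card (arcs (?C (e @ [a])))) * \<delta>"
        using b ca \<delta> by (intro mult_right_mono) auto
      also have "\<dots> = (\<Sum>g\<in>arcs (?C (e @ [a])). 2 * \<delta>)"
        by simp
      also have "\<dots> \<le> \<Phi> a"
        unfolding \<Phi>_def
      proof (rule sum_mono)
        fix g
        assume "g \<in> arcs (?C (e @ [a]))"
        from h_ge[OF e a(1) this a(2,3)]
        show "2 * \<delta> \<le> h (tail ?H ((e @ [a]) @ g)) + h (head ?H ((e @ [a]) @ g))"
          by simp
      qed
      also have "\<dots> \<le> (\<Sum>a\<in>arcs (rule S (icolour S j e)). \<Phi> a)"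
        using a(1) nn simple_graphD(2)[OF rule_simple[OF icolour_less[OF j e]]] by (intro member_le_sum) auto
      finally show ?thesis
        using True by simp
    next
      case False
      then show ?thesis
        using nn by (simp add: sum_nonneg)
    qed
    then show "(if e \<in> incident j N v then 2 * b * \<delta> else 0) \<le> (\<Sum>a\<in>arcs (rule S (icolour S j e)).
        \<Sum>g\<in>arcs (?C (e @ [a])). h (tail ?H ((e @ [a]) @ g)) + h (head ?H ((e @ [a]) @ g)))"
      unfolding \<Phi>_def .
  qed
  also have "\<dots> = (\<Sum>f\<in>arcs ?H. h (tail ?H f) + h (head ?H f))"
    unfolding HSuc sum_arcs_add[OF j, of _ "Suc N" m] sum_arcs_Suc[OF j, of _ N] ..
  also have "\<dots> = energy ?H (col_weight j (\<lambda>_. 1)) h u"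
    unfolding energy_one using u(3) supp by simp
  also have "\<dots> = energy ?G (col_weight j (resistance_map S y)) (delta v) u"
    by (rule E)
  also have "\<dots> \<le> (\<Sum>e\<in>arcs ?G. if e \<in> incident j N v then u v / ?w e else 0)"
    unfolding energy_def Suc_y
  proof (rule sum_mono)
    fix e
    assume e: "e \<in> arcs ?G"
    have ne: "tail ?G e \<noteq> head ?G e"
      using simple_graphD(4)[OF simple_iterate[OF j] e] by simp
    have w: "0 < resistance_map S y (icolour S j e)"
      using resistance_map_pos[OF icolour_less[OF j e] y] .
    \<comment> \<open>Other old vertices may lie in the ball here; their values of \<open>u\<close>
      enter with a negative sign and are dropped.\<close>
    have "(delta v (tail ?G e) - delta v (head ?G e)) * (u (tail ?G e) - u (head ?G e))
        \<le> (if e \<in> incident j N v then u v else 0)"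
      using e ne u(2)[rule_format, of "tail ?G e"] u(2)[rule_format, of "head ?G e"]
      by (auto simp: delta_def incident_def)
    then have "(delta v (tail ?G e) - delta v (head ?G e)) * (u (tail ?G e) - u (head ?G e)) /
        resistance_map S y (icolour S j e)
      \<le> (if e \<in> incident j N v then u v else 0) / resistance_map S y (icolour S j e)"
      using w by (intro divide_right_mono) auto
    then show "(delta v (tail ?G e) - delta v (head ?G e)) * (u (tail ?G e) - u (head ?G e)) /
        col_weight j (resistance_map S y) e
      \<le> (if e \<in> incident j N v then u v / resistance_map S y (icolour S j e) else 0)"
      by (simp add: col_weight_def split: if_splits)
  qed
  also have "\<dots> = u v * (\<Sum>e\<in>incident j N v. 1 / ?w e)"
    unfolding sum_incident[OF j] by (simp add: sum_distrib_left)
  finally have "card (incident j N v) * (2 * b / (real arcs_total * \<kappa>)) \<le> u v * (\<Sum>e\<in>incident j N v. 1 / ?w e)" .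
  then show ?thesis
    using u(1) u(2)[rule_format, of v] by (intro exI[of _ "u v"] conjI)
qed

text \<open>The original end vertices are distinct, hence at distance at least 1 in every iterate. A
  rate below 1 would push the diameter bound under 1.\<close>

lemma rho_min_ge_1:
  assumes "distance_constants S cd Cd"
  shows "1 \<le> rho_min S"
proof -
  let ?G = "iterate_graph S (icol S)"
  have Cd: "0 < Cd"
    using assms by (simp add: distance_constants_def)
  have ge: "1 \<le> Cd * rho_min S ^ m" for m
  proof -
    have "gdist (?G m) Vplus Vminus \<noteq> 0"
    proof
      assume "gdist (?G m) Vplus Vminus = 0"
      then show False
        using relpow_iterate[OF icol_less Vplus_Vminus_verts, of m] by simp
    qed
    then have "1 \<le> real (gdist (?G m) Vplus Vminus)"
      by simp
    also have "\<dots> \<le> real (gdiam (?G m))"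
      using assms icol_less by (simp add: distance_constants_def)
    also have "\<dots> \<le> Cd * rho_min S ^ m"
      using assms icol_less by (simp add: distance_constants_def)
    finally show ?thesis .
  qed
  have "0 < Cd * rho_min S"
    using ge[of 1] by simp
  then have pos: "0 < rho_min S"
    using Cd by (simp add: zero_less_mult_iff)
  show ?thesis
  proof (rule ccontr)
    assume "\<not> 1 \<le> rho_min S"
    then obtain m where "rho_min S ^ m < 1 / Cd"
      using real_arch_pow_inv[of "1 / Cd" "rho_min S"] Cd by auto
    then have "Cd * rho_min S ^ m < 1"
      using Cd by (simp add: field_simps)
    with ge[of m] show False
      by simp
  qed
qed

section \<open>Constants uniform in the level\<close>

lemma ex_resistance_bounds:
  "0 < rho_resistance S \<and> (\<exists>b>0. \<exists>B>0. \<forall>m. \<forall>i<ncol S. b * rho_resistance S ^ m \<le> (resistance_map S ^^ m) (\<lambda>_. 1) i \<and>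
     (resistance_map S ^^ m) (\<lambda>_. 1) i \<le> B * rho_resistance S ^ m)"
proof (rule conjI)
  show "0 < rho_resistance S"
    using eigenvalue_rho_resistance unfolding resistance.positive_eigenvalue_def by (rule conjunct1)
  have one: "\<forall>i<ncol S. (0 :: real) < 1"
    by simp
  show "\<exists>b>0. \<exists>B>0. \<forall>m. \<forall>i<ncol S. b * rho_resistance S ^ m \<le> (resistance_map S ^^ m) (\<lambda>_. 1) i \<and>
     (resistance_map S ^^ m) (\<lambda>_. 1) i \<le> B * rho_resistance S ^ m"
    by (rule resistance.ex_growth[OF eigenvalue_rho_resistance one])
qed

lemma ex_edge_bounds:
  "0 < rho (edge_matrix S) \<and> (\<exists>b>0. \<exists>B>0. \<forall>m. \<forall>i<ncol S. b * rho (edge_matrix S) ^ m \<le> real (card (arcs (iterate_graph S i m))) \<and>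
     real (card (arcs (iterate_graph S i m))) \<le> B * rho (edge_matrix S) ^ m)"
proof (rule conjI)
  show "0 < rho (edge_matrix S)"
    using eigenvalue_rho_edge_matrix unfolding edges.positive_eigenvalue_def by (rule conjunct1)
  have one: "\<forall>i<ncol S. (0 :: real) < 1"
    by simp
  obtain b B where "0 < b" "0 < B" and bB: "\<forall>m. \<forall>i<ncol S. b * rho (edge_matrix S) ^ m \<le> (edge_map ^^ m) (\<lambda>_. 1) i \<and>
     (edge_map ^^ m) (\<lambda>_. 1) i \<le> B * rho (edge_matrix S) ^ m"
    using edges.ex_growth[OF eigenvalue_rho_edge_matrix one] by (elim exE conjE)
  then show "\<exists>b>0. \<exists>B>0. \<forall>m. \<forall>i<ncol S.
     b * rho (edge_matrix S) ^ m \<le> real (card (arcs (iterate_graph S i m))) \<and>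
     real (card (arcs (iterate_graph S i m))) \<le> B * rho (edge_matrix S) ^ m"
    by (intro exI[of _ b] exI[of _ B] conjI) (simp_all add: card_arcs_iterate)
qed

text \<open>After at least one application the iterate lies in the image of \<Psi>, where the ratio
  bound holds with one constant; the zeroth iterate is constant.\<close>

lemma ex_resistance_ratio:
  "\<exists>\<kappa>\<ge>1. \<forall>m. \<forall>i<ncol S. \<forall>k<ncol S.
     (resistance_map S ^^ m) (\<lambda>_. 1) i \<le> \<kappa> * (resistance_map S ^^ m) (\<lambda>_. 1) k"
proof -
  obtain \<kappa> where \<kappa>: "1 \<le> \<kappa>" "\<forall>x i j. (\<forall>j<ncol S. 0 < x j) \<longrightarrow> i < ncol S \<longrightarrow> j < ncol S \<longrightarrow>
      resistance_map S x i \<le> \<kappa> * resistance_map S x j"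
    using resistance.ex_ratio_bound by (elim exE conjE)
  have "(resistance_map S ^^ m) (\<lambda>_. 1) i \<le> \<kappa> * (resistance_map S ^^ m) (\<lambda>_. 1) k"
    if ik: "i < ncol S" "k < ncol S" for m i k
  proof (cases m)
    case 0
    then show ?thesis
      using \<kappa>(1) by simp
  next
    case (Suc l)
    have "\<forall>j<ncol S. 0 < (resistance_map S ^^ l) (\<lambda>_. 1) j"
      by (rule pos_resistance_funpow) simp
    with \<kappa>(2) ik show ?thesis
      unfolding Suc by simp
  qed
  with \<kappa>(1) show ?thesis
    by (intro exI[of _ \<kappa>] conjI allI impI)
qed

end

theorem theorem2p23:
  fixes S :: "('v, 'e) eigs" and cd Cd :: real and c0 :: nat
  assumes "wf_eigs S"
    and "canonical S" and "distance_positive S" and "degree_primitive S"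
    and "distance_constants S cd Cd" and "level_constant S cd Cd c0"
  shows "\<exists>c_exit C_exit :: real. c_exit > 0 \<and> C_exit > 0 \<and>
    (\<forall>(n::nat) (k::nat) (m::nat) (r::real). \<forall>v \<in> born_at S k.
       k \<le> n \<longrightarrow> int c0 + 1 \<le> int m \<longrightarrow> int m \<le> int n - int k - int c0 \<longrightarrow> r > 0 \<longrightarrow>
       cd * rho_min S ^ m \<le> r \<longrightarrow> r \<le> Cd * rho_min S ^ m \<longrightarrow>
       ennreal (c_exit * rho (edge_matrix S) ^ m * rho_resistance S ^ m)
         \<le> expected_exit_time (Xi S n) v (gball (Xi S n) v r) \<and>
       expected_exit_time (Xi S n) v (gball (Xi S n) v r)
         \<le> ennreal (C_exit * rho (edge_matrix S) ^ m * rho_resistance S ^ m))"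
proof -
  interpret eigs_system S
    using assms by unfold_locales
  define \<rho> where "\<rho> = rho_min S"
  define t where "t = rho_resistance S"
  define l where "l = rho (edge_matrix S)"
  define R where "R m = (resistance_map S ^^ m) (\<lambda>_. 1)" for m
  define A where "A i m = real (card (arcs (iterate_graph S i m)))" for i m
  have \<rho>: "1 \<le> \<rho>"
    unfolding \<rho>_def by (rule rho_min_ge_1[OF assms(5)])
  obtain aR bR where t: "0 < t" and aR: "0 < aR" and bR: "0 < bR"
    and R: "\<forall>m. \<forall>i<ncol S. aR * t ^ m \<le> R m i \<and> R m i \<le> bR * t ^ m"
    using ex_resistance_bounds unfolding t_def R_def by (elim exE conjE)
  obtain aA bA where l: "0 < l" and aA: "0 < aA" and bA: "0 < bA"
    and A: "\<forall>m. \<forall>i<ncol S. aA * l ^ m \<le> A i m \<and> A i m \<le> bA * l ^ m"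
    using ex_edge_bounds unfolding l_def A_def by (elim exE conjE)
  obtain \<kappa> where \<kappa>: "1 \<le> \<kappa>" "\<forall>m. \<forall>i<ncol S. \<forall>k<ncol S. R m i \<le> \<kappa> * R m k"
    using ex_resistance_ratio unfolding R_def by (elim exE conjE)
  have Rpos: "0 < R m i" if "i < ncol S" for m i
    using R[rule_format, OF that, of m] aR t by (meson less_le_trans mult_pos_pos zero_less_power)
  have cd: "0 < cd" and Cd: "0 < Cd"
    and dist: "\<And>i m. i < ncol S \<Longrightarrow> cd * \<rho> ^ m \<le> real (gdist (iterate_graph S i m) Vplus Vminus)"
    and diam: "\<And>i m. i < ncol S \<Longrightarrow> real (gdiam (iterate_graph S i m)) \<le> Cd * \<rho> ^ m"
    using assms(5) by (simp_all add: distance_constants_def \<rho>_def)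
  have lev1: "4 * Cd \<le> cd * \<rho> ^ c0"
    using assms(6) unfolding level_constant_def \<rho>_def by (rule conjunct2)
  have "Cd * \<rho> powi (- int c0) \<le> cd / (4 * \<rho>)"
    using assms(6) unfolding level_constant_def \<rho>_def by (rule conjunct1)
  moreover have "\<rho> powi (- int c0) = 1 / \<rho> ^ c0"
    by (simp add: power_int_minus inverse_eq_divide)
  ultimately have lev2: "Cd / \<rho> ^ c0 \<le> cd / (4 * \<rho>)"
    by simp
  define \<delta> where "\<delta> = 1 / (real arcs_total * \<kappa>)"
  have \<delta>: "0 < \<delta>"
    using arcs_total_pos \<kappa>(1) by (simp add: \<delta>_def)
  \<comment> \<open>In \<open>C1\<close>, (l t)^c0 pays for copies of level m + c0 instead of m. In
    \<open>c1\<close> the denominator pays for levels m - c0 - 1 in the edge count and m - c0 in the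
    resistance, hence the extra factor \<open>l\<close>.\<close>
  define C1 where "C1 = 2 * bR * bA * (l * t) ^ c0"
  define c1 where "c1 = 2 * \<delta> * aR * aA / (l * (l * t) ^ c0)"
  have pos: "0 < C1" "0 < c1"
    using aR bR aA bA l t \<delta> by (simp_all add: C1_def c1_def)
  have main: "ennreal (c1 * l ^ m * t ^ m) \<le> expected_exit_time (Xi S n) v (gball (Xi S n) v r) \<and>
      expected_exit_time (Xi S n) v (gball (Xi S n) v r) \<le> ennreal (C1 * l ^ m * t ^ m)"
    if v: "v \<in> born_at S k" and m: "int c0 + 1 \<le> int m" "int m \<le> int n - int k - int c0"
      and r: "0 < r" "cd * \<rho> ^ m \<le> r" "r \<le> Cd * \<rho> ^ m" for n k m r v
  proof -
    let ?j = "icol S"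
    let ?H = "iterate_graph S ?j n"
    note j = icol_less
    have vk: "v \<in> verts (iterate_graph S ?j k)"
      using v by (auto simp: born_at_def Xi_def)
    have rpos: "0 < \<rho> ^ p" for p
      using \<rho> by simp
    have upper: "truncated_exit ?H (gball ?H v r) q v \<le> C1 * l ^ m * t ^ m" for q
    proof -
      \<comment> \<open>The coarse level for the upper bound: its copies have level m + c0, so by
        the second condition on c0 their end vertices are at least \<open>r\<close> apart. The upper
        limit on m gives k <= N, so \<open>v\<close> is already present.\<close>
      define N where "N = n - m - c0"
      have N: "N + (m + c0) = n" "k \<le> N"
        using m by (auto simp: N_def)
      have vN: "v \<in> verts (iterate_graph S ?j N)"
        using vk verts_mono[OF N(2)] by blast
      let ?I = "incident ?j N v"
      have D: "0 < real (card ?I)"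
        using card_incident_pos[OF j vN] by simp
      have far: "\<forall>i<ncol S. r \<le> real (gdist (iterate_graph S i (m + c0)) Vplus Vminus)"
      proof (intro allI impI)
        fix i
        assume i: "i < ncol S"
        have "Cd * \<rho> ^ m \<le> (cd * \<rho> ^ c0) * \<rho> ^ m"
          using lev1 Cd rpos[of m] by (intro mult_right_mono) auto
        also have "\<dots> = cd * \<rho> ^ (m + c0)"
          by (simp add: power_add mult_ac)
        finally show "r \<le> real (gdist (iterate_graph S i (m + c0)) Vplus Vminus)"
          using r(3) dist[OF i, of "m + c0"] by linarith
      qed
      define U where "U = truncated_exit ?H (gball ?H v r) q v"
      have U: "0 \<le> U"
        by (simp add: U_def truncated_exit_nonneg)
      have star: "U * (\<Sum>e\<in>?I. 1 / R (m + c0) (icolour S ?j e)) \<le> (\<Sum>e\<in>?I. 2 * A (icolour S ?j e) (m + c0))"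
        using truncated_exit_star[OF j vN less_imp_le[OF r(1)] far, of q] unfolding N(1) U_def R_def A_def .
      have "U * (card ?I * (1 / (bR * t ^ (m + c0)))) = U * (\<Sum>e\<in>?I. 1 / (bR * t ^ (m + c0)))"
        by simp
      also have "\<dots> \<le> U * (\<Sum>e\<in>?I. 1 / R (m + c0) (icolour S ?j e))"
      proof (intro mult_left_mono sum_mono U)
        fix e
        assume "e \<in> ?I"
        then have i: "icolour S ?j e < ncol S"
          using icolour_less[OF j] by (auto simp: incident_def)
        show "1 / (bR * t ^ (m + c0)) \<le> 1 / R (m + c0) (icolour S ?j e)"
          using R i Rpos[OF i, of "m + c0"] bR t by (intro divide_left_mono) auto
      qed
      also note star
      also have "(\<Sum>e\<in>?I. 2 * A (icolour S ?j e) (m + c0)) \<le> (\<Sum>e\<in>?I. 2 * (bA * l ^ (m + c0)))"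
      proof (intro sum_mono mult_left_mono)
        fix e
        assume "e \<in> ?I"
        then have i: "icolour S ?j e < ncol S"
          using icolour_less[OF j] by (auto simp: incident_def)
        show "A (icolour S ?j e) (m + c0) \<le> bA * l ^ (m + c0)"
          using A i by blast
      qed simp
      also have "\<dots> = card ?I * (2 * bA * l ^ (m + c0))"
        by simp
      finally have "real (card ?I) * (U * (1 / (bR * t ^ (m + c0)))) \<le> real (card ?I) * (2 * bA * l ^ (m + c0))"
        by (simp only: mult.left_commute)
      \<comment> \<open>The degree of \<open>v\<close> occurs linearly on both sides and
        cancels.\<close>
      then have "U * (1 / (bR * t ^ (m + c0))) \<le> 2 * bA * l ^ (m + c0)"
        using D by (rule mult_left_le_imp_le)
      then have "U \<le> 2 * bA * l ^ (m + c0) * (bR * t ^ (m + c0))"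
        using bR t by (simp add: field_simps)
      also have "\<dots> = C1 * l ^ m * t ^ m"
        by (simp add: C1_def power_add power_mult_distrib mult_ac)
      finally show ?thesis
        unfolding U_def .
    qed
    have nbrs: "\<forall>x\<in>gball ?H v r. finite (neighbours ?H x) \<and> neighbours ?H x \<noteq> {}"
    proof
      fix x
      assume "x \<in> gball ?H v r"
      then have x: "x \<in> verts ?H"
        by (simp add: gball_def)
      have "finite (verts ?H)"
        using finite_iterate[OF j] by simp
      then show "finite (neighbours ?H x) \<and> neighbours ?H x \<noteq> {}"
        using neighbours_subset[OF wf_iterate[OF j]] neighbours_nonempty[OF j x] by (meson finite_subset)
    qed
    have "expected_exit_time ?H v (gball ?H v r) \<le> ennreal (C1 * l ^ m * t ^ m)"
      unfolding expected_exit_time_eq_SUP[OF nbrs] using upper by (intro SUP_least ennreal_leI)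
    moreover have "ennreal (c1 * l ^ m * t ^ m) \<le> expected_exit_time ?H v (gball ?H v r)"
    proof -
      \<comment> \<open>The finer level for the lower bound: its copies have level m - c0 = p + 1.
        The lower limit on m leaves room for the extra substitution producing the corner
        arcs.\<close>
      define N where "N = n - m + c0"
      define p where "p = m - c0 - 1"
      have N: "N + Suc p = n" "k \<le> N" "Suc p + c0 = m"
        using m by (auto simp: N_def p_def)
      have vN: "v \<in> verts (iterate_graph S ?j N)"
        using vk verts_mono[OF N(2)] by blast
      let ?I = "incident ?j N v"
      have D: "0 < real (card ?I)"
        using card_incident_pos[OF j vN] by simp
      have near: "\<forall>i<ncol S. real (gdiam (iterate_graph S i (Suc p))) < r"
      proof (intro allI impI)
        fix i
        assume i: "i < ncol S"
        have "Cd * \<rho> ^ Suc p = Cd / \<rho> ^ c0 * \<rho> ^ m"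
          using rpos[of c0] unfolding N(3)[symmetric] by (simp add: power_add field_simps)
        \<comment> \<open>The first condition on c0; with \<rho> >= 1 the factor 1 / (4 \<rho>)
          makes the comparison with \<open>r\<close> strict, as the open ball requires.\<close>
        also have "\<dots> \<le> cd / (4 * \<rho>) * \<rho> ^ m"
          using lev2 rpos[of m] by (intro mult_right_mono) auto
        also have "\<dots> < cd * \<rho> ^ m"
        proof (rule mult_strict_right_mono[OF _ rpos])
          show "cd / (4 * \<rho>) < cd"
            using cd \<rho> by (simp add: divide_less_eq)
        qed
        finally show "real (gdiam (iterate_graph S i (Suc p))) < r"
          using diam[OF i, of "Suc p"] r(2) by linarith
      qed
      \<comment> \<open>The upper bound just proved serves as the finiteness premise of the lower
        bound.\<close>
      have bdd: "truncated_exit (iterate_graph S ?j (N + Suc p)) (gball (iterate_graph S ?j (N + Suc p)) v r) q v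
          \<le> C1 * l ^ m * t ^ m" for q
        unfolding N(1) by (rule upper)
      have kp: "\<forall>i<ncol S. \<forall>k<ncol S. (resistance_map S ^^ p) (\<lambda>_. 1) i \<le> \<kappa> * (resistance_map S ^^ p) (\<lambda>_. 1) k"
        using \<kappa>(2) unfolding R_def by blast
      have b0: "0 \<le> aA * l ^ p"
        using aA l by simp
      have b: "\<forall>i<ncol S. aA * l ^ p \<le> real (card (arcs (iterate_graph S i p)))"
        using A unfolding A_def by blast
      obtain T where T: "0 \<le> T" "expected_exit_time ?H v (gball ?H v r) = ennreal T"
        "card ?I * (2 * (aA * l ^ p) / (real arcs_total * \<kappa>))
          \<le> T * (\<Sum>e\<in>?I. 1 / R (Suc p) (icolour S ?j e))"
        using expected_exit_star_lower[OF j vN near bdd \<kappa>(1) kp b0 b] unfolding N(1) R_def by (elim exE conjE)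
      have "real (card ?I) * (2 * (aA * l ^ p) * \<delta>) \<le> T * (\<Sum>e\<in>?I. 1 / R (Suc p) (icolour S ?j e))"
        using T(3) by (simp add: \<delta>_def)
      also have "\<dots> \<le> T * (\<Sum>e\<in>?I. 1 / (aR * t ^ Suc p))"
      proof (intro mult_left_mono sum_mono T(1))
        fix e
        assume "e \<in> ?I"
        then have i: "icolour S ?j e < ncol S"
          using icolour_less[OF j] by (auto simp: incident_def)
        have "aR * t ^ Suc p \<le> R (Suc p) (icolour S ?j e)" "0 < aR * t ^ Suc p"
          using R i aR t by (blast, simp)
        then show "1 / R (Suc p) (icolour S ?j e) \<le> 1 / (aR * t ^ Suc p)"
          by (intro divide_left_mono) auto
      qed
      also have "\<dots> = real (card ?I) * (T * (1 / (aR * t ^ Suc p)))"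
        by (simp del: power_Suc)
      finally have "2 * (aA * l ^ p) * \<delta> \<le> T * (1 / (aR * t ^ Suc p))"
        using D by (rule mult_left_le_imp_le)
      then have "2 * (aA * l ^ p) * \<delta> * (aR * t ^ Suc p) \<le> T"
        using aR t by (simp add: field_simps del: power_Suc)
      moreover have "c1 * l ^ m * t ^ m = 2 * (aA * l ^ p) * \<delta> * (aR * t ^ Suc p)"
      proof -
        define X where "X = (l * t) ^ c0"
        have X: "0 < X"
          using l t by (simp add: X_def)
        have "l ^ m * t ^ m = (l * X) * (l ^ p * t ^ Suc p)"
          unfolding N(3)[symmetric] X_def by (simp add: power_add power_mult_distrib)
        then have "c1 * l ^ m * t ^ m = c1 * (l * X) * (l ^ p * t ^ Suc p)"
          by (simp only: mult.assoc)
        also have "c1 * (l * X) = 2 * \<delta> * aR * aA"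
          using X l by (simp add: c1_def X_def[symmetric])
        finally show ?thesis
          by (simp only: mult_ac)
      qed
      ultimately show ?thesis
        unfolding T(2) by (intro ennreal_leI) simp
    qed
    ultimately show ?thesis
      unfolding Xi_def by (intro conjI)
  qed
  have bounds: "\<forall>(n::nat) (k::nat) (m::nat) (r::real). \<forall>v \<in> born_at S k.
       k \<le> n \<longrightarrow> int c0 + 1 \<le> int m \<longrightarrow> int m \<le> int n - int k - int c0 \<longrightarrow> r > 0 \<longrightarrow>
       cd * rho_min S ^ m \<le> r \<longrightarrow> r \<le> Cd * rho_min S ^ m \<longrightarrow>
       ennreal (c1 * rho (edge_matrix S) ^ m * rho_resistance S ^ m)
         \<le> expected_exit_time (Xi S n) v (gball (Xi S n) v r) \<and>
       expected_exit_time (Xi S n) v (gball (Xi S n) v r)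
         \<le> ennreal (C1 * rho (edge_matrix S) ^ m * rho_resistance S ^ m)"
  proof (intro allI ballI impI)
    fix n k m :: nat and r :: real and v
    assume "v \<in> born_at S k" "int c0 + 1 \<le> int m" "int m \<le> int n - int k - int c0"
      "0 < r" "cd * rho_min S ^ m \<le> r" "r \<le> Cd * rho_min S ^ m"
    then show "ennreal (c1 * rho (edge_matrix S) ^ m * rho_resistance S ^ m)
         \<le> expected_exit_time (Xi S n) v (gball (Xi S n) v r) \<and>
       expected_exit_time (Xi S n) v (gball (Xi S n) v r)
         \<le> ennreal (C1 * rho (edge_matrix S) ^ m * rho_resistance S ^ m)"
      using main[of v k m n r] unfolding l_def t_def \<rho>_def by simp
  qed
  show ?thesis
    by (rule exI[of _ c1], rule exI[of _ C1]) (rule conjI[OF pos(2) conjI[OF pos(1) bounds]])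
qed

end
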